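(* Let $(G_n)$ be a sequence of finite simple graphs with $|G_n|\to\infty$, let $F$ be a fixed graph with vertex set $[k]$, $k>1$, let $0<p<1$ and let $0<\gamma<1$. Suppose that there is a sequence $\varepsilon_n\to0$ such that for every $n$ and all subsets $U_1,\dots,U_k\subseteq V(G_n)$ with $|U_i|=\lfloor\gamma|G_n|\rfloor$ for each $i$, $$\Bigl|N^*(F,G_n;U_1,\dots,U_k)-p^{e(F)}(1-p)^{\binom k2-e(F)}\prod_{i=1}^k|U_i|\Bigr|\le\varepsilon_n|G_n|^k.$$ Then $(G_n)$ is $[p,\bar p]$-quasi-random. Alternatively, if $\gamma<1/k$, the same conclusion holds if this estimate is only assumed for all such $U_1,\dots,U_k$ that in addition are pairwise disjoint.
   Context: Graphs are finite, undirected and simple. For a graph $F$ on $[k]$, a graph $G$ and $U_1,\dots,U_k\subseteq V(G)$, $N^*(F,G;U_1,\dots,U_k)$ is the number of injective maps $\varphi:V(F)\to V(G)$ with $\varphi(i)\in U_i$ for all $i$ such that for all $i\ne j$, $ij\in E(F)$ iff $\varphi(i)\varphi(j)\in E(G)$ (induced labelled copies). $N(F,G)$ denotes the number of injective homomorphisms $V(F)\to V(G)$. A sequence $(G_n)$ with $|G_n|\to\infty$ is $q$-quasi-random if $N(H,G_n)=(q^{e(H)}+o(1))|G_n|^{|H|}$ for every graph $H$. Let $\beta_F(q)=q^{e(F)}(1-q)^{\binom k2-e(F)}$. If $F$ is neither empty nor complete, let $p_F=e(F)/\binom k2$; for $q\ne p_F$ the conjugate $\bar q$ is the unique other number in $[0,1]$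 with $\beta_F(\bar q)=\beta_F(q)$ (note $\beta_F$ increases on $[0,p_F]$ and decreases on $[p_F,1]$), and $\bar q=q$ if $q=p_F$ or if $F$ is empty or complete. A sequence $(G_n)$ is $[p,\bar p]$-quasi-random if $\mathbb N$ can be partitioned into sets $I_1,I_2$ such that $(G_n)_{n\in I_1}$ is $p$-quasi-random (if $I_1$ is infinite) and $(G_n)_{n\in I_2}$ is $\bar p$-quasi-random (if $I_2$ is infinite). *)

theory Defs
  imports Complex_Main "HOL-Library.FuncSet" "HOL-Library.Infinite_Set"
    "HOL-Library.Disjoint_Sets" "HOL-Library.Landau_Symbols"
begin

record 'a sgraph =
  vertices :: "'a set"
  edge_set :: "'a set set"

definition vertex_pairs :: "'a set \<Rightarrow> 'a set set" where
  "vertex_pairs V = {e. e \<subseteq> V \<and> card e = 2}"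

definition simple_graph :: "'a sgraph \<Rightarrow> bool" where
  "simple_graph G \<longleftrightarrow> finite (vertices G) \<and> edge_set G \<subseteq> vertex_pairs (vertices G)"

definition num_verts :: "'a sgraph \<Rightarrow> nat" where
  "num_verts G = card (vertices G)"

definition num_edges :: "'a sgraph \<Rightarrow> nat" where
  "num_edges G = card (edge_set G)"

definition empty_graph :: "'a sgraph \<Rightarrow> bool" where
  "empty_graph G \<longleftrightarrow> edge_set G = {}"

definition complete_graph :: "'a sgraph \<Rightarrow> bool" where
  "complete_graph G \<longleftrightarrow> edge_set G = vertex_pairs (vertices G)"

text \<open>Maps between vertex sets are taken from the extensional function space
  (value \<^term>\<open>undefined\<close> outside the domain), so that each map is counted once.\<close>

definition inj_hom_count :: "'b sgraph \<Rightarrow> 'a sgraph \<Rightarrow> nat" where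
  "inj_hom_count F G = card {\<phi> \<in> vertices F \<rightarrow>\<^sub>E vertices G. inj_on \<phi> (vertices F) \<and>
     (\<forall>i \<in> vertices F. \<forall>j \<in> vertices F. {i, j} \<in> edge_set F \<longrightarrow> {\<phi> i, \<phi> j} \<in> edge_set G)}"

definition induced_count :: "'b sgraph \<Rightarrow> 'a sgraph \<Rightarrow> ('b \<Rightarrow> 'a set) \<Rightarrow> nat" where
  "induced_count F G U = card {\<phi> \<in> vertices F \<rightarrow>\<^sub>E vertices G. inj_on \<phi> (vertices F) \<and>
     (\<forall>i \<in> vertices F. \<phi> i \<in> U i) \<and>
     (\<forall>i \<in> vertices F. \<forall>j \<in> vertices F. i \<noteq> j \<longrightarrow>
        ({i, j} \<in> edge_set F \<longleftrightarrow> {\<phi> i, \<phi> j} \<in> edge_set G))}"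

text \<open>Every finite graph is isomorphic to one with vertices in \<^typ>\<open>nat\<close>, so it suffices
  to let the test graph range over those.\<close>

definition quasi_random :: "real \<Rightarrow> (nat \<Rightarrow> 'a sgraph) \<Rightarrow> bool" where
  "quasi_random q G \<longleftrightarrow>
     filterlim (\<lambda>n. num_verts (G n)) at_top sequentially \<and>
     (\<forall>H :: nat sgraph. simple_graph H \<longrightarrow>
        (\<lambda>n. real (inj_hom_count H (G n)) - q ^ num_edges H * real (num_verts (G n)) ^ num_verts H)
          \<in> o(\<lambda>n. real (num_verts (G n)) ^ num_verts H))"

definition beta_fun :: "'b sgraph \<Rightarrow> real \<Rightarrow> real" where
  "beta_fun F q = q ^ num_edges F * (1 - q) ^ ((num_verts F choose 2) - num_edges F)"

definition edge_density :: "'b sgraph \<Rightarrow> real" where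
  "edge_density F = real (num_edges F) / real (num_verts F choose 2)"

definition conjugate_density :: "'b sgraph \<Rightarrow> real \<Rightarrow> real" where
  "conjugate_density F q =
     (if empty_graph F \<or> complete_graph F \<or> q = edge_density F then q
      else (THE r. r \<in> {0..1} \<and> r \<noteq> q \<and> beta_fun F r = beta_fun F q))"

text \<open>The subsequence indexed by an infinite set \<open>I\<close> of naturals is
  \<open>G \<circ> enumerate I\<close>, where \<^term>\<open>enumerate I\<close> lists \<open>I\<close> increasingly.\<close>

definition quasi_random2 :: "real \<Rightarrow> real \<Rightarrow> (nat \<Rightarrow> 'a sgraph) \<Rightarrow> bool" where
  "quasi_random2 p p' G \<longleftrightarrow>
     (\<exists>I\<^sub>1 I\<^sub>2 :: nat set. I\<^sub>1 \<union> I\<^sub>2 = UNIV \<and> I\<^sub>1 \<inter> I\<^sub>2 = {} \<and>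
        (infinite I\<^sub>1 \<longrightarrow> quasi_random p (G \<circ> enumerate I\<^sub>1)) \<and>
        (infinite I\<^sub>2 \<longrightarrow> quasi_random p' (G \<circ> enumerate I\<^sub>2)))"

end

theory Submission
  imports Defs "HOL-Analysis.Convex"
begin

text \<open>The graph is replaced by the step kernel \<open>W\<close> of block densities of a regular labelling of its
  vertices. The counting hypothesis passes from sets of the prescribed size to all small disjoint
  boxes, and regularity then turns it into an \<open>L\<^sup>1\<close> statement: the product
  \<open>\<Psi>\<close> over all pairs of \<open>F\<close> of \<open>W\<close> (edges) and \<open>1 - W\<close> (non-edges) is close to the constant
  \<open>\<beta>\<close>. Exchanging the vertices at the two ends of one pair shows that
  \<open>M(a,b) M(a',b') \<approx> M(a',b) M(a,b')\<close> for \<open>M = W\<close> if \<open>F\<close> has an edge and for \<open>M = 1 - W\<close> if it has a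
  non-edge, i.e. with \<open>\<mu>\<close> the mean and \<open>f\<close> the degree function, \<open>\<mu> W(a,b) \<approx> f(a) f(b)\<close>, respectively
  \<open>(1 - \<mu>) (1 - W(a,b)) \<approx> (1 - f(a)) (1 - f(b))\<close>. Both together give
  \<open>(f(a) - \<mu>) (f(b) - \<mu>) \<approx> 0\<close>, so \<open>f \<approx> \<mu>\<close> and \<open>W \<approx> \<mu>\<close>; if only one of them is available,
  moving a single vertex of \<open>F\<close> shows that \<open>f\<close> is nearly constant. Finally \<open>\<beta>\<^sub>F(\<mu>) \<approx> \<beta>\<^sub>F(p)\<close> forces
  \<open>\<mu>\<close> to be near \<open>p\<close> or its conjugate.\<close>

section \<open>Counts in boxes of arbitrary size\<close>

text \<open>The hypothesis bounds signed sums over single boxes, while the argument needs the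
  absolute deviation of \<Psi> from \<beta>. For a step kernel, \<Psi> is constant on the box of
  each tuple of blocks, so the absolute value is multiplication by a sign that depends on the labels
  alone. The regularity notion therefore tests against every such sign; closeness in the cut norm
  alone would lose a factor depending on the number of blocks. Tuples with a repeated label lie in
  boxes that are not disjoint and are given up; starting from many small classes makes them
  negligible. The order of choices is forced: the accuracy of regularity, the number of initial
  classes, the bound M on the final number of blocks, and only then the admissible error per box,
  because M^k boxes are added up. Positivity of \<beta> enters as a lower bound for the factors that
  are divided out when two ends are exchanged.\<close>

lemma sum_PiE_split:
  assumes "i \<in> I"
  shows "(\<Sum>x\<in>PiE I U. f x) = (\<Sum>a\<in>U i. \<Sum>x\<in>PiE (I - {i}) U. f (x(i := a)))"
proof -
  have I: "I = insert i (I - {i})"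
    using assms by auto
  have "(\<Sum>x\<in>PiE I U. f x) = (\<Sum>x\<in>(\<lambda>(y, g). g(i := y)) ` (U i \<times> PiE (I - {i}) U). f x)"
    by (subst I, subst PiE_insert_eq) simp
  also have "\<dots> = (\<Sum>(a, x)\<in>U i \<times> PiE (I - {i}) U. f (x(i := a)))"
    by (subst sum.reindex[OF inj_combinator]) (auto intro: sum.cong)
  finally show ?thesis
    by (simp add: sum.cartesian_product)
qed

lemma sum_PiE_split2:
  assumes "i \<in> I" "j \<in> I" "i \<noteq> j"
  shows "(\<Sum>x\<in>I \<rightarrow>\<^sub>E V. f x) =
    (\<Sum>x\<in>I - {i, j} \<rightarrow>\<^sub>E V. \<Sum>a\<in>V. \<Sum>b\<in>V. f (x(i := a, j := b)))"
proof -
  have eq: "I - {j} - {i} = I - {i, j}"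
    by auto
  have "(\<Sum>x\<in>I \<rightarrow>\<^sub>E V. f x) = (\<Sum>b\<in>V. \<Sum>x\<in>I - {j} \<rightarrow>\<^sub>E V. f (x(j := b)))"
    using assms by (subst sum_PiE_split[where i = j]) auto
  also have "\<dots> = (\<Sum>b\<in>V. \<Sum>a\<in>V. \<Sum>x\<in>I - {i, j} \<rightarrow>\<^sub>E V. f (x(i := a, j := b)))"
    using assms by (subst sum_PiE_split[where i = i]) (auto simp: eq)
  also have "\<dots> = (\<Sum>b\<in>V. \<Sum>x\<in>I - {i, j} \<rightarrow>\<^sub>E V. \<Sum>a\<in>V. f (x(i := a, j := b)))"
    by (intro sum.cong sum.swap refl)
  also have "\<dots> = (\<Sum>x\<in>I - {i, j} \<rightarrow>\<^sub>E V. \<Sum>b\<in>V. \<Sum>a\<in>V. f (x(i := a, j := b)))"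
    by (rule sum.swap)
  also have "\<dots> = (\<Sum>x\<in>I - {i, j} \<rightarrow>\<^sub>E V. \<Sum>a\<in>V. \<Sum>b\<in>V. f (x(i := a, j := b)))"
    by (intro sum.cong sum.swap refl)
  finally show ?thesis .
qed

lemma card_funcset: "finite I \<Longrightarrow> card (I \<rightarrow>\<^sub>E V) = card V ^ card I"
  by (simp add: card_PiE)

text \<open>Discarding an element of least value never lowers the average, so after enough deletions
  the survivors still have at least the average of \<open>D\<close>. The product form avoids
  dividing by \<open>c\<close> or \<open>card D\<close>, either of which may be 0.\<close>

lemma exists_subset_sum_ge_average:
  fixes t :: "'a \<Rightarrow> real"
  assumes "finite D" "c \<le> card D"
  shows "\<exists>C\<subseteq>D. card C = c \<and> real c * sum t D \<le> real (card D) * sum t C"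
  using assms
proof (induction "card D" arbitrary: D)
  case 0
  then show ?case by auto
next
  case (Suc d)
  show ?case
  proof (cases "c = card D")
    case False
    have ne: "D \<noteq> {}"
      using Suc.hyps by auto
    obtain x where x: "x \<in> D" "\<And>y. y \<in> D \<Longrightarrow> t x \<le> t y"
      using ex_is_arg_min_if_finite[OF Suc.prems(1) ne, of t]
      by (auto simp: is_arg_min_linorder)
    have d: "card (D - {x}) = d" "c \<le> d"
      using x Suc False by auto
    obtain C where C: "C \<subseteq> D - {x}" "card C = c" "real c * sum t (D - {x}) \<le> real d * sum t C"
      using Suc.hyps(1)[of "D - {x}"] d Suc.prems by auto
    have sD: "sum t D = t x + sum t (D - {x})"
      using x Suc.prems by (simp add: sum.remove)
    have avg: "real d * t x \<le> sum t (D - {x})"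
      using sum_bounded_below[of "D - {x}" "t x" t] x d by auto
    have cx: "real c * t x \<le> sum t C"
      using sum_bounded_below[of C "t x" t] x C by auto
    have "real c * sum t D \<le> real c * t x + real d * sum t C"
      using C by (simp add: sD algebra_simps)
    also have "\<dots> \<le> sum t C + real d * sum t C"
      using cx by simp
    also have "\<dots> = real (card D) * sum t C"
      using Suc.hyps(2) by (simp add: algebra_simps flip: Suc.hyps(2))
    finally show ?thesis
      using C by auto
  qed auto
qed

text \<open>Fill \<open>A\<close> up to size \<open>m\<close> with a set \<open>C\<close> whose
  average is at least that of \<open>V - A\<close>. The sum over the union is at most \<delta>, and
  the sum over \<open>C\<close> is bounded below through the sum over \<open>V\<close>, which cannot
  be very negative because some m-set has at most the average sum. The multiples of
  \<open>sum t A\<close> combine to (N - a) - (m - a) = N - m.\<close>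

lemma sum_le_from_fixed_size:
  fixes t :: "'a \<Rightarrow> real"
  assumes fin: "finite V" and A: "A \<subseteq> V" "card A \<le> m" and m: "m < card V"
    and bound: "\<And>S. S \<subseteq> V \<Longrightarrow> card S = m \<Longrightarrow> \<bar>sum t S\<bar> \<le> \<delta>"
  shows "real (card V - m) * sum t A \<le> 2 * real (card V) * \<delta>"
proof (cases "m = 0")
  case True
  then have "A = {}"
    using A fin by (auto dest: finite_subset)
  moreover have "0 \<le> \<delta>"
    using bound[of "{}"] True by simp
  ultimately show ?thesis by simp
next
  case False
  define N a where "N = card V" and "a = card A"
  have finA: "finite A"
    using A fin by (auto dest: finite_subset)
  have le: "a \<le> m" "m < N"
    using A m by (auto simp: N_def a_def)
  have cD: "card (V - A) = N - a"
    using A fin finA by (simp add: card_Diff_subset N_def a_def)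
  have sD: "sum t (V - A) = sum t V - sum t A"
    using A fin by (simp add: sum_diff)
  obtain C where C: "C \<subseteq> V - A" "card C = m - a"
    "real (m - a) * sum t (V - A) \<le> real (N - a) * sum t C"
    using exists_subset_sum_ge_average[of "V - A" "m - a" t] fin diff_le_mono[of m N a] le
    unfolding cD by auto
  have finC: "finite C"
    using C fin by (auto dest: finite_subset)
  have "card (A \<union> C) = m"
    using C finA finC le by (subst card_Un_disjoint) (auto simp: a_def)
  moreover have "sum t (A \<union> C) = sum t A + sum t C"
    using C finA finC by (intro sum.union_disjoint) auto
  ultimately have "sum t A + sum t C \<le> \<delta>"
    using bound[of "A \<union> C"] A C by fastforce
  then have 1: "real (N - a) * sum t A + real (N - a) * sum t C \<le> real (N - a) * \<delta>"
    by (metis distrib_left mult_left_mono of_nat_0_le_iff)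
  obtain S where S: "S \<subseteq> V" "card S = m"
    "real m * sum (\<lambda>x. - t x) V \<le> real N * sum (\<lambda>x. - t x) S"
    using exists_subset_sum_ge_average[of V m "\<lambda>x. - t x"] fin le by (auto simp: N_def)
  have \<delta>: "0 \<le> \<delta>"
    using bound[OF S(1,2)] by simp
  have "- (real m * sum t V) \<le> real N * (- sum t S)"
    using S by (simp add: sum_negf)
  also have "\<dots> \<le> real N * \<delta>"
    using bound[OF S(1,2)] by (intro mult_left_mono) auto
  finally have 2: "- (real m * sum t V) \<le> real N * \<delta>" .
  \<comment> \<open>The sign of \<open>sum t V\<close> is unknown: if it is positive the left side
    is not, and otherwise replacing \<open>m - a\<close> by \<open>m\<close> only enlarges
    it.\<close>
  have 3: "- (real (m - a) * sum t V) \<le> real N * \<delta>"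
  proof (cases "sum t V \<le> 0")
    case True
    then have "- (real (m - a) * sum t V) \<le> - (real m * sum t V)"
      by (simp add: mult_right_mono_neg)
    then show ?thesis using 2 by simp
  next
    case False
    then have "0 \<le> real (m - a) * sum t V"
      by simp
    moreover have "0 \<le> real N * \<delta>"
      using \<delta> by simp
    ultimately show ?thesis by linarith
  qed
  have "real (N - a) * \<delta> \<le> real N * \<delta>"
    using \<delta> by (intro mult_right_mono) auto
  then show ?thesis
    using 1 3 C(3) le unfolding sD N_def[symmetric]
    by (simp add: of_nat_diff algebra_simps)
qed

lemma abs_sum_le_from_fixed_size:
  fixes t :: "'a \<Rightarrow> real"
  assumes "finite V" "A \<subseteq> V" "card A \<le> m" "m < card V"
    and "\<And>S. S \<subseteq> V \<Longrightarrow> card S = m \<Longrightarrow> \<bar>sum t S\<bar> \<le> \<delta>"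
  shows "real (card V - m) * \<bar>sum t A\<bar> \<le> 2 * real (card V) * \<delta>"
proof -
  have "real (card V - m) * sum t A \<le> 2 * real (card V) * \<delta>"
    using assms by (rule sum_le_from_fixed_size)
  moreover have "real (card V - m) * sum (\<lambda>x. - t x) A \<le> 2 * real (card V) * \<delta>"
    using assms by (intro sum_le_from_fixed_size) (auto simp: sum_negf)
  ultimately show ?thesis
    by (auto simp: abs_if sum_negf)
qed

text \<open>Sizes are relaxed one coordinate at a time. With the other boxes frozen the sum is
  additive in the remaining one, so \<open>abs_sum_le_from_fixed_size\<close> applies and costs a
  factor 2 |V| / r. The flag \<open>D\<close> lets one induction serve both forms of the hypothesis,
  with arbitrary and with pairwise disjoint sets.\<close>

lemma sum_box_le_from_fixed_size:
  fixes f :: "('i \<Rightarrow> 'a) \<Rightarrow> real"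
  assumes fin: "finite V" "finite I" and r: "0 < r"
    and room: "(if D then card I * m else m) + r \<le> card V"
    and bound: "\<And>U. (\<And>i. i \<in> I \<Longrightarrow> U i \<subseteq> V \<and> card (U i) = m) \<Longrightarrow>
      (D \<Longrightarrow> disjoint_family_on U I) \<Longrightarrow> \<bar>\<Sum>x\<in>PiE I U. f x\<bar> \<le> \<delta>"
    and U: "\<And>i. i \<in> I \<Longrightarrow> U i \<subseteq> V \<and> card (U i) \<le> m" "D \<Longrightarrow> disjoint_family_on U I"
  shows "\<bar>\<Sum>x\<in>PiE I U. f x\<bar> \<le> (2 * real (card V) / real r) ^ card I * \<delta>"
proof -
  define c where "c = 2 * real (card V) / real r"
  have "\<bar>\<Sum>x\<in>PiE I U. f x\<bar> \<le> c ^ card J * \<delta>"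
    if "J \<subseteq> I" "\<And>i. i \<in> I \<Longrightarrow> U i \<subseteq> V \<and> card (U i) \<le> m"
      "\<And>i. i \<in> I - J \<Longrightarrow> card (U i) = m" "D \<Longrightarrow> disjoint_family_on U I" for J U
  proof -
    have "finite J"
      using that(1) fin by (auto dest: finite_subset)
    then show ?thesis
      using that
    proof (induction J arbitrary: U)
      case empty
      then show ?case
        using bound by simp
    next
      case (insert i J)
      \<comment> \<open>Under \<open>D\<close> the i-th box may only vary inside the complement of
        the other boxes; \<open>room\<close> leaves at least m + r vertices there.\<close>
      define W where "W = (if D then V - (\<Union>j\<in>I - {i}. U j) else V)"
      have i: "i \<in> I"
        using insert.prems by auto
      have W: "W \<subseteq> V" "finite W"
        using fin by (auto simp: W_def)
      have cW: "m + r \<le> card W"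
      proof (cases D)
        case True
        have "card (\<Union>j\<in>I - {i}. U j) \<le> (\<Sum>j\<in>I - {i}. card (U j))"
          using fin by (intro card_UN_le) auto
        also have "\<dots> \<le> (\<Sum>j\<in>I - {i}. m)"
          using insert.prems by (intro sum_mono) auto
        also have "\<dots> = card I * m - m"
          using i fin by (simp add: diff_mult_distrib)
        finally have "card V - (card I * m - m) \<le> card W"
          using True fin diff_card_le_card_Diff[of "\<Union>j\<in>I - {i}. U j" V]
            finite_subset[of _ V] insert.prems(2)
          by (simp add: W_def)
        moreover have "m \<le> card I * m"
          using i fin by (cases "card I") auto
        ultimately show ?thesis
          using room True by auto
      qed (use room in \<open>auto simp: W_def\<close>)
      define t where "t a = (\<Sum>x\<in>PiE (I - {i}) U. f (x(i := a)))" for a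
      have split: "(\<Sum>x\<in>PiE I (U(i := S)). f x) = sum t S" for S
      proof -
        have "PiE (I - {i}) (U(i := S)) = PiE (I - {i}) U"
          by (intro PiE_cong) auto
        then show ?thesis
          using i by (simp add: sum_PiE_split[where i = i] t_def)
      qed
      have Ui: "U i \<subseteq> W"
        using insert.prems(2)[OF i] insert.prems(4) i
        by (auto simp: W_def disjoint_family_on_def)
      have "real (card W - m) * \<bar>sum t (U i)\<bar> \<le> 2 * real (card W) * (c ^ card J * \<delta>)"
      proof (rule abs_sum_le_from_fixed_size)
        fix S assume S: "S \<subseteq> W" "card S = m"
        have "\<bar>\<Sum>x\<in>PiE I (U(i := S)). f x\<bar> \<le> c ^ card J * \<delta>"
        proof (rule insert.IH)
          assume D
          then show "disjoint_family_on (U(i := S)) I"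
            using S insert.prems(4) by (auto simp: disjoint_family_on_def W_def)
        qed (use S W insert.prems in auto)
        then show "\<bar>sum t S\<bar> \<le> c ^ card J * \<delta>"
          by (simp add: split)
      qed (use W Ui insert.prems(2)[OF i] cW r in auto)
      moreover have "sum t (U i) = (\<Sum>x\<in>PiE I U. f x)"
        using split[of "U i"] by simp
      ultimately have 1: "real (card W - m) * \<bar>\<Sum>x\<in>PiE I U. f x\<bar> \<le> 2 * real (card W) * (c ^ card J * \<delta>)"
        by simp
      have 2: "real r * \<bar>\<Sum>x\<in>PiE I U. f x\<bar> \<le> real (card W - m) * \<bar>\<Sum>x\<in>PiE I U. f x\<bar>"
        using cW by (intro mult_right_mono) auto
      \<comment> \<open>\<delta> is not assumed nonnegative; the sign needed for enlarging |W| to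
        |V| is read off from the inequality itself.\<close>
      have "0 \<le> real (card W - m) * \<bar>\<Sum>x\<in>PiE I U. f x\<bar>"
        by simp
      then have "0 \<le> 2 * real (card W) * (c ^ card J * \<delta>)"
        using 1 by linarith
      then have "0 \<le> c ^ card J * \<delta>"
        using cW r by (simp add: zero_le_mult_iff)
      then have 3: "2 * real (card W) * (c ^ card J * \<delta>) \<le> 2 * real (card V) * (c ^ card J * \<delta>)"
        using W fin by (intro mult_right_mono) (auto intro: card_mono)
      have "2 * real (card V) = real r * c"
        using r by (simp add: c_def)
      then have "real r * \<bar>\<Sum>x\<in>PiE I U. f x\<bar> \<le> real r * (c * (c ^ card J * \<delta>))"
        using 1 2 3 by (simp add: mult.assoc)
      then have "\<bar>\<Sum>x\<in>PiE I U. f x\<bar> \<le> c * (c ^ card J * \<delta>)"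
        using r by simp
      then show ?case
        using insert.hyps by simp
    qed
  qed
  from this[of I U] show ?thesis
    using U by (auto simp: c_def)
qed

section \<open>A regularity lemma with label-dependent signs\<close>

text \<open>If a class is empty the quotient is 0, so the value stays in [0, 1] for all labels,
  whether they occur or not.\<close>

definition block_mean :: "'a set \<Rightarrow> ('a \<Rightarrow> nat) \<Rightarrow> ('a \<Rightarrow> 'a \<Rightarrow> real) \<Rightarrow> nat \<Rightarrow> nat \<Rightarrow> real" where
  "block_mean V P g A B = (\<Sum>x\<in>{x\<in>V. P x = A}. \<Sum>y\<in>{y\<in>V. P y = B}. g x y)
     / (real (card {x\<in>V. P x = A}) * real (card {y\<in>V. P y = B}))"

definition energy :: "'a set \<Rightarrow> ('a \<Rightarrow> nat) \<Rightarrow> ('a \<Rightarrow> 'a \<Rightarrow> real) \<Rightarrow> real" where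
  "energy V P g = (\<Sum>x\<in>V. \<Sum>y\<in>V. (block_mean V P g (P x) (P y))\<^sup>2)"

text \<open>Stronger than cut-norm regularity and weaker than Szemeredi's: \<open>X\<close> and
  \<open>Y\<close> are common to all blocks, but the sign may change from block to block, so the
  discrepancies of different blocks cannot cancel. The number of labels stays exponential in a power
  of 1/\<eta> instead of a tower.\<close>

definition regular_labelling :: "'a set \<Rightarrow> ('a \<Rightarrow> nat) \<Rightarrow> ('a \<Rightarrow> 'a \<Rightarrow> real) \<Rightarrow> real \<Rightarrow> bool" where
  "regular_labelling V P g \<eta> \<longleftrightarrow>
     (\<forall>X Y s. X \<subseteq> V \<longrightarrow> Y \<subseteq> V \<longrightarrow> (\<forall>A B. \<bar>s A B\<bar> \<le> 1) \<longrightarrow>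
       \<bar>\<Sum>x\<in>X. \<Sum>y\<in>Y. (g x y - block_mean V P g (P x) (P y)) * s (P x) (P y)\<bar>
         \<le> \<eta> * (real (card V))\<^sup>2)"

lemma block_mean_unit:
  assumes "\<And>x y. x \<in> V \<Longrightarrow> y \<in> V \<Longrightarrow> 0 \<le> g x y \<and> g x y \<le> 1"
  shows "0 \<le> block_mean V P g A B" "block_mean V P g A B \<le> 1"
proof -
  let ?A = "{x\<in>V. P x = A}" and ?B = "{y\<in>V. P y = B}"
  show "0 \<le> block_mean V P g A B"
    unfolding block_mean_def using assms by (intro divide_nonneg_nonneg sum_nonneg) auto
  have "(\<Sum>x\<in>?A. \<Sum>y\<in>?B. g x y) \<le> (\<Sum>x\<in>?A. \<Sum>y\<in>?B. 1)"
    using assms by (intro sum_mono) auto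
  also have "\<dots> = real (card ?A) * real (card ?B)"
    by simp
  finally show "block_mean V P g A B \<le> 1"
    unfolding block_mean_def
    by (cases "card ?A = 0 \<or> card ?B = 0") (auto simp: divide_le_eq_1_pos zero_less_mult_iff)
qed

lemma block_mean_commute:
  assumes "\<And>x y. x \<in> V \<Longrightarrow> y \<in> V \<Longrightarrow> g x y = g y x"
  shows "block_mean V P g A B = block_mean V P g B A"
proof -
  have "(\<Sum>x\<in>{x\<in>V. P x = A}. \<Sum>y\<in>{y\<in>V. P y = B}. g x y) =
    (\<Sum>x\<in>{x\<in>V. P x = A}. \<Sum>y\<in>{y\<in>V. P y = B}. g y x)"
    using assms by (intro sum.cong) auto
  also have "\<dots> = (\<Sum>y\<in>{y\<in>V. P y = B}. \<Sum>x\<in>{x\<in>V. P x = A}. g y x)"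
    by (rule sum.swap)
  finally show ?thesis
    by (simp add: block_mean_def mult.commute)
qed

text \<open>Taking block means is the orthogonal projection onto the kernels that depend on the
  labels only, so \<open>g\<close> and its block means have the same inner product with each such
  kernel.\<close>

lemma sum_block_mean:
  assumes "finite V"
  shows "(\<Sum>x\<in>V. \<Sum>y\<in>V. g x y * s (P x) (P y)) =
    (\<Sum>x\<in>V. \<Sum>y\<in>V. block_mean V P g (P x) (P y) * s (P x) (P y))"
proof -
  let ?C = "\<lambda>A. {x\<in>V. P x = A}"
  have group: "(\<Sum>x\<in>V. \<Sum>y\<in>V. h x y) = (\<Sum>A\<in>P ` V. \<Sum>B\<in>P ` V. \<Sum>x\<in>?C A. \<Sum>y\<in>?C B. h x y)"
    for h :: "'a \<Rightarrow> 'a \<Rightarrow> real"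
  proof -
    have "(\<Sum>x\<in>V. \<Sum>y\<in>V. h x y) = (\<Sum>A\<in>P ` V. \<Sum>x\<in>?C A. \<Sum>B\<in>P ` V. \<Sum>y\<in>?C B. h x y)"
      by (subst sum.image_gen[OF assms, of _ P]) (intro sum.cong refl sum.image_gen assms)
    also have "\<dots> = (\<Sum>A\<in>P ` V. \<Sum>B\<in>P ` V. \<Sum>x\<in>?C A. \<Sum>y\<in>?C B. h x y)"
      by (intro sum.cong refl sum.swap)
    finally show ?thesis .
  qed
  show ?thesis
    unfolding group
  proof (rule sum.cong[OF refl], rule sum.cong[OF refl])
    fix A B assume "A \<in> P ` V" "B \<in> P ` V"
    then have ne: "card (?C A) \<noteq> 0" "card (?C B) \<noteq> 0"
      using assms by auto
    have "(\<Sum>x\<in>?C A. \<Sum>y\<in>?C B. g x y * s (P x) (P y)) = (\<Sum>x\<in>?C A. \<Sum>y\<in>?C B. g x y) * s A B"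
      by (simp add: sum_distrib_right)
    also have "\<dots> = real (card (?C A)) * real (card (?C B)) * block_mean V P g A B * s A B"
      using ne by (simp add: block_mean_def)
    also have "\<dots> = (\<Sum>x\<in>?C A. \<Sum>y\<in>?C B. block_mean V P g (P x) (P y) * s (P x) (P y))"
      by simp
    finally show "(\<Sum>x\<in>?C A. \<Sum>y\<in>?C B. g x y * s (P x) (P y)) =
      (\<Sum>x\<in>?C A. \<Sum>y\<in>?C B. block_mean V P g (P x) (P y) * s (P x) (P y))" .
  qed
qed

lemma energy_le:
  assumes "\<And>x y. x \<in> V \<Longrightarrow> y \<in> V \<Longrightarrow> 0 \<le> g x y \<and> g x y \<le> 1"
  shows "energy V P g \<le> (real (card V))\<^sup>2"
proof -
  have "energy V P g \<le> (\<Sum>x\<in>V. \<Sum>y\<in>V. 1)"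
    unfolding energy_def using block_mean_unit[of V g, OF assms]
    by (intro sum_mono) (auto simp: power_le_one)
  then show ?thesis
    by (simp add: power2_eq_square)
qed

text \<open>Pythagoras for nested projections: the means over \<open>P\<close> are a function of the
  finer labels \<open>Q\<close>, so the cross term collapses to the energy of
  \<open>P\<close>.\<close>

lemma energy_refinement:
  assumes fin: "finite V" and ref: "\<And>x. x \<in> V \<Longrightarrow> P x = r (Q x)"
  shows "(\<Sum>x\<in>V. \<Sum>y\<in>V. (block_mean V Q g (Q x) (Q y) - block_mean V P g (P x) (P y))\<^sup>2)
    = energy V Q g - energy V P g"
proof -
  let ?q = "\<lambda>x y. block_mean V Q g (Q x) (Q y)" and ?p = "\<lambda>x y. block_mean V P g (P x) (P y)"
  have "(\<Sum>x\<in>V. \<Sum>y\<in>V. ?q x y * ?p x y) =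
      (\<Sum>x\<in>V. \<Sum>y\<in>V. ?q x y * block_mean V P g (r (Q x)) (r (Q y)))"
    using ref by (intro sum.cong) auto
  also have "\<dots> = (\<Sum>x\<in>V. \<Sum>y\<in>V. g x y * block_mean V P g (r (Q x)) (r (Q y)))"
    by (rule sum_block_mean[OF fin, symmetric])
  also have "\<dots> = (\<Sum>x\<in>V. \<Sum>y\<in>V. g x y * ?p x y)"
    using ref by (intro sum.cong) auto
  also have "\<dots> = (\<Sum>x\<in>V. \<Sum>y\<in>V. ?p x y * ?p x y)"
    by (rule sum_block_mean[OF fin])
  finally have cross: "(\<Sum>x\<in>V. \<Sum>y\<in>V. ?q x y * ?p x y) = energy V P g"
    by (simp add: energy_def power2_eq_square)
  have "(\<Sum>x\<in>V. \<Sum>y\<in>V. (?q x y - ?p x y)\<^sup>2) =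
      (\<Sum>x\<in>V. \<Sum>y\<in>V. (?q x y)\<^sup>2 + (?p x y)\<^sup>2 - 2 * (?q x y * ?p x y))"
    by (intro sum.cong refl) (simp add: power2_diff algebra_simps)
  also have "\<dots> = energy V Q g + energy V P g - 2 * (\<Sum>x\<in>V. \<Sum>y\<in>V. ?q x y * ?p x y)"
    by (simp add: energy_def sum.distrib sum_subtractf sum_distrib_left)
  finally show ?thesis
    by (simp add: cross)
qed

text \<open>Two common sets \<open>X\<close>, \<open>Y\<close> serve all blocks, so a refinement only multiplies the number of labels
  by four, and the two new bits of the label record membership in \<open>X\<close> and \<open>Y\<close>.\<close>

lemma energy_increment:
  assumes fin: "finite V" and P: "P ` V \<subseteq> {..<M}" and irr: "\<not> regular_labelling V P g \<eta>" and "0 < \<eta>"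
  shows "\<exists>Q. Q ` V \<subseteq> {..<4 * M} \<and> (\<forall>x. P x = Q x div 4) \<and>
    energy V P g + \<eta>\<^sup>2 * (real (card V))\<^sup>2 \<le> energy V Q g"
proof -
  obtain X Y s where XY: "X \<subseteq> V" "Y \<subseteq> V" and s: "\<And>A B. \<bar>s A B\<bar> \<le> 1"
    and big: "\<eta> * (real (card V))\<^sup>2 <
      \<bar>\<Sum>x\<in>X. \<Sum>y\<in>Y. (g x y - block_mean V P g (P x) (P y)) * s (P x) (P y)\<bar>"
    using irr unfolding regular_labelling_def by (auto simp: not_le)
  define Q where "Q x = 4 * P x + (2 * of_bool (x \<in> X) + of_bool (x \<in> Y))" for x
  have low: "2 * of_bool b + of_bool c < (4 :: nat)" for b c :: bool
    by (cases b; cases c) auto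
  have Pdiv: "P x = Q x div 4" for x
    using low[of "x \<in> X" "x \<in> Y"] by (simp add: Q_def)
  have Qmod: "Q x mod 4 = 2 * of_bool (x \<in> X) + of_bool (x \<in> Y)" for x
    unfolding Q_def by (simp only: mod_mult_self4 mod_less low)
  have inX: "x \<in> X \<longleftrightarrow> 2 \<le> Q x mod 4" for x
    unfolding Qmod by (cases "x \<in> Y") simp_all
  have inY: "x \<in> Y \<longleftrightarrow> odd (Q x)" for x
    unfolding Q_def by simp
  \<comment> \<open>In terms of the new labels the test \<open>s\<close> on the product of
    \<open>X\<close> and \<open>Y\<close> is a function of labels, so \<open>sum_block_mean\<close>
    lets the means over \<open>Q\<close> replace \<open>g\<close>.\<close>
  define t where "t l m = s (l div 4) (m div 4) * of_bool (2 \<le> l mod 4) * of_bool (odd m)" for l m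
  have t: "\<bar>t l m\<bar> \<le> 1" for l m
    using s by (auto simp: t_def abs_mult)
  let ?q = "\<lambda>x y. block_mean V Q g (Q x) (Q y)" and ?p = "\<lambda>x y. block_mean V P g (P x) (P y)"
  let ?D = "\<Sum>(x, y)\<in>V \<times> V. (?q x y - ?p x y) * t (Q x) (Q y)"
  have ind: "(\<Sum>x\<in>V. h x * of_bool (x \<in> Z)) = sum h Z" if "Z \<subseteq> V" for h :: "'a \<Rightarrow> real" and Z
    using that fin by (intro sum.mono_neutral_cong_right) auto
  have "(\<Sum>x\<in>X. \<Sum>y\<in>Y. (g x y - ?p x y) * s (P x) (P y)) =
      (\<Sum>x\<in>V. (\<Sum>y\<in>V. ((g x y - ?p x y) * s (P x) (P y)) * of_bool (y \<in> Y)) * of_bool (x \<in> X))"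
    using XY by (simp only: ind)
  also have "\<dots> = (\<Sum>x\<in>V. \<Sum>y\<in>V. (g x y - ?p x y) * t (Q x) (Q y))"
    unfolding sum_distrib_right
    by (intro sum.cong refl) (simp only: t_def inX inY Pdiv mult_ac)
  also have "\<dots> = (\<Sum>x\<in>V. \<Sum>y\<in>V. g x y * t (Q x) (Q y)) - (\<Sum>x\<in>V. \<Sum>y\<in>V. ?p x y * t (Q x) (Q y))"
    by (simp add: left_diff_distrib sum_subtractf)
  also have "\<dots> = (\<Sum>x\<in>V. \<Sum>y\<in>V. ?q x y * t (Q x) (Q y)) - (\<Sum>x\<in>V. \<Sum>y\<in>V. ?p x y * t (Q x) (Q y))"
    by (subst sum_block_mean[OF fin]) simp
  also have "\<dots> = ?D"
    by (simp add: left_diff_distrib sum_subtractf sum.cartesian_product[symmetric])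
  finally have "\<eta> * (real (card V))\<^sup>2 < \<bar>?D\<bar>"
    using big by simp
  then have "(\<eta> * (real (card V))\<^sup>2)\<^sup>2 \<le> ?D\<^sup>2"
    using \<open>0 < \<eta>\<close> by (intro abs_le_square_iff[THEN iffD1]) auto
  also have "?D\<^sup>2 \<le> (\<Sum>(x, y)\<in>V \<times> V. (?q x y - ?p x y)\<^sup>2) * (\<Sum>(x, y)\<in>V \<times> V. (t (Q x) (Q y))\<^sup>2)"
    using Cauchy_Schwarz_ineq_sum[of "\<lambda>(x, y). ?q x y - ?p x y" "\<lambda>(x, y). t (Q x) (Q y)" "V \<times> V"]
    by (simp add: case_prod_beta)
  also have "\<dots> \<le> (\<Sum>(x, y)\<in>V \<times> V. (?q x y - ?p x y)\<^sup>2) * (\<Sum>(x, y)\<in>V \<times> V. 1)"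
    using t by (intro mult_left_mono sum_mono sum_nonneg) (auto simp: abs_square_le_1)
  also have "\<dots> = (energy V Q g - energy V P g) * (real (card V))\<^sup>2"
    using energy_refinement[OF fin, of P "\<lambda>l. l div 4" Q g] Pdiv
    by (simp add: sum.cartesian_product power2_eq_square card_cartesian_product)
  finally have *: "(\<eta>\<^sup>2 * (real (card V))\<^sup>2) * (real (card V))\<^sup>2 \<le> (energy V Q g - energy V P g) * (real (card V))\<^sup>2"
    by (simp add: power_mult_distrib power2_eq_square mult_ac)
  have "\<eta>\<^sup>2 * (real (card V))\<^sup>2 \<le> energy V Q g - energy V P g"
  proof (cases "card V = 0")
    case True
    then show ?thesis
      using fin by (simp add: energy_def)
  next
    case False
    then show ?thesis
      using * by simp
  qed
  moreover have "Q ` V \<subseteq> {..<4 * M}"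
  proof
    fix l assume "l \<in> Q ` V"
    then obtain x where "x \<in> V" "l = Q x" by auto
    moreover have "P x + 1 \<le> M" using P \<open>x \<in> V\<close> by (auto simp: Suc_le_eq)
    ultimately show "l \<in> {..<4 * M}"
      using low[of "x \<in> X" "x \<in> Y"] by (simp add: Q_def)
  qed
  ultimately show ?thesis
    using Pdiv by (intro exI[of _ Q]) auto
qed

text \<open>Every failure of regularity raises the energy by \<eta>^2 |V|^2, while the energy never
  exceeds |V|^2, so a number of refinements determined by \<eta> suffices. Hence \<open>M\<close> is
  uniform in the graph. The map \<open>r\<close> records that the result refines \<open>P0\<close>,
  whose small classes are thereby inherited.\<close>

lemma exists_regular_labelling:
  fixes M0 :: nat
  assumes "0 < \<eta>"
  obtains M :: nat where "\<And>V P0 (g :: 'a \<Rightarrow> 'a \<Rightarrow> real). finite V \<Longrightarrow> P0 ` V \<subseteq> {..<M0} \<Longrightarrow>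
    (\<And>x y. x \<in> V \<Longrightarrow> y \<in> V \<Longrightarrow> 0 \<le> g x y \<and> g x y \<le> 1) \<Longrightarrow>
    \<exists>P r. P ` V \<subseteq> {..<M} \<and> (\<forall>x. P0 x = r (P x)) \<and> regular_labelling V P g \<eta>"
proof -
  have step: "\<exists>P r. P ` V \<subseteq> {..<4 ^ j * M0} \<and> (\<forall>x. P0 x = r (P x)) \<and>
      (regular_labelling V P g \<eta> \<or> real j * \<eta>\<^sup>2 * (real (card V))\<^sup>2 \<le> energy V P g)"
    if "finite V" "P0 ` V \<subseteq> {..<M0}" for V :: "'a set" and P0 g j
  proof (induction j)
    case 0
    then show ?case
      using that by (intro exI[of _ P0] exI[of _ id]) (auto simp: energy_def intro!: sum_nonneg)
  next
    case (Suc j)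
    have fin: "finite V"
      using that by simp
    from Suc obtain P r where P: "P ` V \<subseteq> {..<4 ^ j * M0}" "\<And>x. P0 x = r (P x)"
      "regular_labelling V P g \<eta> \<or> real j * \<eta>\<^sup>2 * (real (card V))\<^sup>2 \<le> energy V P g"
      by auto
    show ?case
    proof (cases "regular_labelling V P g \<eta>")
      case True
      moreover have "P ` V \<subseteq> {..<4 ^ Suc j * M0}"
        using P(1) by fastforce
      ultimately show ?thesis
        using P by (intro exI[of _ P] exI[of _ r]) simp
    next
      case False
      obtain Q where Q: "Q ` V \<subseteq> {..<4 * (4 ^ j * M0)}" "\<And>x. P x = Q x div 4"
        "energy V P g + \<eta>\<^sup>2 * (real (card V))\<^sup>2 \<le> energy V Q g"
        using energy_increment[OF fin P(1) False assms] by auto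
      have "real (Suc j) * \<eta>\<^sup>2 * (real (card V))\<^sup>2 \<le> energy V Q g"
        using Q(3) P(3) False by (simp add: algebra_simps)
      then show ?thesis
        using Q P(2) by (intro exI[of _ Q] exI[of _ "\<lambda>l. r (l div 4)"]) (auto simp: mult_ac)
    qed
  qed
  obtain j :: nat where j: "1 < real j * \<eta>\<^sup>2"
    using assms reals_Archimedean3[of "\<eta>\<^sup>2"] by auto
  show ?thesis
  proof (rule that[of "4 ^ j * M0"])
    fix V :: "'a set" and P0 and g :: "'a \<Rightarrow> 'a \<Rightarrow> real"
    assume V: "finite V" "P0 ` V \<subseteq> {..<M0}"
      and g: "\<And>x y. x \<in> V \<Longrightarrow> y \<in> V \<Longrightarrow> 0 \<le> g x y \<and> g x y \<le> 1"
    obtain P r where P: "P ` V \<subseteq> {..<4 ^ j * M0}" "\<And>x. P0 x = r (P x)"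
      "regular_labelling V P g \<eta> \<or> real j * \<eta>\<^sup>2 * (real (card V))\<^sup>2 \<le> energy V P g"
      using step[OF V, of j g] by auto
    have "regular_labelling V P g \<eta>"
    proof (cases "V = {}")
      case True
      then show ?thesis
        by (simp add: regular_labelling_def)
    next
      case False
      then have "1 * (real (card V))\<^sup>2 < real j * \<eta>\<^sup>2 * (real (card V))\<^sup>2"
        using j V by (intro mult_strict_right_mono) (auto simp: card_gt_0_iff)
      then show ?thesis
        using P(3) energy_le[of V g P, OF g] by linarith
    qed
    then show "\<exists>P r. P ` V \<subseteq> {..<4 ^ j * M0} \<and> (\<forall>x. P0 x = r (P x)) \<and> regular_labelling V P g \<eta>"
      using P by auto
  qed
qed

section \<open>Rounding weights to subsets\<close>

text \<open>A linear function on the cube of weights is extremal at a vertex: keep the summands of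
  one sign.\<close>

lemma abs_weighted_sum_le_subset:
  fixes a u :: "'a \<Rightarrow> real"
  assumes "finite V" "\<And>x. x \<in> V \<Longrightarrow> 0 \<le> u x \<and> u x \<le> 1"
  shows "\<exists>X\<subseteq>V. \<bar>\<Sum>x\<in>V. a x * u x\<bar> \<le> \<bar>\<Sum>x\<in>X. a x\<bar>"
proof -
  have *: "(\<Sum>x\<in>V. b x * u x) \<le> (\<Sum>x\<in>{x\<in>V. 0 \<le> b x}. b x)" for b :: "'a \<Rightarrow> real"
  proof -
    have "(\<Sum>x\<in>V. b x * u x) \<le> (\<Sum>x\<in>V. if 0 \<le> b x then b x else 0)"
      using assms(2) by (intro sum_mono) (auto simp: mult_left_le mult_nonpos_nonneg)
    then show ?thesis
      using assms(1) by (simp add: sum.inter_filter)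
  qed
  show ?thesis
  proof (cases "0 \<le> (\<Sum>x\<in>V. a x * u x)")
    case True
    then show ?thesis
      using *[of a] by (intro exI[of _ "{x\<in>V. 0 \<le> a x}"]) auto
  next
    case False
    then show ?thesis
      using *[of "\<lambda>x. - a x"]
      by (intro exI[of _ "{x\<in>V. 0 \<le> - a x}"]) (auto simp: sum_negf)
  qed
qed

text \<open>The form is linear in \<open>u\<close> and in \<open>v\<close> separately, so they are
  rounded to sets one after the other. Weights are what appears when the other coordinates of a
  product of kernels are frozen.\<close>

lemma regular_labelling_weighted:
  assumes reg: "regular_labelling V P g \<eta>" and fin: "finite V"
    and u: "\<And>x. x \<in> V \<Longrightarrow> 0 \<le> u x \<and> u x \<le> 1" and v: "\<And>x. x \<in> V \<Longrightarrow> 0 \<le> v x \<and> v x \<le> 1"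
    and s: "\<And>A B. \<bar>s A B\<bar> \<le> 1"
  shows "\<bar>\<Sum>x\<in>V. \<Sum>y\<in>V. (g x y - block_mean V P g (P x) (P y)) * u x * v y * s (P x) (P y)\<bar>
    \<le> \<eta> * (real (card V))\<^sup>2"
proof -
  let ?k = "\<lambda>x y. (g x y - block_mean V P g (P x) (P y)) * s (P x) (P y)"
  obtain X where X: "X \<subseteq> V"
    "\<bar>\<Sum>x\<in>V. (\<Sum>y\<in>V. ?k x y * v y) * u x\<bar> \<le> \<bar>\<Sum>x\<in>X. \<Sum>y\<in>V. ?k x y * v y\<bar>"
    using abs_weighted_sum_le_subset[OF fin, of u "\<lambda>x. \<Sum>y\<in>V. ?k x y * v y"] u by auto
  obtain Y where Y: "Y \<subseteq> V"
    "\<bar>\<Sum>y\<in>V. (\<Sum>x\<in>X. ?k x y) * v y\<bar> \<le> \<bar>\<Sum>y\<in>Y. \<Sum>x\<in>X. ?k x y\<bar>"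
    using abs_weighted_sum_le_subset[OF fin, of v "\<lambda>y. \<Sum>x\<in>X. ?k x y"] v by auto
  have "\<bar>\<Sum>x\<in>V. \<Sum>y\<in>V. (g x y - block_mean V P g (P x) (P y)) * u x * v y * s (P x) (P y)\<bar>
      = \<bar>\<Sum>x\<in>V. (\<Sum>y\<in>V. ?k x y * v y) * u x\<bar>"
    by (simp add: sum_distrib_left sum_distrib_right mult_ac)
  also have "\<dots> \<le> \<bar>\<Sum>x\<in>X. \<Sum>y\<in>V. ?k x y * v y\<bar>"
    by (rule X)
  also have "\<dots> = \<bar>\<Sum>y\<in>V. (\<Sum>x\<in>X. ?k x y) * v y\<bar>"
    by (subst sum.swap) (simp add: sum_distrib_right)
  also have "\<dots> \<le> \<bar>\<Sum>y\<in>Y. \<Sum>x\<in>X. ?k x y\<bar>"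
    by (rule Y)
  also have "\<dots> = \<bar>\<Sum>x\<in>X. \<Sum>y\<in>Y. ?k x y\<bar>"
    by (subst sum.swap) simp
  also have "\<dots> \<le> \<eta> * (real (card V))\<^sup>2"
    using reg X Y s unfolding regular_labelling_def by blast
  finally show ?thesis .
qed

section \<open>Products of kernels over pairs of indices\<close>

definition index_pairs :: "nat set \<Rightarrow> (nat \<times> nat) set" where
  "index_pairs I = {(i, j). i \<in> I \<and> j \<in> I \<and> i < j}"

definition kernel_prod :: "(nat \<times> nat) set \<Rightarrow> (nat \<times> nat \<Rightarrow> 'a \<Rightarrow> 'a \<Rightarrow> real) \<Rightarrow> (nat \<Rightarrow> 'a) \<Rightarrow> real" where
  "kernel_prod E K x = (\<Prod>e\<in>E. K e (x (fst e)) (x (snd e)))"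

definition unit_kernel :: "'a set \<Rightarrow> ('a \<Rightarrow> 'a \<Rightarrow> real) \<Rightarrow> bool" where
  "unit_kernel V k \<longleftrightarrow> (\<forall>x\<in>V. \<forall>y\<in>V. 0 \<le> k x y \<and> k x y \<le> 1)"

text \<open>The sign \<open>s\<close> may depend on the labels only. For the trivial labelling \<open>\<lambda>_. ()\<close> this is closeness in
  the cut norm.\<close>

definition cut_close :: "'a set \<Rightarrow> ('a \<Rightarrow> 'l) \<Rightarrow> ('a \<Rightarrow> 'a \<Rightarrow> real) \<Rightarrow> ('a \<Rightarrow> 'a \<Rightarrow> real) \<Rightarrow> real \<Rightarrow> bool" where
  "cut_close V P k l \<eta> \<longleftrightarrow>
     (\<forall>u v s. (\<forall>x\<in>V. 0 \<le> u x \<and> u x \<le> 1) \<longrightarrow> (\<forall>x\<in>V. 0 \<le> v x \<and> v x \<le> 1) \<longrightarrow>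
       (\<forall>A B. \<bar>s A B\<bar> \<le> (1 :: real)) \<longrightarrow>
       \<bar>\<Sum>x\<in>V. \<Sum>y\<in>V. (k x y - l x y) * u x * v y * s (P x) (P y)\<bar> \<le> \<eta> * (real (card V))\<^sup>2)"

lemma finite_index_pairs: "finite I \<Longrightarrow> finite (index_pairs I)"
  by (rule finite_subset[of _ "I \<times> I"]) (auto simp: index_pairs_def)

lemma kernel_prod_unit:
  assumes "E \<subseteq> index_pairs I" "\<And>e. e \<in> E \<Longrightarrow> unit_kernel V (K e)" "\<And>i. i \<in> I \<Longrightarrow> x i \<in> V"
  shows "0 \<le> kernel_prod E K x" "kernel_prod E K x \<le> 1"
proof -
  have "0 \<le> K e (x (fst e)) (x (snd e)) \<and> K e (x (fst e)) (x (snd e)) \<le> 1" if "e \<in> E" for e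
  proof -
    have "fst e \<in> I" "snd e \<in> I"
      using that assms(1) by (auto simp: index_pairs_def)
    then show ?thesis
      using assms(2)[OF that] assms(3) unfolding unit_kernel_def by blast
  qed
  then show "0 \<le> kernel_prod E K x" "kernel_prod E K x \<le> 1"
    unfolding kernel_prod_def by (auto intro!: prod_nonneg prod_le_1)
qed

lemma kernel_prod_remove:
  assumes "finite E" "e \<in> E"
  shows "kernel_prod E K x = K e (x (fst e)) (x (snd e)) * kernel_prod (E - {e}) K x"
  unfolding kernel_prod_def using assms by (rule prod.remove)

lemma kernel_prod_cong:
  "(\<And>e. e \<in> E \<Longrightarrow> K e = L e) \<Longrightarrow> kernel_prod E K x = kernel_prod E L x"
  by (simp add: kernel_prod_def)

text \<open>No pair other than (i, j) contains both i and j, so with the remaining coordinates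
  frozen each other factor sees at most one of a and b. The pairs at i make up \<open>u\<close>; all
  others, including the constant factors, go into \<open>v\<close>.\<close>

lemma kernel_prod_factor:
  assumes E: "E \<subseteq> index_pairs I" "finite E" "(i, j) \<in> E"
    and K: "\<And>e. e \<in> E \<Longrightarrow> unit_kernel V (K e)" and c: "c \<in> I - {i, j} \<rightarrow>\<^sub>E V"
  obtains u v where "\<And>a. a \<in> V \<Longrightarrow> 0 \<le> u a \<and> u a \<le> 1" "\<And>b. b \<in> V \<Longrightarrow> 0 \<le> v b \<and> v b \<le> 1"
    "\<And>a b. kernel_prod (E - {(i, j)}) K (c(i := a, j := b)) = u a * v b"
proof -
  define L where "L = {e \<in> E - {(i, j)}. fst e = i \<or> snd e = i}"
  define R where "R = E - {(i, j)} - L"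
  define u where "u a = kernel_prod L K (c(i := a))" for a
  define v where "v b = kernel_prod R K (c(j := b))" for b
  have ij: "i \<in> I" "j \<in> I" "i < j"
    using E by (auto simp: index_pairs_def)
  have L: "fst e \<in> I \<and> snd e \<in> I \<and> fst e \<noteq> j \<and> snd e \<noteq> j \<and> e \<in> E" if "e \<in> L" for e
    using that E ij by (cases e) (auto simp: L_def index_pairs_def)
  have R: "fst e \<in> I \<and> snd e \<in> I \<and> fst e \<noteq> i \<and> snd e \<noteq> i \<and> e \<in> E" if "e \<in> R" for e
    using that E ij by (cases e) (auto simp: R_def L_def index_pairs_def)
  show ?thesis
  proof (rule that)
    fix a b
    have "kernel_prod (E - {(i, j)}) K (c(i := a, j := b)) =
        kernel_prod L K (c(i := a, j := b)) * kernel_prod R K (c(i := a, j := b))"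
      unfolding kernel_prod_def R_def using E
      by (subst prod.union_disjoint[symmetric]) (auto simp: L_def intro: prod.cong)
    also have "kernel_prod L K (c(i := a, j := b)) = u a"
      unfolding u_def kernel_prod_def using L by (intro prod.cong) auto
    also have "kernel_prod R K (c(i := a, j := b)) = v b"
      unfolding v_def kernel_prod_def using R by (intro prod.cong) auto
    finally show "kernel_prod (E - {(i, j)}) K (c(i := a, j := b)) = u a * v b" .
  next
    fix a assume a: "a \<in> V"
    have "0 \<le> K e ((c(i := a)) (fst e)) ((c(i := a)) (snd e)) \<and>
        K e ((c(i := a)) (fst e)) ((c(i := a)) (snd e)) \<le> 1" if "e \<in> L" for e
    proof -
      have "(c(i := a)) l \<in> V" if "l \<in> I" "l \<noteq> j" for l
        using c a that by auto
      then show ?thesis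
        using K[of e] L[OF that] unfolding unit_kernel_def by blast
    qed
    then show "0 \<le> u a \<and> u a \<le> 1"
      unfolding u_def kernel_prod_def by (auto intro!: prod_nonneg prod_le_1)
  next
    fix a assume a: "a \<in> V"
    have "0 \<le> K e ((c(j := a)) (fst e)) ((c(j := a)) (snd e)) \<and>
        K e ((c(j := a)) (fst e)) ((c(j := a)) (snd e)) \<le> 1" if "e \<in> R" for e
    proof -
      have "(c(j := a)) l \<in> V" if "l \<in> I" "l \<noteq> i" for l
        using c a that by auto
      then show ?thesis
        using K[of e] R[OF that] unfolding unit_kernel_def by blast
    qed
    then show "0 \<le> v a \<and> v a \<le> 1"
      unfolding v_def kernel_prod_def by (auto intro!: prod_nonneg prod_le_1)
  qed
qed

lemma card_Diff_pair:
  assumes "finite I" "i \<in> I" "j \<in> I" "i \<noteq> j"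
  shows "card (I - {i, j}) + 2 = card I"
proof -
  have "card {i, j} \<le> card I"
    using assms by (intro card_mono) auto
  then show ?thesis
    using assms by (simp add: card_Diff_subset)
qed

lemma kernel_prod_single_diff:
  fixes S :: "(nat \<Rightarrow> 'l) \<Rightarrow> real"
  assumes fin: "finite I" "finite V" and E: "E \<subseteq> index_pairs I" "e \<in> E"
    and K: "\<And>e. e \<in> E \<Longrightarrow> unit_kernel V (K e)"
    and cut: "cut_close V P k l \<eta>" and S: "\<And>A. \<bar>S A\<bar> \<le> 1"
  shows "\<bar>\<Sum>x\<in>I \<rightarrow>\<^sub>E V. (k (x (fst e)) (x (snd e)) - l (x (fst e)) (x (snd e)))
      * kernel_prod (E - {e}) K x * S (\<lambda>i\<in>I. P (x i))\<bar> \<le> \<eta> * real (card V) ^ card I"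
proof -
  obtain i j where e: "e = (i, j)"
    by (cases e)
  have ij: "i \<in> I" "j \<in> I" "i < j"
    using E by (auto simp: index_pairs_def e)
  have finE: "finite E"
    using E(1) finite_index_pairs[OF fin(1)] by (rule finite_subset)
  let ?f = "\<lambda>x. (k (x i) (x j) - l (x i) (x j)) * kernel_prod (E - {e}) K x * S (\<lambda>i\<in>I. P (x i))"
  have inner: "\<bar>\<Sum>a\<in>V. \<Sum>b\<in>V. ?f (c(i := a, j := b))\<bar> \<le> \<eta> * (real (card V))\<^sup>2"
    if c: "c \<in> I - {i, j} \<rightarrow>\<^sub>E V" for c
  proof -
    obtain u v where u: "\<And>a. a \<in> V \<Longrightarrow> 0 \<le> u a \<and> u a \<le> 1" and v: "\<And>b. b \<in> V \<Longrightarrow> 0 \<le> v b \<and> v b \<le> 1"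
      and uv: "\<And>a b. kernel_prod (E - {(i, j)}) K (c(i := a, j := b)) = u a * v b"
      using kernel_prod_factor[OF E(1) finE, of i j V K c] E(2) K c by (auto simp: e)
    define s where "s A B = S ((\<lambda>i\<in>I. P (c i))(i := A, j := B))" for A B
    have s: "S (\<lambda>l\<in>I. P ((c(i := a, j := b)) l)) = s (P a) (P b)" for a b
      unfolding s_def using ij by (intro arg_cong[of _ _ S]) auto
    have "(\<Sum>a\<in>V. \<Sum>b\<in>V. ?f (c(i := a, j := b))) =
        (\<Sum>a\<in>V. \<Sum>b\<in>V. (k a b - l a b) * u a * v b * s (P a) (P b))"
      unfolding s using ij by (intro sum.cong refl) (simp add: uv e mult_ac)
    moreover have "\<bar>s A B\<bar> \<le> 1" for A B
      using S by (simp add: s_def)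
    ultimately show ?thesis
      using cut u v unfolding cut_close_def by simp
  qed
  have "\<bar>\<Sum>x\<in>I \<rightarrow>\<^sub>E V. ?f x\<bar> = \<bar>\<Sum>c\<in>I - {i, j} \<rightarrow>\<^sub>E V. \<Sum>a\<in>V. \<Sum>b\<in>V. ?f (c(i := a, j := b))\<bar>"
    using ij by (subst sum_PiE_split2[of i I j]) auto
  also have "\<dots> \<le> (\<Sum>c\<in>I - {i, j} \<rightarrow>\<^sub>E V. \<eta> * (real (card V))\<^sup>2)"
    by (rule order_trans[OF sum_abs sum_mono[OF inner]])
  also have "\<dots> = \<eta> * real (card V) ^ (card (I - {i, j}) + 2)"
    using fin by (simp add: card_funcset power_add power2_eq_square mult_ac)
  also have "card (I - {i, j}) + 2 = card I"
    using fin(1) ij by (intro card_Diff_pair) auto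
  finally show ?thesis
    by (simp only: e fst_conv snd_conv)
qed

text \<open>Counting lemma by telescoping: the hybrid \<open>H D\<close> uses \<open>L\<close> on
  \<open>D\<close> and \<open>K\<close> elsewhere, and each exchange at a single pair costs \<eta>.
  The sign may depend on all labels jointly, which later turns the estimate into one for absolute
  values.\<close>

lemma kernel_prod_diff:
  fixes S :: "(nat \<Rightarrow> 'l) \<Rightarrow> real"
  assumes fin: "finite I" "finite V" and E: "E \<subseteq> index_pairs I"
    and K: "\<And>e. e \<in> E \<Longrightarrow> unit_kernel V (K e)" and L: "\<And>e. e \<in> E \<Longrightarrow> unit_kernel V (L e)"
    and cut: "\<And>e. e \<in> E \<Longrightarrow> cut_close V P (K e) (L e) \<eta>" and S: "\<And>A. \<bar>S A\<bar> \<le> 1"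
  shows "\<bar>\<Sum>x\<in>I \<rightarrow>\<^sub>E V. (kernel_prod E K x - kernel_prod E L x) * S (\<lambda>i\<in>I. P (x i))\<bar>
    \<le> real (card E) * \<eta> * real (card V) ^ card I"
proof -
  have finE: "finite E"
    using E finite_index_pairs[OF fin(1)] by (rule finite_subset)
  define H where "H D e = (if e \<in> D then L e else K e)" for D e
  have "\<bar>\<Sum>x\<in>I \<rightarrow>\<^sub>E V. (kernel_prod E K x - kernel_prod E (H D) x) * S (\<lambda>i\<in>I. P (x i))\<bar>
      \<le> real (card D) * \<eta> * real (card V) ^ card I" if "D \<subseteq> E" for D
  proof -
    have "finite D"
      using that finE by (rule finite_subset)
    then show ?thesis
      using that
    proof induction
      case empty
      have "H {} = K"
        by (auto simp: H_def)
      then show ?case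
        by simp
    next
      case (insert e D)
      have e: "e \<in> E"
        using insert by auto
      have "kernel_prod (E - {e}) (H (insert e D)) x = kernel_prod (E - {e}) (H D) x" for x
        by (intro kernel_prod_cong) (auto simp: H_def)
      then have step: "kernel_prod E (H D) x - kernel_prod E (H (insert e D)) x =
          (K e (x (fst e)) (x (snd e)) - L e (x (fst e)) (x (snd e))) * kernel_prod (E - {e}) (H D) x" for x
        using insert.hyps by (simp add: kernel_prod_remove[OF finE e] H_def algebra_simps)
      have "(\<Sum>x\<in>I \<rightarrow>\<^sub>E V. (kernel_prod E K x - kernel_prod E (H (insert e D)) x) * S (\<lambda>i\<in>I. P (x i))) =
          (\<Sum>x\<in>I \<rightarrow>\<^sub>E V. (kernel_prod E K x - kernel_prod E (H D) x) * S (\<lambda>i\<in>I. P (x i))) +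
          (\<Sum>x\<in>I \<rightarrow>\<^sub>E V. (K e (x (fst e)) (x (snd e)) - L e (x (fst e)) (x (snd e)))
            * kernel_prod (E - {e}) (H D) x * S (\<lambda>i\<in>I. P (x i)))"
        unfolding step[symmetric] sum.distrib[symmetric]
        by (intro sum.cong refl) (simp add: algebra_simps)
      moreover have "\<bar>\<Sum>x\<in>I \<rightarrow>\<^sub>E V. (K e (x (fst e)) (x (snd e)) - L e (x (fst e)) (x (snd e)))
            * kernel_prod (E - {e}) (H D) x * S (\<lambda>i\<in>I. P (x i))\<bar> \<le> \<eta> * real (card V) ^ card I"
        using K L by (intro kernel_prod_single_diff fin E e cut S) (auto simp: H_def)
      moreover have "real (card (insert e D)) * \<eta> * real (card V) ^ card I =
          real (card D) * \<eta> * real (card V) ^ card I + \<eta> * real (card V) ^ card I"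
        using insert.hyps by (simp add: algebra_simps)
      moreover have "\<bar>\<Sum>x\<in>I \<rightarrow>\<^sub>E V. (kernel_prod E K x - kernel_prod E (H D) x) * S (\<lambda>i\<in>I. P (x i))\<bar>
          \<le> real (card D) * \<eta> * real (card V) ^ card I"
        using insert by blast
      ultimately show ?case
        by linarith
    qed
  qed
  from this[of E] show ?thesis
    by (simp add: H_def cong: kernel_prod_cong)
qed

section \<open>Repeated labels and sums over label boxes\<close>

text \<open>Union bound over pairs of coordinates that share a label: once one of them is placed, at
  most \<open>b\<close> vertices remain for the other. The factor \<open>card V\<close> on the left
  stands in for an exponent \<open>card I - 1\<close> on the right.\<close>

lemma card_non_injective:
  assumes fin: "finite I" "finite V" and b: "\<And>l. card {x\<in>V. P x = l} \<le> b"
  shows "card V * card {x \<in> I \<rightarrow>\<^sub>E V. \<not> inj_on (\<lambda>i. P (x i)) I} \<le> (card I)\<^sup>2 * b * card V ^ card I"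
proof -
  define B where "B = (\<lambda>(i, j). {x \<in> I \<rightarrow>\<^sub>E V. P (x i) = P (x j)})"
  define T where "T = {(i, j) \<in> I \<times> I. i \<noteq> j}"
  have T: "T \<subseteq> I \<times> I"
    by (auto simp: T_def)
  have finT: "finite T"
    by (rule finite_subset[OF T finite_cartesian_product[OF fin(1) fin(1)]])
  have cT: "card T \<le> (card I)\<^sup>2"
    using card_mono[OF finite_cartesian_product[OF fin(1) fin(1)] T]
    unfolding power2_eq_square card_cartesian_product .
  have finP: "finite (I \<rightarrow>\<^sub>E V)"
    using fin by (simp add: finite_PiE)
  have b': "card {x\<in>V. l = P x} \<le> b" for l
  proof -
    have "{x\<in>V. l = P x} = {x\<in>V. P x = l}"
      by auto
    then show ?thesis
      using b by simp
  qed
  have cB: "card V * card (B t) \<le> b * card V ^ card I" if t: "t \<in> T" for t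
  proof -
    obtain i j where ij: "t = (i, j)" "i \<in> I" "j \<in> I" "i \<noteq> j"
      using t by (auto simp: T_def)
    have "card (B t) = (\<Sum>x\<in>I \<rightarrow>\<^sub>E V. of_bool (P (x i) = P (x j)))"
      using finP by (simp add: B_def ij Collect_conj_eq Collect_mem_eq)
    also have "\<dots> = (\<Sum>c\<in>I - {i, j} \<rightarrow>\<^sub>E V. \<Sum>a\<in>V. \<Sum>b\<in>V. of_bool (P a = P b))"
      using ij by (subst sum_PiE_split2[of i I j]) auto
    also have "\<dots> = (\<Sum>c\<in>I - {i, j} \<rightarrow>\<^sub>E V. \<Sum>a\<in>V. card {b\<in>V. P a = P b})"
      using fin by (simp add: Collect_conj_eq Collect_mem_eq)
    also have "\<dots> \<le> (\<Sum>c\<in>I - {i, j} \<rightarrow>\<^sub>E V. \<Sum>a\<in>V. b)"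
      by (intro sum_mono b')
    also have "\<dots> = card V ^ card (I - {i, j}) * (card V * b)"
      using fin by (simp add: card_funcset)
    finally have "card V * card (B t) \<le> card V * (card V ^ card (I - {i, j}) * (card V * b))"
      by (rule mult_le_mono2)
    also have "\<dots> = b * card V ^ (card (I - {i, j}) + 2)"
      by (simp add: numeral_2_eq_2 mult_ac)
    finally show ?thesis
      unfolding card_Diff_pair[OF fin(1) ij(2-4)] .
  qed
  have "{x \<in> I \<rightarrow>\<^sub>E V. \<not> inj_on (\<lambda>i. P (x i)) I} \<subseteq> (\<Union>t\<in>T. B t)"
    by (auto simp: inj_on_def B_def T_def)
  moreover have "finite (\<Union>t\<in>T. B t)"
    by (rule finite_subset[OF _ finP]) (auto simp: B_def)
  ultimately have "card {x \<in> I \<rightarrow>\<^sub>E V. \<not> inj_on (\<lambda>i. P (x i)) I} \<le> card (\<Union>t\<in>T. B t)"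
    by (intro card_mono)
  also have "\<dots> \<le> (\<Sum>t\<in>T. card (B t))"
    using finT by (intro card_UN_le)
  finally have "card V * card {x \<in> I \<rightarrow>\<^sub>E V. \<not> inj_on (\<lambda>i. P (x i)) I} \<le> (\<Sum>t\<in>T. card V * card (B t))"
    by (simp add: sum_distrib_left[symmetric])
  also have "\<dots> \<le> card T * (b * card V ^ card I)"
    using sum_bounded_above[of T "\<lambda>t. card V * card (B t)" "b * card V ^ card I"] cB by simp
  also have "\<dots> \<le> (card I)\<^sup>2 * (b * card V ^ card I)"
    using cT by (intro mult_right_mono) auto
  finally show ?thesis
    by (simp add: mult_ac)
qed

text \<open>The weight \<open>S\<close> is constant on the box of each of the
  \<open>M ^ card I\<close> label tuples. It vanishes on tuples with a repeated label, so only
  pairwise disjoint boxes have to be controlled.\<close>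

lemma sum_labelled_boxes:
  fixes S :: "(nat \<Rightarrow> nat) \<Rightarrow> real"
  assumes fin: "finite I" "finite V" and P: "P ` V \<subseteq> {..<M}" and "0 \<le> \<theta>"
    and box: "\<And>A. inj_on A I \<Longrightarrow> \<bar>\<Sum>x\<in>PiE I (\<lambda>i. {v\<in>V. P v = A i}). f x\<bar> \<le> \<theta>"
    and S: "\<And>A. \<bar>S A\<bar> \<le> 1" "\<And>A. \<not> inj_on A I \<Longrightarrow> S A = 0"
  shows "\<bar>\<Sum>x\<in>I \<rightarrow>\<^sub>E V. f x * S (\<lambda>i\<in>I. P (x i))\<bar> \<le> real M ^ card I * \<theta>"
proof -
  let ?T = "\<lambda>x. \<lambda>i\<in>I. P (x i)" and ?L = "I \<rightarrow>\<^sub>E {..<M}"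
  have Pless: "P v < M" if "v \<in> V" for v
    using P that by auto
  have "(\<Sum>x\<in>I \<rightarrow>\<^sub>E V. f x * S (?T x)) = (\<Sum>A\<in>?L. \<Sum>x\<in>{x \<in> I \<rightarrow>\<^sub>E V. ?T x = A}. f x * S (?T x))"
    using fin Pless by (intro sum.group[symmetric]) (auto simp: finite_PiE dest: PiE_mem)
  also have "\<dots> = (\<Sum>A\<in>?L. (\<Sum>x\<in>PiE I (\<lambda>i. {v\<in>V. P v = A i}). f x) * S A)"
  proof (rule sum.cong[OF refl])
    fix A assume A: "A \<in> ?L"
    have *: "{x \<in> I \<rightarrow>\<^sub>E V. ?T x = A} = PiE I (\<lambda>i. {v\<in>V. P v = A i})"
    proof (intro set_eqI iffI)
      fix x assume "x \<in> PiE I (\<lambda>i. {v\<in>V. P v = A i})"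
      then show "x \<in> {x \<in> I \<rightarrow>\<^sub>E V. ?T x = A}"
        using A by (auto simp: PiE_iff extensional_def fun_eq_iff)
    qed (auto simp: PiE_iff extensional_def)
    have "(\<Sum>x\<in>{x \<in> I \<rightarrow>\<^sub>E V. ?T x = A}. f x * S (?T x)) = (\<Sum>x\<in>{x \<in> I \<rightarrow>\<^sub>E V. ?T x = A}. f x * S A)"
      by (intro sum.cong) auto
    then show "(\<Sum>x\<in>{x \<in> I \<rightarrow>\<^sub>E V. ?T x = A}. f x * S (?T x)) = (\<Sum>x\<in>PiE I (\<lambda>i. {v\<in>V. P v = A i}). f x) * S A"
      by (simp add: * sum_distrib_right)
  qed
  finally have "\<bar>\<Sum>x\<in>I \<rightarrow>\<^sub>E V. f x * S (?T x)\<bar> \<le> (\<Sum>A\<in>?L. \<bar>(\<Sum>x\<in>PiE I (\<lambda>i. {v\<in>V. P v = A i}). f x) * S A\<bar>)"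
    by (simp add: sum_abs)
  also have "\<dots> \<le> (\<Sum>A\<in>?L. \<theta>)"
  proof (rule sum_mono)
    fix A
    show "\<bar>(\<Sum>x\<in>PiE I (\<lambda>i. {v\<in>V. P v = A i}). f x) * S A\<bar> \<le> \<theta>"
    proof (cases "inj_on A I")
      case True
      have "\<bar>(\<Sum>x\<in>PiE I (\<lambda>i. {v\<in>V. P v = A i}). f x)\<bar> * \<bar>S A\<bar> \<le> \<theta> * 1"
        using S(1) box[OF True] \<open>0 \<le> \<theta>\<close> by (intro mult_mono) auto
      then show ?thesis
        by (simp add: abs_mult)
    next
      case False
      then show ?thesis
        using S(2) \<open>0 \<le> \<theta>\<close> by simp
    qed
  qed
  also have "\<dots> = real M ^ card I * \<theta>"
    using fin by (simp add: card_funcset)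
  finally show ?thesis .
qed

text \<open>The step product is constant on label boxes, so off the repeated labels its absolute
  deviation from \<beta> is the deviation times a sign of the labels. Under that sign the counting
  lemma exchanges the step kernels for \<open>K\<close>, which leaves sums over disjoint boxes. The
  three error terms come from regularity, the boxes and the repeated labels.\<close>

lemma step_kernel_prod_L1:
  fixes w :: "nat \<times> nat \<Rightarrow> nat \<Rightarrow> nat \<Rightarrow> real"
  assumes fin: "finite I" "finite V" and E: "E \<subseteq> index_pairs I"
    and P: "P ` V \<subseteq> {..<M}" "\<And>l. card {x\<in>V. P x = l} \<le> b"
    and K: "\<And>e. e \<in> E \<Longrightarrow> unit_kernel V (K e)"
    and w: "\<And>e A B. e \<in> E \<Longrightarrow> 0 \<le> w e A B \<and> w e A B \<le> 1"
    and cut: "\<And>e. e \<in> E \<Longrightarrow> cut_close V P (K e) (\<lambda>x y. w e (P x) (P y)) \<eta>"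
    and \<beta>: "0 \<le> \<beta>" "\<beta> \<le> 1" and "0 \<le> \<theta>"
    and box: "\<And>U. (\<And>i. i \<in> I \<Longrightarrow> U i \<subseteq> V \<and> card (U i) \<le> b) \<Longrightarrow> disjoint_family_on U I \<Longrightarrow>
      \<bar>\<Sum>x\<in>PiE I U. kernel_prod E K x - \<beta>\<bar> \<le> \<theta>"
  shows "real (card V) * (\<Sum>x\<in>I \<rightarrow>\<^sub>E V. \<bar>kernel_prod E (\<lambda>e x y. w e (P x) (P y)) x - \<beta>\<bar>)
    \<le> real (card V) * (real (card E) * \<eta> * real (card V) ^ card I + real M ^ card I * \<theta>)
      + real ((card I)\<^sup>2 * b * card V ^ card I)"
proof -
  let ?L = "\<lambda>e x y. w e (P x) (P y)" and ?T = "\<lambda>x. \<lambda>i\<in>I. P (x i)"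
  define S where "S A = (if inj_on A I then sgn (kernel_prod E w A - \<beta>) else 0)" for A
  have S: "\<bar>S A\<bar> \<le> 1" "\<not> inj_on A I \<Longrightarrow> S A = 0" for A
    by (auto simp: S_def abs_sgn_eq)
  have L: "unit_kernel V (?L e)" if "e \<in> E" for e
    using w[OF that] by (simp add: unit_kernel_def)
  have LT: "kernel_prod E ?L x = kernel_prod E w (?T x)" for x
    using E by (auto simp: kernel_prod_def index_pairs_def intro!: prod.cong)
  have injT: "inj_on (?T x) I \<longleftrightarrow> inj_on (\<lambda>i. P (x i)) I" for x
    by (rule inj_on_cong) simp
  have finP: "finite (I \<rightarrow>\<^sub>E V)"
    using fin by (simp add: finite_PiE)
  have "(\<Sum>x\<in>I \<rightarrow>\<^sub>E V. \<bar>kernel_prod E ?L x - \<beta>\<bar>) \<le>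
      (\<Sum>x\<in>I \<rightarrow>\<^sub>E V. (kernel_prod E ?L x - \<beta>) * S (?T x) + of_bool (\<not> inj_on (\<lambda>i. P (x i)) I))"
  proof (rule sum_mono)
    fix x assume x: "x \<in> I \<rightarrow>\<^sub>E V"
    have "0 \<le> kernel_prod E ?L x" "kernel_prod E ?L x \<le> 1"
      using kernel_prod_unit[OF E, of V ?L x] L x by auto
    then have "\<bar>kernel_prod E ?L x - \<beta>\<bar> \<le> 1"
      using \<beta> by (auto simp: abs_if)
    then show "\<bar>kernel_prod E ?L x - \<beta>\<bar> \<le>
        (kernel_prod E ?L x - \<beta>) * S (?T x) + of_bool (\<not> inj_on (\<lambda>i. P (x i)) I)"
      by (auto simp: S_def injT LT abs_sgn)
  qed
  also have "\<dots> = (\<Sum>x\<in>I \<rightarrow>\<^sub>E V. (kernel_prod E ?L x - \<beta>) * S (?T x))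
      + real (card {x \<in> I \<rightarrow>\<^sub>E V. \<not> inj_on (\<lambda>i. P (x i)) I})"
    using finP by (simp add: sum.distrib Int_def)
  also have "(\<Sum>x\<in>I \<rightarrow>\<^sub>E V. (kernel_prod E ?L x - \<beta>) * S (?T x)) =
      (\<Sum>x\<in>I \<rightarrow>\<^sub>E V. (kernel_prod E K x - \<beta>) * S (?T x))
      - (\<Sum>x\<in>I \<rightarrow>\<^sub>E V. (kernel_prod E K x - kernel_prod E ?L x) * S (?T x))"
    by (simp add: sum_subtractf[symmetric] algebra_simps)
  finally have 1: "(\<Sum>x\<in>I \<rightarrow>\<^sub>E V. \<bar>kernel_prod E ?L x - \<beta>\<bar>) \<le>
      \<bar>\<Sum>x\<in>I \<rightarrow>\<^sub>E V. (kernel_prod E K x - \<beta>) * S (?T x)\<bar>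
      + \<bar>\<Sum>x\<in>I \<rightarrow>\<^sub>E V. (kernel_prod E K x - kernel_prod E ?L x) * S (?T x)\<bar>
      + real (card {x \<in> I \<rightarrow>\<^sub>E V. \<not> inj_on (\<lambda>i. P (x i)) I})"
    by linarith
  have 2: "\<bar>\<Sum>x\<in>I \<rightarrow>\<^sub>E V. (kernel_prod E K x - \<beta>) * S (?T x)\<bar> \<le> real M ^ card I * \<theta>"
  proof (rule sum_labelled_boxes[OF fin P(1) \<open>0 \<le> \<theta>\<close> _ S])
    fix A :: "nat \<Rightarrow> nat" assume "inj_on A I"
    then show "\<bar>\<Sum>x\<in>PiE I (\<lambda>i. {v \<in> V. P v = A i}). kernel_prod E K x - \<beta>\<bar> \<le> \<theta>"
      using P(2) by (intro box) (auto simp: disjoint_family_on_def inj_on_def)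
  qed
  have 3: "\<bar>\<Sum>x\<in>I \<rightarrow>\<^sub>E V. (kernel_prod E K x - kernel_prod E ?L x) * S (?T x)\<bar>
      \<le> real (card E) * \<eta> * real (card V) ^ card I"
    by (rule kernel_prod_diff[OF fin E K L cut S(1)])
  have "real (card V) * (\<Sum>x\<in>I \<rightarrow>\<^sub>E V. \<bar>kernel_prod E ?L x - \<beta>\<bar>) \<le>
      real (card V) * (real (card E) * \<eta> * real (card V) ^ card I + real M ^ card I * \<theta>
        + real (card {x \<in> I \<rightarrow>\<^sub>E V. \<not> inj_on (\<lambda>i. P (x i)) I}))"
    using 1 2 3 by (intro mult_left_mono) linarith+
  moreover have "real (card V) * real (card {x \<in> I \<rightarrow>\<^sub>E V. \<not> inj_on (\<lambda>i. P (x i)) I})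
      \<le> real ((card I)\<^sup>2 * b * card V ^ card I)"
    using of_nat_mono[OF card_non_injective[OF fin P(2)], where 'a = real] by (simp only: of_nat_mult)
  ultimately show ?thesis
    by (simp add: algebra_simps)
qed

section \<open>Near rank one kernels\<close>

definition mean_degree :: "'a set \<Rightarrow> ('a \<Rightarrow> 'a \<Rightarrow> real) \<Rightarrow> 'a \<Rightarrow> real" where
  "mean_degree V m a = (\<Sum>b\<in>V. m a b) / real (card V)"

definition kernel_mean :: "'a set \<Rightarrow> ('a \<Rightarrow> 'a \<Rightarrow> real) \<Rightarrow> real" where
  "kernel_mean V m = (\<Sum>a\<in>V. mean_degree V m a) / real (card V)"

text \<open>The L1 form of m(a,b) = f(a) f(b) / \<mu>, cleared of its denominator because no lower
  bound on the mean is at hand yet.\<close>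

definition near_rank_one :: "'a set \<Rightarrow> ('a \<Rightarrow> 'a \<Rightarrow> real) \<Rightarrow> real \<Rightarrow> bool" where
  "near_rank_one V m \<theta> \<longleftrightarrow>
     (\<Sum>a\<in>V. \<Sum>b\<in>V. \<bar>kernel_mean V m * m a b - mean_degree V m a * mean_degree V m b\<bar>)
       \<le> \<theta> * (real (card V))\<^sup>2"

lemma abs_mult_le_unit:
  fixes a b :: real
  assumes "\<bar>a\<bar> \<le> 1"
  shows "\<bar>a * b\<bar> \<le> \<bar>b\<bar>"
  using mult_right_mono[OF assms, of "\<bar>b\<bar>"] by (simp add: abs_mult)

lemma abs_mult_diff_le:
  fixes a b c d :: real
  assumes "\<bar>b\<bar> \<le> 1" "\<bar>c\<bar> \<le> 1"
  shows "\<bar>a * b - c * d\<bar> \<le> \<bar>a - c\<bar> + \<bar>b - d\<bar>"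
proof -
  have "a * b - c * d = b * (a - c) + c * (b - d)"
    by (simp add: algebra_simps)
  then show ?thesis
    using abs_mult_le_unit[OF assms(1), of "a - c"] abs_mult_le_unit[OF assms(2), of "b - d"] by linarith
qed

text \<open>Here s1, s2, t1, t2 stand for m(a,b), m(a',b'), m(a',b), m(a,b'), and u, u', v, v' for
  the remaining factors at a, a', b, b'. Both s1 s2 and t1 t2 occur with the same weight w = u v u'
  v'. As s1 s2 w is close to \<beta>^2 and s1 s2 \<le> 1, this weight is at least about \<beta>^2.
  That estimate uses the first two deviations a second time, hence their coefficient 2.\<close>

lemma cross_product_le:
  fixes s1 s2 t1 t2 u u' v v' \<beta> :: real
  assumes "0 \<le> s1" "s1 \<le> 1" "0 \<le> s2" "s2 \<le> 1" "0 \<le> t1" "t1 \<le> 1" "0 \<le> t2" "t2 \<le> 1"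
    and "0 \<le> u" "u \<le> 1" "0 \<le> u'" "u' \<le> 1" "0 \<le> v" "v \<le> 1" "0 \<le> v'" "v' \<le> 1" "0 \<le> \<beta>" "\<beta> \<le> 1"
  shows "\<beta>\<^sup>2 * \<bar>s1 * s2 - t1 * t2\<bar> \<le> 2 * \<bar>s1 * (u * v) - \<beta>\<bar> + 2 * \<bar>s2 * (u' * v') - \<beta>\<bar>
    + \<bar>t1 * (u' * v) - \<beta>\<bar> + \<bar>t2 * (u * v') - \<beta>\<bar>"
proof -
  define q1 q2 q3 q4 where q: "q1 = s1 * (u * v)" "q2 = s2 * (u' * v')" "q3 = t1 * (u' * v)" "q4 = t2 * (u * v')"
  define w where "w = (u * v) * (u' * v')"
  have unit: "\<bar>q1\<bar> \<le> 1" "\<bar>q2\<bar> \<le> 1" "\<bar>q3\<bar> \<le> 1" "\<bar>q4\<bar> \<le> 1" "0 \<le> w"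
    unfolding q w_def using assms by (simp_all add: mult_le_one)
  have st: "\<bar>s1 * s2 - t1 * t2\<bar> \<le> 1"
  proof -
    have "0 \<le> s1 * s2" "s1 * s2 \<le> 1" "0 \<le> t1 * t2" "t1 * t2 \<le> 1"
      using assms by (simp_all add: mult_le_one)
    then show ?thesis by linarith
  qed
  have \<beta>: "\<bar>\<beta>\<bar> \<le> 1"
    using assms by simp
  have d12: "\<bar>q1 * q2 - \<beta> * \<beta>\<bar> \<le> \<bar>q1 - \<beta>\<bar> + \<bar>q2 - \<beta>\<bar>"
    by (rule abs_mult_diff_le[OF unit(2) \<beta>])
  have d34: "\<bar>q3 * q4 - \<beta> * \<beta>\<bar> \<le> \<bar>q3 - \<beta>\<bar> + \<bar>q4 - \<beta>\<bar>"
    by (rule abs_mult_diff_le[OF unit(4) \<beta>])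
  have "q1 * q2 = (s1 * s2) * w"
    by (simp add: q w_def mult_ac)
  moreover have "(s1 * s2) * w \<le> 1 * w"
    using assms unit(5) by (intro mult_right_mono) (simp_all add: mult_le_one)
  ultimately have "\<beta>\<^sup>2 \<le> w + (\<bar>q1 - \<beta>\<bar> + \<bar>q2 - \<beta>\<bar>)"
    using d12 by (simp add: power2_eq_square)
  then have "\<beta>\<^sup>2 * \<bar>s1 * s2 - t1 * t2\<bar> \<le> (w + (\<bar>q1 - \<beta>\<bar> + \<bar>q2 - \<beta>\<bar>)) * \<bar>s1 * s2 - t1 * t2\<bar>"
    by (rule mult_right_mono) simp
  also have "\<dots> = \<bar>w * (s1 * s2 - t1 * t2)\<bar> + (\<bar>q1 - \<beta>\<bar> + \<bar>q2 - \<beta>\<bar>) * \<bar>s1 * s2 - t1 * t2\<bar>"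
    using unit(5) by (simp add: distrib_right abs_mult)
  also have "\<dots> \<le> \<bar>w * (s1 * s2 - t1 * t2)\<bar> + (\<bar>q1 - \<beta>\<bar> + \<bar>q2 - \<beta>\<bar>)"
    using mult_left_mono[OF st, of "\<bar>q1 - \<beta>\<bar> + \<bar>q2 - \<beta>\<bar>"] by simp
  also have "w * (s1 * s2 - t1 * t2) = q1 * q2 - q3 * q4"
    by (simp add: q w_def algebra_simps)
  finally have le: "\<beta>\<^sup>2 * \<bar>s1 * s2 - t1 * t2\<bar> \<le> \<bar>q1 * q2 - q3 * q4\<bar> + (\<bar>q1 - \<beta>\<bar> + \<bar>q2 - \<beta>\<bar>)" .
  have "\<bar>q1 * q2 - q3 * q4\<bar> \<le> \<bar>q1 * q2 - \<beta> * \<beta>\<bar> + \<bar>q3 * q4 - \<beta> * \<beta>\<bar>"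
    by linarith
  also have "\<dots> \<le> (\<bar>q1 - \<beta>\<bar> + \<bar>q2 - \<beta>\<bar>) + (\<bar>q3 - \<beta>\<bar> + \<bar>q4 - \<beta>\<bar>)"
    by (rule add_mono[OF d12 d34])
  finally have "\<bar>q1 * q2 - q3 * q4\<bar> \<le> \<bar>q1 - \<beta>\<bar> + \<bar>q2 - \<beta>\<bar> + (\<bar>q3 - \<beta>\<bar> + \<bar>q4 - \<beta>\<bar>)" .
  note total = order_trans[OF le add_right_mono[OF this]]
  define D where "D x = \<bar>x - \<beta>\<bar>" for x
  show ?thesis
    using total unfolding q[symmetric] D_def[symmetric] by linarith
qed

text \<open>Sum \<open>cross_product_le\<close> over all coordinates: each of the four tuples is
  equidistributed, whence the constant 2 + 2 + 1 + 1 = 6. Summing over a' and b' inside the absolute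
  value turns m(a,b) m(a',b') into N^2 \<mu> m(a,b) and, by symmetry of m, m(a',b) m(a,b') into N^2
  f(a) f(b).\<close>

lemma kernel_prod_L1_imp_near_rank_one:
  assumes fin: "finite I" "finite V" and E: "E \<subseteq> index_pairs I" "(i, j) \<in> E" and ne: "V \<noteq> {}"
    and K: "\<And>e. e \<in> E \<Longrightarrow> unit_kernel V (K e)"
    and sym: "\<And>x y. x \<in> V \<Longrightarrow> y \<in> V \<Longrightarrow> K (i, j) x y = K (i, j) y x"
    and \<beta>: "0 < \<beta>" "\<beta> \<le> 1"
    and L1: "(\<Sum>x\<in>I \<rightarrow>\<^sub>E V. \<bar>kernel_prod E K x - \<beta>\<bar>) \<le> \<eta> * real (card V) ^ card I"
  shows "near_rank_one V (K (i, j)) (6 * \<eta> / \<beta>\<^sup>2)"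
proof -
  define m N where "m = K (i, j)" and "N = real (card V)"
  have N: "0 < N"
    using fin ne by (simp add: N_def card_gt_0_iff)
  have ij: "i \<in> I" "j \<in> I" "i < j" "i \<noteq> j"
    using E by (auto simp: index_pairs_def)
  have finE: "finite E"
    using E(1) finite_index_pairs[OF fin(1)] by (rule finite_subset)
  have m: "0 \<le> m a b \<and> m a b \<le> 1" if "a \<in> V" "b \<in> V" for a b
    using K[OF E(2)] that by (auto simp: m_def unit_kernel_def)
  let ?C = "I - {i, j} \<rightarrow>\<^sub>E V"
  define n where "n = card (I - {i, j})"
  have n: "n + 2 = card I"
    unfolding n_def using fin ij by (intro card_Diff_pair) auto
  define d where "d c a b = \<bar>kernel_prod E K (c(i := a, j := b)) - \<beta>\<bar>" for c a b
  define D where "D = (\<Sum>c\<in>?C. \<Sum>a\<in>V. \<Sum>b\<in>V. d c a b)"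
  have D: "D \<le> \<eta> * N ^ card I"
    using L1 unfolding D_def d_def N_def by (subst (asm) sum_PiE_split2[OF ij(1,2,4)])
  let ?X = "\<lambda>a b a' b'. \<bar>m a b * m a' b' - m a' b * m a b'\<bar>"
  have point: "\<beta>\<^sup>2 * ?X a b a' b' \<le> 2 * d c a b + 2 * d c a' b' + d c a' b + d c a b'"
    if c: "c \<in> ?C" and V: "a \<in> V" "b \<in> V" "a' \<in> V" "b' \<in> V" for c a b a' b'
  proof -
    obtain u v where u: "\<And>a. a \<in> V \<Longrightarrow> 0 \<le> u a \<and> u a \<le> 1" and v: "\<And>b. b \<in> V \<Longrightarrow> 0 \<le> v b \<and> v b \<le> 1"
      and uv: "\<And>a b. kernel_prod (E - {(i, j)}) K (c(i := a, j := b)) = u a * v b"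
      using kernel_prod_factor[OF E(1) finE E(2), where K = K and V = V, OF K c] by blast
    have "kernel_prod E K (c(i := a, j := b)) = m a b * (u a * v b)" for a b
      using kernel_prod_remove[OF finE E(2), of K "c(i := a, j := b)"] ij by (simp add: uv m_def)
    then have d: "d c a b = \<bar>m a b * (u a * v b) - \<beta>\<bar>" for a b
      by (simp add: d_def)
    show ?thesis
      unfolding d using m[OF V(1,2)] m[OF V(3,4)] m[OF V(3,2)] m[OF V(1,4)]
        u[OF V(1)] u[OF V(3)] v[OF V(2)] v[OF V(4)] \<beta>
      by (intro cross_product_le) auto
  qed
  have sums: "(\<Sum>c\<in>?C. \<Sum>a\<in>V. \<Sum>b\<in>V. \<Sum>a'\<in>V. \<Sum>b'\<in>V. d c a b) = N\<^sup>2 * D"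
    "(\<Sum>c\<in>?C. \<Sum>a\<in>V. \<Sum>b\<in>V. \<Sum>a'\<in>V. \<Sum>b'\<in>V. d c a' b') = N\<^sup>2 * D"
    "(\<Sum>c\<in>?C. \<Sum>a\<in>V. \<Sum>b\<in>V. \<Sum>a'\<in>V. \<Sum>b'\<in>V. d c a' b) = N\<^sup>2 * D"
    "(\<Sum>c\<in>?C. \<Sum>a\<in>V. \<Sum>b\<in>V. \<Sum>a'\<in>V. \<Sum>b'\<in>V. d c a b') = N\<^sup>2 * D"
  proof -
    show "(\<Sum>c\<in>?C. \<Sum>a\<in>V. \<Sum>b\<in>V. \<Sum>a'\<in>V. \<Sum>b'\<in>V. d c a b) = N\<^sup>2 * D"
      by (simp add: D_def N_def power2_eq_square sum_distrib_left mult.assoc)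
    show "(\<Sum>c\<in>?C. \<Sum>a\<in>V. \<Sum>b\<in>V. \<Sum>a'\<in>V. \<Sum>b'\<in>V. d c a' b') = N\<^sup>2 * D"
      by (simp add: D_def N_def power2_eq_square sum_distrib_left mult.assoc)
    have "(\<Sum>b\<in>V. \<Sum>a'\<in>V. d c a' b) = (\<Sum>a'\<in>V. \<Sum>b\<in>V. d c a' b)" for c
      by (rule sum.swap)
    then show "(\<Sum>c\<in>?C. \<Sum>a\<in>V. \<Sum>b\<in>V. \<Sum>a'\<in>V. \<Sum>b'\<in>V. d c a' b) = N\<^sup>2 * D"
      by (simp add: D_def N_def power2_eq_square sum_distrib_left[symmetric] mult.assoc)
    show "(\<Sum>c\<in>?C. \<Sum>a\<in>V. \<Sum>b\<in>V. \<Sum>a'\<in>V. \<Sum>b'\<in>V. d c a b') = N\<^sup>2 * D"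
      by (simp add: D_def N_def power2_eq_square sum_distrib_left mult.assoc)
  qed
  let ?S = "\<Sum>a\<in>V. \<Sum>b\<in>V. \<Sum>a'\<in>V. \<Sum>b'\<in>V. ?X a b a' b'"
  have "N ^ n * (\<beta>\<^sup>2 * ?S) = (\<Sum>c\<in>?C. \<Sum>a\<in>V. \<Sum>b\<in>V. \<Sum>a'\<in>V. \<Sum>b'\<in>V. \<beta>\<^sup>2 * ?X a b a' b')"
    using fin by (simp add: sum_distrib_left[symmetric] card_funcset N_def n_def)
  also have "\<dots> \<le> (\<Sum>c\<in>?C. \<Sum>a\<in>V. \<Sum>b\<in>V. \<Sum>a'\<in>V. \<Sum>b'\<in>V.
      2 * d c a b + 2 * d c a' b' + d c a' b + d c a b')"
    by (intro sum_mono point)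
  also have "\<dots> = 2 * (N\<^sup>2 * D) + 2 * (N\<^sup>2 * D) + N\<^sup>2 * D + N\<^sup>2 * D"
    unfolding sum.distrib sum_distrib_left[symmetric] sums ..
  also have "\<dots> = 6 * N\<^sup>2 * D"
    by simp
  also have "\<dots> \<le> 6 * N\<^sup>2 * (\<eta> * N ^ card I)"
    using D by (intro mult_left_mono) auto
  also have "\<dots> = N ^ n * (6 * \<eta> * (N\<^sup>2 * N\<^sup>2))"
    unfolding n[symmetric] power_add by (simp only: mult_ac)
  finally have S: "\<beta>\<^sup>2 * ?S \<le> 6 * \<eta> * (N\<^sup>2 * N\<^sup>2)"
    using N by simp
  have msym: "m a b = m b a" if "a \<in> V" "b \<in> V" for a b
    using sym that by (simp add: m_def)
  have deg: "(\<Sum>b\<in>V. m a b) = N * mean_degree V m a" for a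
    using N by (simp add: mean_degree_def N_def)
  have tot: "(\<Sum>a\<in>V. mean_degree V m a) = N * kernel_mean V m"
    using N by (simp add: kernel_mean_def N_def)
  have "N\<^sup>2 * \<bar>kernel_mean V m * m a b - mean_degree V m a * mean_degree V m b\<bar> \<le> (\<Sum>a'\<in>V. \<Sum>b'\<in>V. ?X a b a' b')"
    if ab: "a \<in> V" "b \<in> V" for a b
  proof -
    have "(\<Sum>a'\<in>V. m a' b) = (\<Sum>a'\<in>V. m b a')"
      using msym ab by (intro sum.cong) auto
    then have "(\<Sum>a'\<in>V. \<Sum>b'\<in>V. m a b * m a' b' - m a' b * m a b') =
        m a b * (N * (N * kernel_mean V m)) - (N * mean_degree V m b) * (N * mean_degree V m a)"
      by (simp add: sum_subtractf sum_distrib_left[symmetric] sum_distrib_right[symmetric] deg tot)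
    also have "\<dots> = N\<^sup>2 * (kernel_mean V m * m a b - mean_degree V m a * mean_degree V m b)"
      by (simp add: algebra_simps power2_eq_square)
    finally have "N\<^sup>2 * \<bar>kernel_mean V m * m a b - mean_degree V m a * mean_degree V m b\<bar> =
        \<bar>\<Sum>a'\<in>V. \<Sum>b'\<in>V. m a b * m a' b' - m a' b * m a b'\<bar>"
      by (simp add: abs_mult)
    also have "\<dots> \<le> (\<Sum>a'\<in>V. \<Sum>b'\<in>V. ?X a b a' b')"
      by (rule order_trans[OF sum_abs sum_mono[OF sum_abs]])
    finally show ?thesis .
  qed
  then have "(\<Sum>a\<in>V. \<Sum>b\<in>V. N\<^sup>2 * \<bar>kernel_mean V m * m a b - mean_degree V m a * mean_degree V m b\<bar>) \<le> ?S"
    by (intro sum_mono) auto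
  then have "\<beta>\<^sup>2 * (N\<^sup>2 * (\<Sum>a\<in>V. \<Sum>b\<in>V. \<bar>kernel_mean V m * m a b - mean_degree V m a * mean_degree V m b\<bar>)) \<le> \<beta>\<^sup>2 * ?S"
    by (intro mult_left_mono) (simp_all add: sum_distrib_left)
  with S have "N\<^sup>2 * (\<beta>\<^sup>2 * (\<Sum>a\<in>V. \<Sum>b\<in>V. \<bar>kernel_mean V m * m a b - mean_degree V m a * mean_degree V m b\<bar>))
      \<le> N\<^sup>2 * (6 * \<eta> * N\<^sup>2)"
    by (simp only: mult_ac)
  then have "\<beta>\<^sup>2 * (\<Sum>a\<in>V. \<Sum>b\<in>V. \<bar>kernel_mean V m * m a b - mean_degree V m a * mean_degree V m b\<bar>) \<le> 6 * \<eta> * N\<^sup>2"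
    using N by simp
  then show ?thesis
    unfolding near_rank_one_def m_def[symmetric] N_def[symmetric] using \<beta> by (simp add: field_simps)
qed

lemma mean_degree_unit:
  assumes "unit_kernel V m" "a \<in> V" "finite V"
  shows "0 \<le> mean_degree V m a" "mean_degree V m a \<le> 1"
proof -
  have "0 \<le> (\<Sum>b\<in>V. m a b)" "(\<Sum>b\<in>V. m a b) \<le> (\<Sum>b\<in>V. 1)"
    using assms by (auto simp: unit_kernel_def simp del: sum_constant intro!: sum_nonneg sum_mono)
  then show "0 \<le> mean_degree V m a" "mean_degree V m a \<le> 1"
    by (auto simp: mean_degree_def divide_le_eq_1)
qed

lemma kernel_mean_unit:
  assumes "unit_kernel V m" "finite V"
  shows "0 \<le> kernel_mean V m" "kernel_mean V m \<le> 1"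
proof -
  have "0 \<le> (\<Sum>a\<in>V. mean_degree V m a)" "(\<Sum>a\<in>V. mean_degree V m a) \<le> (\<Sum>a\<in>V. 1)"
    using mean_degree_unit[OF assms(1) _ assms(2)] by (auto simp del: sum_constant intro!: sum_nonneg sum_mono)
  then show "0 \<le> kernel_mean V m" "kernel_mean V m \<le> 1"
    by (auto simp: kernel_mean_def divide_le_eq_1)
qed

lemma mean_degree_complement:
  assumes "finite V" "V \<noteq> {}"
  shows "mean_degree V (\<lambda>x y. 1 - m x y) a = 1 - mean_degree V m a"
  using assms by (simp add: mean_degree_def sum_subtractf diff_divide_distrib)

lemma kernel_mean_complement:
  assumes "finite V" "V \<noteq> {}"
  shows "kernel_mean V (\<lambda>x y. 1 - m x y) = 1 - kernel_mean V m"
  using assms by (simp add: kernel_mean_def mean_degree_complement sum_subtractf diff_divide_distrib)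

text \<open>The difference of the two relations is linear: m(a,b) + \<mu> is close to f(a) + f(b).
  Substituted into the first it yields the product relation, whose double sum is the square of the
  total deviation of f from \<mu>; this is where the square root comes from. The linear relation
  then carries the bound over to m.\<close>

lemma near_rank_one_complement_imp_near_const:
  assumes fin: "finite V" "V \<noteq> {}" and m: "unit_kernel V m" and \<theta>: "0 \<le> \<theta>"
    and r1: "near_rank_one V m \<theta>" and r2: "near_rank_one V (\<lambda>x y. 1 - m x y) \<theta>"
  shows "(\<Sum>a\<in>V. \<Sum>b\<in>V. \<bar>m a b - kernel_mean V m\<bar>) \<le> (2 * \<theta> + 2 * sqrt (3 * \<theta>)) * (real (card V))\<^sup>2"
proof -
  define f \<mu> N where "f = mean_degree V m" and "\<mu> = kernel_mean V m" and "N = real (card V)"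
  have \<mu>: "0 \<le> \<mu>" "\<mu> \<le> 1"
    using kernel_mean_unit[OF m fin(1)] by (auto simp: \<mu>_def)
  have N: "0 < N"
    using fin by (simp add: N_def card_gt_0_iff)
  have e1: "(\<Sum>a\<in>V. \<Sum>b\<in>V. \<bar>\<mu> * m a b - f a * f b\<bar>) \<le> \<theta> * N\<^sup>2"
    using r1 by (simp add: near_rank_one_def f_def \<mu>_def N_def)
  have e2: "(\<Sum>a\<in>V. \<Sum>b\<in>V. \<bar>(1 - \<mu>) * (1 - m a b) - (1 - f a) * (1 - f b)\<bar>) \<le> \<theta> * N\<^sup>2"
    using r2 unfolding near_rank_one_def mean_degree_complement[OF fin] kernel_mean_complement[OF fin]
    by (simp add: f_def \<mu>_def N_def)
  have "(\<Sum>a\<in>V. \<Sum>b\<in>V. \<bar>m a b + \<mu> - f a - f b\<bar>) \<le>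
      (\<Sum>a\<in>V. \<Sum>b\<in>V. \<bar>\<mu> * m a b - f a * f b\<bar> + \<bar>(1 - \<mu>) * (1 - m a b) - (1 - f a) * (1 - f b)\<bar>)"
  proof (intro sum_mono)
    fix a b
    have "m a b + \<mu> - f a - f b =
        (\<mu> * m a b - f a * f b) - ((1 - \<mu>) * (1 - m a b) - (1 - f a) * (1 - f b))"
      by (simp add: algebra_simps)
    then show "\<bar>m a b + \<mu> - f a - f b\<bar> \<le>
        \<bar>\<mu> * m a b - f a * f b\<bar> + \<bar>(1 - \<mu>) * (1 - m a b) - (1 - f a) * (1 - f b)\<bar>"
      by linarith
  qed
  then have e3: "(\<Sum>a\<in>V. \<Sum>b\<in>V. \<bar>m a b + \<mu> - f a - f b\<bar>) \<le> 2 * \<theta> * N\<^sup>2"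
    using e1 e2 by (simp add: sum.distrib)
  define s where "s = (\<Sum>a\<in>V. \<bar>f a - \<mu>\<bar>)"
  have "s\<^sup>2 = (\<Sum>a\<in>V. \<Sum>b\<in>V. \<bar>(f a - \<mu>) * (f b - \<mu>)\<bar>)"
    by (simp add: s_def power2_eq_square sum_product abs_mult)
  also have "\<dots> \<le> (\<Sum>a\<in>V. \<Sum>b\<in>V. \<bar>\<mu> * m a b - f a * f b\<bar> + \<bar>m a b + \<mu> - f a - f b\<bar>)"
  proof (intro sum_mono)
    fix a b
    have "(f a - \<mu>) * (f b - \<mu>) = \<mu> * (m a b + \<mu> - f a - f b) - (\<mu> * m a b - f a * f b)"
      by (simp add: algebra_simps)
    moreover have "\<bar>\<mu> * (m a b + \<mu> - f a - f b)\<bar> \<le> \<bar>m a b + \<mu> - f a - f b\<bar>"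
      using \<mu> by (intro abs_mult_le_unit) auto
    ultimately show "\<bar>(f a - \<mu>) * (f b - \<mu>)\<bar> \<le> \<bar>\<mu> * m a b - f a * f b\<bar> + \<bar>m a b + \<mu> - f a - f b\<bar>"
      by linarith
  qed
  also have "\<dots> \<le> 3 * \<theta> * N\<^sup>2"
    using e1 e3 by (simp add: sum.distrib)
  finally have "s \<le> sqrt (3 * \<theta> * N\<^sup>2)"
    by (rule real_le_rsqrt)
  then have s: "s \<le> sqrt (3 * \<theta>) * N"
    using N by (simp add: real_sqrt_mult)
  have "(\<Sum>a\<in>V. \<Sum>b\<in>V. \<bar>m a b - \<mu>\<bar>) \<le>
      (\<Sum>a\<in>V. \<Sum>b\<in>V. \<bar>m a b + \<mu> - f a - f b\<bar> + \<bar>f a - \<mu>\<bar> + \<bar>f b - \<mu>\<bar>)"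
    by (intro sum_mono) linarith
  also have "\<dots> = (\<Sum>a\<in>V. \<Sum>b\<in>V. \<bar>m a b + \<mu> - f a - f b\<bar>) + 2 * (N * s)"
    by (simp add: sum.distrib s_def N_def sum_distrib_left[symmetric])
  also have "\<dots> \<le> 2 * \<theta> * N\<^sup>2 + 2 * (N * (sqrt (3 * \<theta>) * N))"
    using e3 s N by (intro add_mono mult_left_mono) auto
  finally show ?thesis
    by (simp add: \<mu>_def N_def power2_eq_square algebra_simps)
qed


section \<open>Cliques: a single near rank one relation\<close>

text \<open>Factor out s - t: the cofactor is a sum of nonnegative terms, one of which is s^(n-1)
  \<ge> s^n. The weight s^n costs nothing later because the star product supplies it.\<close>

lemma abs_diff_mult_power_le:
  fixes s t :: real
  assumes "0 \<le> s" "s \<le> 1" "0 \<le> t" "0 < n"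
  shows "\<bar>s - t\<bar> * s ^ n \<le> \<bar>s ^ n - t ^ n\<bar>"
proof -
  obtain l where n: "n = Suc l"
    using assms(4) by (cases n) auto
  have "s ^ n \<le> s ^ l"
    unfolding n using assms by (simp add: mult_left_le_one_le)
  also have "s ^ l = t ^ (n - Suc l) * s ^ l"
    by (simp add: n)
  also have "\<dots> \<le> (\<Sum>i<n. t ^ (n - Suc i) * s ^ i)"
    using assms by (intro member_le_sum[where f = "\<lambda>i. t ^ (n - Suc i) * s ^ i"]) (auto simp: n)
  finally have "\<bar>s - t\<bar> * s ^ n \<le> \<bar>s - t\<bar> * \<bar>\<Sum>i<n. t ^ (n - Suc i) * s ^ i\<bar>"
    by (intro mult_left_mono) auto
  then show ?thesis
    unfolding power_diff_sumr2[of s n t] abs_mult .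
qed

lemma sum_PiE_coordinate:
  assumes "finite J" "finite V" "j \<in> J"
  shows "real (card V) * (\<Sum>c\<in>J \<rightarrow>\<^sub>E V. h (c j)) = real (card V) ^ card J * (\<Sum>b\<in>V. h b :: real)"
proof -
  have "(\<Sum>c\<in>J \<rightarrow>\<^sub>E V. h (c j)) = (\<Sum>b\<in>V. \<Sum>c\<in>J - {j} \<rightarrow>\<^sub>E V. h b)"
    unfolding sum_PiE_split[OF assms(3)] by simp
  also have "\<dots> = real (card V) ^ card (J - {j}) * (\<Sum>b\<in>V. h b)"
    unfolding sum_constant card_funcset[OF finite_Diff[OF assms(1)]] sum_distrib_left by simp
  finally show ?thesis
    unfolding card.remove[OF assms(1,3)] power_Suc by (simp only: mult.assoc)
qed

text \<open>As \<open>i0\<close> is the least index, every pair containing it has the form (i0, j),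
  so the moved vertex \<open>a\<close> always appears as first argument of \<open>m\<close>.\<close>

lemma clique_split:
  assumes "finite I" "i0 \<in> I" "\<And>i. i \<in> I \<Longrightarrow> i0 \<le> i"
  shows "kernel_prod (index_pairs I) (\<lambda>_. m) (c(i0 := a)) =
    (\<Prod>j\<in>I - {i0}. m a (c j)) * kernel_prod (index_pairs (I - {i0})) (\<lambda>_. m) c"
proof -
  have "index_pairs I = Pair i0 ` (I - {i0}) \<union> index_pairs (I - {i0})"
    using assms(2,3) by (force simp: index_pairs_def order_less_le)
  moreover have "Pair i0 ` (I - {i0}) \<inter> index_pairs (I - {i0}) = {}"
    by (auto simp: index_pairs_def)
  ultimately have "kernel_prod (index_pairs I) (\<lambda>_. m) (c(i0 := a)) =
      kernel_prod (Pair i0 ` (I - {i0})) (\<lambda>_. m) (c(i0 := a)) *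
      kernel_prod (index_pairs (I - {i0})) (\<lambda>_. m) (c(i0 := a))"
    unfolding kernel_prod_def using assms(1) by (simp add: prod.union_disjoint finite_index_pairs)
  moreover have "kernel_prod (Pair i0 ` (I - {i0})) (\<lambda>_. m) (c(i0 := a)) = (\<Prod>j\<in>I - {i0}. m a (c j))"
    unfolding kernel_prod_def by (subst prod.reindex) (auto simp: inj_on_def intro: prod.cong)
  moreover have "kernel_prod (index_pairs (I - {i0})) (\<lambda>_. m) (c(i0 := a)) =
      kernel_prod (index_pairs (I - {i0})) (\<lambda>_. m) c"
    unfolding kernel_prod_def by (rule prod.cong) (auto simp: index_pairs_def)
  ultimately show ?thesis
    by simp
qed

text \<open>Here \<open>s\<close>, \<open>t\<close> are the degrees of two vertices \<open>a\<close>, \<open>a'\<close> placed at the centre of a star of \<open>n\<close> leaves,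
  \<open>X\<close>, \<open>X'\<close> the products along the two stars, \<open>T\<close> the product over the pairs of leaves,
  \<open>\<Phi>\<close> the product of the degrees of the leaves and \<open>\<mu>n\<close> the \<open>n\<close>-th power of the mean.\<close>

lemma star_comparison:
  fixes s t \<mu>n T X X' \<Phi> \<beta> :: real
  assumes s: "0 \<le> s" "s \<le> 1" and t: "0 \<le> t" "t \<le> 1" and n: "0 < n"
    and \<mu>n: "0 \<le> \<mu>n" "\<mu>n \<le> 1" and T: "0 \<le> T" "T \<le> 1" and \<Phi>: "0 \<le> \<Phi>"
  shows "\<bar>s - t\<bar> * (\<mu>n * \<beta>) \<le> 2 * \<bar>X * T - \<beta>\<bar> + \<bar>X' * T - \<beta>\<bar>
    + 2 * \<bar>\<mu>n * X - s ^ n * \<Phi>\<bar> + \<bar>\<mu>n * X' - t ^ n * \<Phi>\<bar>"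
proof -
  define F where "F = \<bar>s - t\<bar>"
  have F: "0 \<le> F" "F \<le> 1"
    using s t by (auto simp: F_def)
  define d d' e e' where d: "d = \<bar>X * T - \<beta>\<bar>" "d' = \<bar>X' * T - \<beta>\<bar>"
    and e: "e = \<bar>\<mu>n * X - s ^ n * \<Phi>\<bar>" "e' = \<bar>\<mu>n * X' - t ^ n * \<Phi>\<bar>"
  \<comment> \<open>Three replacements follow: \<beta> by X T, then \<mu>n X by s^n \<Phi>, then F
    s^n by the difference of the n-th powers. Cofactors in [0, 1] keep the errors from
    growing.\<close>
  have "F * \<mu>n * \<beta> \<le> F * \<mu>n * (X * T + d)"
    using F \<mu>n by (intro mult_left_mono) (auto simp: d)
  moreover have "F * \<mu>n * d \<le> 1 * d"
    using F \<mu>n by (intro mult_right_mono) (auto simp: d mult_le_one)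
  ultimately have 1: "F * (\<mu>n * \<beta>) \<le> d + (F * T) * (\<mu>n * X)"
    by (simp add: algebra_simps)
  have "(F * T) * (\<mu>n * X) \<le> (F * T) * (s ^ n * \<Phi> + e)"
    using F T by (intro mult_left_mono) (auto simp: e)
  moreover have "(F * T) * e \<le> 1 * e"
    using F T by (intro mult_right_mono) (auto simp: e mult_le_one)
  ultimately have 2: "(F * T) * (\<mu>n * X) \<le> e + (F * s ^ n) * (\<Phi> * T)"
    by (simp add: algebra_simps)
  have "(F * s ^ n) * (\<Phi> * T) \<le> \<bar>s ^ n - t ^ n\<bar> * (\<Phi> * T)"
    unfolding F_def using s t n \<Phi> T by (intro mult_right_mono abs_diff_mult_power_le) auto
  also have "\<dots> = \<bar>(s ^ n - t ^ n) * (\<Phi> * T)\<bar>"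
    using \<Phi> T by (simp add: abs_mult)
  \<comment> \<open>Both stars share their leaves, hence \<Phi> and T; this makes the difference of
    powers a combination of the four errors.\<close>
  also have "(s ^ n - t ^ n) * (\<Phi> * T) =
      \<mu>n * (X * T - \<beta>) - \<mu>n * (X' * T - \<beta>) - T * (\<mu>n * X - s ^ n * \<Phi>) + T * (\<mu>n * X' - t ^ n * \<Phi>)"
    by (simp add: algebra_simps)
  also have "\<bar>\<dots>\<bar> \<le> \<bar>\<mu>n * (X * T - \<beta>)\<bar> + \<bar>\<mu>n * (X' * T - \<beta>)\<bar>
      + \<bar>T * (\<mu>n * X - s ^ n * \<Phi>)\<bar> + \<bar>T * (\<mu>n * X' - t ^ n * \<Phi>)\<bar>"
    by linarith
  also have "\<dots> \<le> d + d' + e + e'"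
    unfolding d e using \<mu>n T by (intro add_mono abs_mult_le_unit) auto
  finally have 3: "(F * s ^ n) * (\<Phi> * T) \<le> d + d' + e + e'" .
  show ?thesis
    using 1 2 3 unfolding F_def[symmetric] d[symmetric] e[symmetric] by linarith
qed

text \<open>Attach two centres a, a' to the same n = k - 1 leaves. Near rank one turns the star
  products, times \<mu>^n, into f(a)^n \<Phi> and f(a')^n \<Phi>, so nearly equal clique products
  force f(a) close to f(a') on average. Then \<mu> m(a,b) is close to \<mu>^2, and \<mu> \<ge>
  \<beta>/2 permits the division.\<close>

lemma clique_L1_imp_near_const:
  assumes fin: "finite I" "finite V" and ne: "V \<noteq> {}" and k: "2 \<le> card I"
    and m: "unit_kernel V m" and r: "near_rank_one V m \<theta>" and \<theta>: "0 \<le> \<theta>"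
    and \<beta>: "0 < \<beta>" "\<beta> \<le> 1" and \<eta>: "0 \<le> \<eta>" "\<eta> \<le> \<beta> / 2"
    and L1: "(\<Sum>x\<in>I \<rightarrow>\<^sub>E V. \<bar>kernel_prod (index_pairs I) (\<lambda>_. m) x - \<beta>\<bar>) \<le> \<eta> * real (card V) ^ card I"
  shows "(\<Sum>a\<in>V. \<Sum>b\<in>V. \<bar>m a b - kernel_mean V m\<bar>) \<le>
    2 / \<beta> * (\<theta> + 6 * (\<eta> + real (card I - 1) * \<theta>) / ((\<beta> / 2) ^ (card I - 1) * \<beta>)) * (real (card V))\<^sup>2"
proof -
  define i0 where "i0 = Min I"
  have "I \<noteq> {}"
    using k by auto
  then have i0: "i0 \<in> I" "\<And>i. i \<in> I \<Longrightarrow> i0 \<le> i"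
    using fin by (auto simp: i0_def)
  define J n where "J = I - {i0}" and "n = card I - 1"
  have J: "finite J" "card J = n" "card I = Suc n" "0 < n"
    using fin i0 k by (auto simp: J_def n_def)
  define f \<mu> N where "f = mean_degree V m" and "\<mu> = kernel_mean V m" and "N = real (card V)"
  have f: "0 \<le> f a \<and> f a \<le> 1" if "a \<in> V" for a
    using mean_degree_unit[OF m that fin(2)] by (simp add: f_def)
  have \<mu>: "0 \<le> \<mu>" "\<mu> \<le> 1"
    using kernel_mean_unit[OF m fin(2)] by (auto simp: \<mu>_def)
  have N: "0 < N"
    using fin ne by (simp add: N_def card_gt_0_iff)
  have m': "0 \<le> m a b \<and> m a b \<le> 1" if "a \<in> V" "b \<in> V" for a b
    using m that by (auto simp: unit_kernel_def)
  let ?C = "J \<rightarrow>\<^sub>E V"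
  define T where "T c = kernel_prod (index_pairs J) (\<lambda>_. m) c" for c
  define X where "X c a = (\<Prod>j\<in>J. m a (c j))" for c a
  define \<Phi> where "\<Phi> c = (\<Prod>j\<in>J. f (c j))" for c
  define d where "d c a = \<bar>X c a * T c - \<beta>\<bar>" for c a
  define e where "e c a = \<bar>\<mu> ^ n * X c a - f a ^ n * \<Phi> c\<bar>" for c a
  have split: "kernel_prod (index_pairs I) (\<lambda>_. m) (c(i0 := a)) = X c a * T c" for c a
    using clique_split[OF fin(1) i0] by (simp add: X_def T_def J_def)
  have C: "c j \<in> V" if "c \<in> ?C" "j \<in> J" for c j
    using that by auto
  have sd: "(\<Sum>c\<in>?C. \<Sum>a\<in>V. d c a) \<le> \<eta> * N ^ Suc n"
  proof -
    have "(\<Sum>x\<in>I \<rightarrow>\<^sub>E V. \<bar>kernel_prod (index_pairs I) (\<lambda>_. m) x - \<beta>\<bar>) = (\<Sum>a\<in>V. \<Sum>c\<in>?C. d c a)"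
      by (subst sum_PiE_split[OF i0(1)]) (simp add: split d_def J_def)
    also have "\<dots> = (\<Sum>c\<in>?C. \<Sum>a\<in>V. d c a)"
      by (rule sum.swap)
    finally show ?thesis
      using L1 J(3) by (simp add: N_def)
  qed
  define r where "r a b = \<bar>\<mu> * m a b - f a * f b\<bar>" for a b
  have sr: "(\<Sum>a\<in>V. \<Sum>b\<in>V. r a b) \<le> \<theta> * N\<^sup>2"
    using assms(6) by (simp add: near_rank_one_def r_def \<mu>_def f_def N_def)
  have se: "(\<Sum>c\<in>?C. \<Sum>a\<in>V. e c a) \<le> real n * \<theta> * N ^ Suc n"
  proof -
    \<comment> \<open>Two products of factors bounded by 1 differ by at most the sum of the
      differences of their factors.\<close>
    have "e c a \<le> (\<Sum>j\<in>J. r a (c j))" if "c \<in> ?C" "a \<in> V" for c a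
    proof -
      have "\<mu> ^ n * X c a = (\<Prod>j\<in>J. \<mu> * m a (c j))" "f a ^ n * \<Phi> c = (\<Prod>j\<in>J. f a * f (c j))"
        using J by (simp_all add: X_def \<Phi>_def prod.distrib)
      moreover have "norm ((\<Prod>j\<in>J. \<mu> * m a (c j)) - (\<Prod>j\<in>J. f a * f (c j))) \<le>
          (\<Sum>j\<in>J. norm (\<mu> * m a (c j) - f a * f (c j)))"
        using that \<mu> m' f C by (intro norm_prod_diff) (auto simp: abs_mult intro!: mult_le_one)
      ultimately show ?thesis
        by (simp add: e_def r_def)
    qed
    then have "(\<Sum>c\<in>?C. \<Sum>a\<in>V. e c a) \<le> (\<Sum>c\<in>?C. \<Sum>a\<in>V. \<Sum>j\<in>J. r a (c j))"
      by (intro sum_mono) auto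
    also have "\<dots> = (\<Sum>c\<in>?C. \<Sum>j\<in>J. \<Sum>a\<in>V. r a (c j))"
      by (intro sum.cong refl sum.swap)
    also have "\<dots> = (\<Sum>j\<in>J. \<Sum>c\<in>?C. \<Sum>a\<in>V. r a (c j))"
      by (rule sum.swap)
    finally have "N * (\<Sum>c\<in>?C. \<Sum>a\<in>V. e c a) \<le> N * (\<Sum>j\<in>J. \<Sum>c\<in>?C. \<Sum>a\<in>V. r a (c j))"
      using N by (intro mult_left_mono) auto
    also have "\<dots> = (\<Sum>j\<in>J. N * (\<Sum>c\<in>?C. \<Sum>a\<in>V. r a (c j)))"
      by (simp add: sum_distrib_left)
    also have "\<dots> = (\<Sum>j\<in>J. N ^ n * (\<Sum>b\<in>V. \<Sum>a\<in>V. r a b))"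
      unfolding N_def using sum_PiE_coordinate[OF J(1) fin(2), where h = "\<lambda>b. \<Sum>a\<in>V. r a b"] J(2)
      by (intro sum.cong) auto
    also have "\<dots> = real n * N ^ n * (\<Sum>a\<in>V. \<Sum>b\<in>V. r a b)"
      using J by (subst sum.swap) simp
    also have "\<dots> \<le> real n * N ^ n * (\<theta> * N\<^sup>2)"
      using sr N by (intro mult_left_mono) auto
    also have "\<dots> = N * (real n * \<theta> * N ^ Suc n)"
      by (simp add: power2_eq_square)
    finally show ?thesis
      using N by simp
  qed
  have point: "\<bar>f a - f a'\<bar> * (\<mu> ^ n * \<beta>) \<le> 2 * d c a + d c a' + 2 * e c a + e c a'"
    if "c \<in> ?C" "a \<in> V" "a' \<in> V" for c a a'
  proof -
    have "0 \<le> T c" "T c \<le> 1"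
      unfolding T_def using that m C by (auto intro!: kernel_prod_unit[of "index_pairs J" J V])
    moreover have "0 \<le> \<Phi> c"
      unfolding \<Phi>_def using that f C by (intro prod_nonneg) auto
    ultimately show ?thesis
      unfolding d_def e_def using f that \<mu> J(4) by (intro star_comparison) (auto simp: power_le_one)
  qed
  let ?F = "\<Sum>a\<in>V. \<Sum>a'\<in>V. \<bar>f a - f a'\<bar>"
  have "N ^ n * (?F * (\<mu> ^ n * \<beta>)) = (\<Sum>c\<in>?C. \<Sum>a\<in>V. \<Sum>a'\<in>V. \<bar>f a - f a'\<bar> * (\<mu> ^ n * \<beta>))"
    using J fin by (simp add: sum_distrib_right[symmetric] card_funcset N_def)
  also have "\<dots> \<le> (\<Sum>c\<in>?C. \<Sum>a\<in>V. \<Sum>a'\<in>V. 2 * d c a + d c a' + 2 * e c a + e c a')"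
    by (intro sum_mono point)
  also have "\<dots> = 3 * (N * (\<Sum>c\<in>?C. \<Sum>a\<in>V. d c a)) + 3 * (N * (\<Sum>c\<in>?C. \<Sum>a\<in>V. e c a))"
    by (simp add: sum.distrib sum_distrib_left[symmetric] N_def)
  also have "\<dots> \<le> 3 * (N * (\<eta> * N ^ Suc n)) + 3 * (N * (real n * \<theta> * N ^ Suc n))"
    using sd se N by (intro add_mono mult_left_mono) auto
  also have "\<dots> = N ^ n * (3 * (\<eta> + real n * \<theta>) * N\<^sup>2)"
    by (simp add: power2_eq_square algebra_simps)
  finally have F1: "?F * (\<mu> ^ n * \<beta>) \<le> 3 * (\<eta> + real n * \<theta>) * N\<^sup>2"
    using N by simp
  have tot: "(\<Sum>a\<in>V. \<Sum>b\<in>V. m a b) = N\<^sup>2 * \<mu>"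
    using N by (simp add: \<mu>_def kernel_mean_def mean_degree_def N_def power2_eq_square sum_divide_distrib[symmetric])
  obtain j where j: "j \<in> J"
    using J by (metis card.empty equals0I less_irrefl)
  \<comment> \<open>A product of numbers in [0, 1] is at most each of its factors, so the mean of
    \<open>m\<close> is at least \<beta> - \<eta>.\<close>
  have \<mu>\<beta>: "\<beta> / 2 \<le> \<mu>"
  proof -
    have "\<beta> \<le> m a (c j) + d c a" if "c \<in> ?C" "a \<in> V" for c a
    proof -
      have T: "0 \<le> T c" "T c \<le> 1"
        unfolding T_def using that m C by (auto intro!: kernel_prod_unit[of "index_pairs J" J V])
      have "X c a = m a (c j) * (\<Prod>l\<in>J - {j}. m a (c l))"
        unfolding X_def using J(1) j by (rule prod.remove)
      also have "\<dots> \<le> m a (c j) * 1"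
        using that m' C j by (intro mult_left_mono prod_le_1) auto
      finally have "X c a \<le> m a (c j)"
        by simp
      moreover have "X c a * T c \<le> X c a * 1"
        using T that m' C by (intro mult_left_mono) (auto simp: X_def intro!: prod_nonneg)
      ultimately show ?thesis
        by (auto simp: d_def)
    qed
    then have "(\<Sum>c\<in>?C. \<Sum>a\<in>V. \<beta>) \<le> (\<Sum>c\<in>?C. \<Sum>a\<in>V. m a (c j) + d c a)"
      by (intro sum_mono) auto
    also have "\<dots> = (\<Sum>c\<in>?C. \<Sum>a\<in>V. m a (c j)) + (\<Sum>c\<in>?C. \<Sum>a\<in>V. d c a)"
      by (simp add: sum.distrib)
    finally have "N ^ n * (N * \<beta>) \<le> (\<Sum>c\<in>?C. \<Sum>a\<in>V. m a (c j)) + \<eta> * N ^ Suc n"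
      using sd J fin by (simp add: card_funcset N_def)
    then have "N * (N ^ n * (N * \<beta>)) \<le> N * ((\<Sum>c\<in>?C. \<Sum>a\<in>V. m a (c j)) + \<eta> * N ^ Suc n)"
      using N by (intro mult_left_mono) auto
    also have "\<dots> = N ^ n * (\<Sum>b\<in>V. \<Sum>a\<in>V. m a b) + N * (\<eta> * N ^ Suc n)"
      unfolding distrib_left N_def sum_PiE_coordinate[OF J(1) fin(2) j, where h = "\<lambda>b. \<Sum>a\<in>V. m a b"] J(2) ..
    also have "(\<Sum>b\<in>V. \<Sum>a\<in>V. m a b) = N\<^sup>2 * \<mu>"
      unfolding tot[symmetric] by (rule sum.swap)
    finally have "(N ^ n * N\<^sup>2) * \<beta> \<le> (N ^ n * N\<^sup>2) * (\<mu> + \<eta>)"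
      by (simp add: power2_eq_square algebra_simps)
    then have "\<beta> \<le> \<mu> + \<eta>"
      using N by simp
    then show ?thesis
      using \<eta> by simp
  qed
  define \<rho> where "\<rho> = 3 * (\<eta> + real n * \<theta>) / ((\<beta> / 2) ^ n * \<beta>)"
  have "?F * ((\<beta> / 2) ^ n * \<beta>) \<le> ?F * (\<mu> ^ n * \<beta>)"
    using \<mu>\<beta> \<beta> by (intro mult_left_mono mult_right_mono power_mono sum_nonneg) auto
  then have F: "?F \<le> \<rho> * N\<^sup>2"
    using F1 \<beta> unfolding \<rho>_def by (simp add: pos_le_divide_eq)
  define s where "s = (\<Sum>a\<in>V. \<bar>f a - \<mu>\<bar>)"
  have "N * s \<le> ?F"
  proof -
    \<comment> \<open>\<mu> is the average of f, so the distance to \<mu> is at most the average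
      distance to the values of f.\<close>
    have "N * \<bar>f a - \<mu>\<bar> \<le> (\<Sum>a'\<in>V. \<bar>f a - f a'\<bar>)" for a
    proof -
      have "(\<Sum>a'\<in>V. f a - f a') = N * (f a - \<mu>)"
        using N by (simp add: sum_subtractf \<mu>_def kernel_mean_def f_def N_def algebra_simps)
      then have "N * \<bar>f a - \<mu>\<bar> = \<bar>\<Sum>a'\<in>V. f a - f a'\<bar>"
        using N by (simp add: abs_mult)
      then show ?thesis
        by (simp add: sum_abs)
    qed
    then show ?thesis
      by (simp add: s_def sum_distrib_left sum_mono)
  qed
  then have s: "N * s \<le> \<rho> * N\<^sup>2"
    using F by simp
  have "(\<Sum>a\<in>V. \<Sum>b\<in>V. \<mu> * \<bar>m a b - \<mu>\<bar>) \<le> (\<Sum>a\<in>V. \<Sum>b\<in>V. r a b + \<bar>f a - \<mu>\<bar> + \<bar>f b - \<mu>\<bar>)"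
  proof (intro sum_mono)
    fix a b assume "a \<in> V" "b \<in> V"
    then have "\<bar>f a * f b - \<mu> * \<mu>\<bar> \<le> \<bar>f a - \<mu>\<bar> + \<bar>f b - \<mu>\<bar>"
      using f \<mu> by (intro abs_mult_diff_le) auto
    moreover have "\<mu> * \<bar>m a b - \<mu>\<bar> = \<bar>\<mu> * (m a b - \<mu>)\<bar>"
      using \<mu> by (simp add: abs_mult)
    moreover have "\<mu> * (m a b - \<mu>) = (\<mu> * m a b - f a * f b) + (f a * f b - \<mu> * \<mu>)"
      by (simp add: algebra_simps)
    ultimately show "\<mu> * \<bar>m a b - \<mu>\<bar> \<le> r a b + \<bar>f a - \<mu>\<bar> + \<bar>f b - \<mu>\<bar>"
      unfolding r_def by linarith
  qed
  also have "\<dots> = (\<Sum>a\<in>V. \<Sum>b\<in>V. r a b) + 2 * (N * s)"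
    by (simp add: sum.distrib s_def N_def sum_distrib_left[symmetric])
  also have "\<dots> \<le> (\<theta> + 2 * \<rho>) * N\<^sup>2"
    using sr s by (simp add: algebra_simps)
  finally have "\<mu> * (\<Sum>a\<in>V. \<Sum>b\<in>V. \<bar>m a b - \<mu>\<bar>) \<le> (\<theta> + 2 * \<rho>) * N\<^sup>2"
    by (simp add: sum_distrib_left)
  moreover have "\<beta> / 2 * (\<Sum>a\<in>V. \<Sum>b\<in>V. \<bar>m a b - \<mu>\<bar>) \<le> \<mu> * (\<Sum>a\<in>V. \<Sum>b\<in>V. \<bar>m a b - \<mu>\<bar>)"
    using \<mu>\<beta> by (intro mult_right_mono sum_nonneg) auto
  ultimately have "\<beta> / 2 * (\<Sum>a\<in>V. \<Sum>b\<in>V. \<bar>m a b - \<mu>\<bar>) \<le> (\<theta> + 2 * \<rho>) * N\<^sup>2"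
    by linarith
  then have "(\<Sum>a\<in>V. \<Sum>b\<in>V. \<bar>m a b - \<mu>\<bar>) \<le> 2 / \<beta> * (\<theta> + 2 * \<rho>) * N\<^sup>2"
    using \<beta> by (simp add: field_simps)
  then show ?thesis
    by (simp add: \<rho>_def \<mu>_def N_def n_def)
qed

section \<open>Kernels with nearly constant pattern products\<close>

definition pattern_kernel :: "(nat \<times> nat) set \<Rightarrow> ('a \<Rightarrow> 'a \<Rightarrow> real) \<Rightarrow> nat \<times> nat \<Rightarrow> 'a \<Rightarrow> 'a \<Rightarrow> real" where
  "pattern_kernel A m e x y = (if e \<in> A then m x y else 1 - m x y)"

lemma unit_kernel_complement: "unit_kernel V m \<Longrightarrow> unit_kernel V (\<lambda>x y. 1 - m x y)"
  by (simp add: unit_kernel_def)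

lemma pattern_kernel_eq:
  "e \<in> A \<Longrightarrow> pattern_kernel A m e = m" "e \<notin> A \<Longrightarrow> pattern_kernel A m e = (\<lambda>x y. 1 - m x y)"
  by (auto simp: pattern_kernel_def fun_eq_iff)

lemma unit_pattern_kernel: "unit_kernel V m \<Longrightarrow> unit_kernel V (pattern_kernel A m e)"
  by (cases "e \<in> A") (simp_all add: pattern_kernel_eq unit_kernel_complement)

lemma cut_close_L1:
  assumes "finite V" "(\<Sum>x\<in>V. \<Sum>y\<in>V. \<bar>k x y - l x y\<bar>) \<le> \<eta> * (real (card V))\<^sup>2"
  shows "cut_close V P k l \<eta>"
  unfolding cut_close_def
proof (intro allI impI)
  fix u v :: "'a \<Rightarrow> real" and s :: "'b \<Rightarrow> 'b \<Rightarrow> real"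
  assume u: "\<forall>x\<in>V. 0 \<le> u x \<and> u x \<le> 1" and v: "\<forall>x\<in>V. 0 \<le> v x \<and> v x \<le> 1" and s: "\<forall>A B. \<bar>s A B\<bar> \<le> 1"
  have "\<bar>\<Sum>x\<in>V. \<Sum>y\<in>V. (k x y - l x y) * u x * v y * s (P x) (P y)\<bar> \<le>
      (\<Sum>x\<in>V. \<Sum>y\<in>V. \<bar>(k x y - l x y) * u x * v y * s (P x) (P y)\<bar>)"
    by (rule order_trans[OF sum_abs sum_mono[OF sum_abs]])
  also have "\<dots> \<le> (\<Sum>x\<in>V. \<Sum>y\<in>V. \<bar>k x y - l x y\<bar>)"
  proof (intro sum_mono)
    fix x y assume "x \<in> V" "y \<in> V"
    then have "\<bar>u x * v y * s (P x) (P y)\<bar> \<le> 1"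
      using u v s by (auto simp: abs_mult intro!: mult_le_one)
    then have "\<bar>(u x * v y * s (P x) (P y)) * (k x y - l x y)\<bar> \<le> \<bar>k x y - l x y\<bar>"
      by (rule abs_mult_le_unit)
    then show "\<bar>(k x y - l x y) * u x * v y * s (P x) (P y)\<bar> \<le> \<bar>k x y - l x y\<bar>"
      by (simp only: mult_ac)
  qed
  finally show "\<bar>\<Sum>x\<in>V. \<Sum>y\<in>V. (k x y - l x y) * u x * v y * s (P x) (P y)\<bar> \<le> \<eta> * (real (card V))\<^sup>2"
    using assms(2) by linarith
qed

lemma cut_close_trans:
  assumes "cut_close V P k l \<eta>" "cut_close V P l m \<theta>"
  shows "cut_close V P k m (\<eta> + \<theta>)"
  unfolding cut_close_def
proof (intro allI impI)
  fix u v :: "'a \<Rightarrow> real" and s :: "'b \<Rightarrow> 'b \<Rightarrow> real"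
  assume "\<forall>x\<in>V. 0 \<le> u x \<and> u x \<le> 1" "\<forall>x\<in>V. 0 \<le> v x \<and> v x \<le> 1" "\<forall>A B. \<bar>s A B\<bar> \<le> 1"
  then have "\<bar>\<Sum>x\<in>V. \<Sum>y\<in>V. (k x y - l x y) * u x * v y * s (P x) (P y)\<bar> \<le> \<eta> * (real (card V))\<^sup>2"
    "\<bar>\<Sum>x\<in>V. \<Sum>y\<in>V. (l x y - m x y) * u x * v y * s (P x) (P y)\<bar> \<le> \<theta> * (real (card V))\<^sup>2"
    using assms unfolding cut_close_def by blast+
  moreover have "(\<Sum>x\<in>V. \<Sum>y\<in>V. (k x y - m x y) * u x * v y * s (P x) (P y)) =
      (\<Sum>x\<in>V. \<Sum>y\<in>V. (k x y - l x y) * u x * v y * s (P x) (P y)) +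
      (\<Sum>x\<in>V. \<Sum>y\<in>V. (l x y - m x y) * u x * v y * s (P x) (P y))"
    unfolding sum.distrib[symmetric] by (intro sum.cong refl) (simp add: algebra_simps)
  ultimately show "\<bar>\<Sum>x\<in>V. \<Sum>y\<in>V. (k x y - m x y) * u x * v y * s (P x) (P y)\<bar> \<le> (\<eta> + \<theta>) * (real (card V))\<^sup>2"
    unfolding distrib_right by linarith
qed

lemma cut_close_mono:
  assumes "cut_close V P k l \<eta>" "\<eta> \<le> \<theta>"
  shows "cut_close V P k l \<theta>"
  using assms mult_right_mono[OF assms(2), of "(real (card V))\<^sup>2"]
  unfolding cut_close_def by (meson order_trans zero_le_power2)

lemma cut_close_complement:
  assumes "cut_close V P k l \<eta>"
  shows "cut_close V P (\<lambda>x y. 1 - k x y) (\<lambda>x y. 1 - l x y) \<eta>"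
  unfolding cut_close_def
proof (intro allI impI)
  fix u v :: "'a \<Rightarrow> real" and s :: "'b \<Rightarrow> 'b \<Rightarrow> real"
  assume *: "\<forall>x\<in>V. 0 \<le> u x \<and> u x \<le> 1" "\<forall>x\<in>V. 0 \<le> v x \<and> v x \<le> 1" "\<forall>A B. \<bar>s A B\<bar> \<le> 1"
  have "(\<Sum>x\<in>V. \<Sum>y\<in>V. (1 - k x y - (1 - l x y)) * u x * v y * s (P x) (P y)) =
      - (\<Sum>x\<in>V. \<Sum>y\<in>V. (k x y - l x y) * u x * v y * s (P x) (P y))"
    unfolding sum_negf[symmetric] by (intro sum.cong refl) (simp add: algebra_simps)
  then show "\<bar>\<Sum>x\<in>V. \<Sum>y\<in>V. (1 - k x y - (1 - l x y)) * u x * v y * s (P x) (P y)\<bar> \<le> \<eta> * (real (card V))\<^sup>2"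
    using assms * unfolding cut_close_def by simp
qed

lemma cut_close_pattern_kernel:
  assumes "cut_close V P k l \<eta>"
  shows "cut_close V P (pattern_kernel A k e) (pattern_kernel A l e) \<eta>"
  using assms cut_close_complement[OF assms] by (cases "e \<in> A") (simp_all add: pattern_kernel_eq)

lemma cut_close_coarsen:
  assumes "cut_close V P k l \<eta>"
  shows "cut_close V (\<lambda>x. r (P x)) k l \<eta>"
  unfolding cut_close_def
proof (intro allI impI)
  fix u v :: "'a \<Rightarrow> real" and s :: "'c \<Rightarrow> 'c \<Rightarrow> real"
  assume *: "\<forall>x\<in>V. 0 \<le> u x \<and> u x \<le> 1" "\<forall>x\<in>V. 0 \<le> v x \<and> v x \<le> 1" "\<forall>A B. \<bar>s A B\<bar> \<le> 1"
  then have "\<forall>A B. \<bar>s (r A) (r B)\<bar> \<le> 1"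
    by blast
  with * assms show "\<bar>\<Sum>x\<in>V. \<Sum>y\<in>V. (k x y - l x y) * u x * v y * s (r (P x)) (r (P y))\<bar> \<le> \<eta> * (real (card V))\<^sup>2"
    unfolding cut_close_def by (elim allE[of _ u] allE[of _ v] allE[of _ "\<lambda>A B. s (r A) (r B)"]) simp
qed

text \<open>If some pairs of \<open>I\<close> lie in \<open>A\<close> and some do not, both rank one
  relations hold; otherwise the pattern is a clique in \<open>m\<close> or in its complement. The
  threshold is fixed before \<open>V\<close> and \<open>m\<close>, so that it serves a whole
  sequence of graphs.\<close>

lemma pattern_L1_imp_near_const:
  assumes fin: "finite I" and k: "2 \<le> card I" and \<beta>: "0 < \<beta>" "\<beta> \<le> 1" and "0 < \<epsilon>"
  obtains \<eta> where "0 < \<eta>" "\<And>V (m :: 'a \<Rightarrow> 'a \<Rightarrow> real). finite V \<Longrightarrow> V \<noteq> {} \<Longrightarrow> unit_kernel V m \<Longrightarrow>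
    (\<And>x y. x \<in> V \<Longrightarrow> y \<in> V \<Longrightarrow> m x y = m y x) \<Longrightarrow>
    (\<Sum>x\<in>I \<rightarrow>\<^sub>E V. \<bar>kernel_prod (index_pairs I) (pattern_kernel A m) x - \<beta>\<bar>) \<le> \<eta> * real (card V) ^ card I \<Longrightarrow>
    (\<Sum>a\<in>V. \<Sum>b\<in>V. \<bar>m a b - kernel_mean V m\<bar>) \<le> \<epsilon> * (real (card V))\<^sup>2"
proof -
  define n where "n = card I - 1"
  \<comment> \<open>With \<theta> = 6 \<eta> / \<beta>^2 the factor in
    \<open>clique_L1_imp_near_const\<close> becomes exactly C \<eta>.\<close>
  define C where "C = 2 / \<beta> * (6 / \<beta>\<^sup>2 + 6 * (1 + real n * (6 / \<beta>\<^sup>2)) / ((\<beta> / 2) ^ n * \<beta>))"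
  have C: "0 < C"
    using \<beta> by (auto simp: C_def intro!: mult_pos_pos divide_pos_pos add_pos_nonneg)
  \<comment> \<open>The first two entries are for the clique case; the last two give 2 \<theta>
    \<le> \<epsilon>/2 and sqrt (3 \<theta>) \<le> \<epsilon>/4 in the mixed case.\<close>
  define \<eta> where "\<eta> = Min {\<beta> / 2, \<epsilon> / C, \<beta>\<^sup>2 * \<epsilon> / 24, \<beta>\<^sup>2 * \<epsilon>\<^sup>2 / 288}"
  have \<eta>: "0 < \<eta>" "\<eta> \<le> \<beta> / 2" "\<eta> \<le> \<epsilon> / C" "\<eta> \<le> \<beta>\<^sup>2 * \<epsilon> / 24" "\<eta> \<le> \<beta>\<^sup>2 * \<epsilon>\<^sup>2 / 288"
  proof -
    show "0 < \<eta>"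
      using \<beta> C \<open>0 < \<epsilon>\<close> by (simp add: \<eta>_def)
    show "\<eta> \<le> \<beta> / 2" "\<eta> \<le> \<epsilon> / C" "\<eta> \<le> \<beta>\<^sup>2 * \<epsilon> / 24" "\<eta> \<le> \<beta>\<^sup>2 * \<epsilon>\<^sup>2 / 288"
      unfolding \<eta>_def by (rule Min_le; simp)+
  qed
  define \<theta> where "\<theta> = 6 * \<eta> / \<beta>\<^sup>2"
  have \<theta>: "0 \<le> \<theta>" "2 * \<theta> \<le> \<epsilon> / 2" "3 * \<theta> \<le> (\<epsilon> / 4)\<^sup>2"
    using \<eta> \<beta> by (simp_all add: \<theta>_def field_simps power2_eq_square)
  have C\<eta>: "2 / \<beta> * (\<theta> + 6 * (\<eta> + real n * \<theta>) / ((\<beta> / 2) ^ n * \<beta>)) \<le> \<epsilon>"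
  proof -
    have "2 / \<beta> * (\<theta> + 6 * (\<eta> + real n * \<theta>) / ((\<beta> / 2) ^ n * \<beta>)) = C * \<eta>"
      by (simp add: C_def \<theta>_def add_divide_distrib algebra_simps)
    also have "\<dots> \<le> \<epsilon>"
      using \<eta>(3) C by (simp add: pos_le_divide_eq mult.commute)
    finally show ?thesis .
  qed
  have clique: "(\<Sum>a\<in>V. \<Sum>b\<in>V. \<bar>m a b - kernel_mean V m\<bar>) \<le> \<epsilon> * (real (card V))\<^sup>2"
    if V: "finite V" "V \<noteq> {}" and m: "unit_kernel V m" and r: "near_rank_one V m \<theta>"
      and L1: "(\<Sum>x\<in>I \<rightarrow>\<^sub>E V. \<bar>kernel_prod (index_pairs I) (\<lambda>_. m) x - \<beta>\<bar>) \<le> \<eta> * real (card V) ^ card I"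
    for V and m :: "'a \<Rightarrow> 'a \<Rightarrow> real"
  proof -
    have "(\<Sum>a\<in>V. \<Sum>b\<in>V. \<bar>m a b - kernel_mean V m\<bar>) \<le>
        2 / \<beta> * (\<theta> + 6 * (\<eta> + real n * \<theta>) / ((\<beta> / 2) ^ n * \<beta>)) * (real (card V))\<^sup>2"
      unfolding n_def using \<eta>(1) by (intro clique_L1_imp_near_const fin V k m r \<theta> \<beta> \<eta> L1) simp
    also have "\<dots> \<le> \<epsilon> * (real (card V))\<^sup>2"
      using C\<eta> by (intro mult_right_mono) auto
    finally show ?thesis .
  qed
  show ?thesis
  proof (rule that[OF \<eta>(1)])
    fix V and m :: "'a \<Rightarrow> 'a \<Rightarrow> real"
    assume V: "finite V" "V \<noteq> {}" and m: "unit_kernel V m"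
      and sym: "\<And>x y. x \<in> V \<Longrightarrow> y \<in> V \<Longrightarrow> m x y = m y x"
      and L1: "(\<Sum>x\<in>I \<rightarrow>\<^sub>E V. \<bar>kernel_prod (index_pairs I) (pattern_kernel A m) x - \<beta>\<bar>) \<le> \<eta> * real (card V) ^ card I"
    have rank: "near_rank_one V (pattern_kernel A m e) \<theta>" if e: "e \<in> index_pairs I" for e
    proof -
      obtain i j where ij: "e = (i, j)"
        by (cases e)
      show ?thesis
        unfolding \<theta>_def ij
        by (rule kernel_prod_L1_imp_near_rank_one[OF fin V(1) order_refl e[unfolded ij] V(2) unit_pattern_kernel[OF m] _ \<beta> L1])
          (simp add: pattern_kernel_def sym)
    qed
    have all: "kernel_prod (index_pairs I) (pattern_kernel A m) = kernel_prod (index_pairs I) (\<lambda>_. m')"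
      if "\<And>e. e \<in> index_pairs I \<Longrightarrow> pattern_kernel A m e = m'" for m'
      using that by (intro ext kernel_prod_cong) simp
    obtain i j where ij: "i \<in> I" "j \<in> I" "i < j"
      using k fin by (metis card_le_Suc0_iff_eq linorder_neqE_nat not_less_eq_eq numeral_2_eq_2)
    then have e0: "(i, j) \<in> index_pairs I"
      by (simp add: index_pairs_def)
    consider "index_pairs I \<subseteq> A" | "index_pairs I \<inter> A = {}"
      | e1 e2 where "e1 \<in> index_pairs I" "e1 \<in> A" "e2 \<in> index_pairs I" "e2 \<notin> A"
      by blast
    then show "(\<Sum>a\<in>V. \<Sum>b\<in>V. \<bar>m a b - kernel_mean V m\<bar>) \<le> \<epsilon> * (real (card V))\<^sup>2"
    proof cases
      case 1
      then have "pattern_kernel A m e = m" if "e \<in> index_pairs I" for e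
        using that by (intro pattern_kernel_eq) auto
      then show ?thesis
        using rank[OF e0] L1 all[of m] e0 by (intro clique[OF V m]) auto
    next
      case 2
      let ?m' = "\<lambda>x y. 1 - m x y"
      have *: "pattern_kernel A m e = ?m'" if "e \<in> index_pairs I" for e
        using that 2 by (intro pattern_kernel_eq) auto
      have "(\<Sum>a\<in>V. \<Sum>b\<in>V. \<bar>?m' a b - kernel_mean V ?m'\<bar>) \<le> \<epsilon> * (real (card V))\<^sup>2"
        using rank[OF e0] L1 all[of ?m', OF *] *[OF e0]
        by (intro clique[OF V unit_kernel_complement[OF m]]) auto
      then show ?thesis
        by (simp add: kernel_mean_complement[OF V] abs_minus_commute)
    next
      case 3
      have "near_rank_one V m \<theta>" "near_rank_one V (\<lambda>x y. 1 - m x y) \<theta>"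
        using rank[OF 3(1)] rank[OF 3(3)] 3(2,4) by (simp_all add: pattern_kernel_eq)
      then have "(\<Sum>a\<in>V. \<Sum>b\<in>V. \<bar>m a b - kernel_mean V m\<bar>) \<le> (2 * \<theta> + 2 * sqrt (3 * \<theta>)) * (real (card V))\<^sup>2"
        by (intro near_rank_one_complement_imp_near_const V m \<theta>)
      also have "sqrt (3 * \<theta>) \<le> \<epsilon> / 4"
        using \<theta>(3) \<open>0 < \<epsilon>\<close> by (intro real_le_lsqrt) auto
      then have "2 * \<theta> + 2 * sqrt (3 * \<theta>) \<le> \<epsilon>"
        using \<theta>(2) by linarith
      then have "(2 * \<theta> + 2 * sqrt (3 * \<theta>)) * (real (card V))\<^sup>2 \<le> \<epsilon> * (real (card V))\<^sup>2"
        by (intro mult_right_mono) auto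
      finally show ?thesis .
    qed
  qed
qed

section \<open>From box counts to cut distance from a constant\<close>

text \<open>Number the vertices and cut the numbering into intervals of length b = |V| div M0 + 1.
  The added 1 makes M0 b exceed |V|, so M0 labels suffice.\<close>

lemma exists_small_classes:
  assumes "finite V" "0 < M0"
  shows "\<exists>P. P ` V \<subseteq> {..<M0} \<and> (\<forall>l :: nat. card {x\<in>V. P x = l} \<le> card V div M0 + 1)"
proof -
  obtain h where h: "bij_betw h V {0..<card V}"
    using ex_bij_betw_finite_nat[OF assms(1)] by auto
  define b where "b = card V div M0 + 1"
  define P where "P x = h x div b" for x
  have "h x div b < M0" if "x \<in> V" for x
  proof (rule less_mult_imp_div_less)
    have "h x < card V"
      using h that by (auto simp: bij_betw_def)
    also have "card V < M0 * b"
      using dividend_less_times_div[OF assms(2), of "card V"] by (simp add: b_def)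
    finally show "h x < M0 * b" .
  qed
  then have "P ` V \<subseteq> {..<M0}"
    by (auto simp: P_def)
  moreover have "card {x\<in>V. P x = l} \<le> b" for l
  proof -
    have "h ` {x\<in>V. P x = l} \<subseteq> {l * b..<l * b + b}"
    proof
      fix y assume "y \<in> h ` {x\<in>V. P x = l}"
      then have "y div b = l"
        by (auto simp: P_def)
      then show "y \<in> {l * b..<l * b + b}"
        using div_times_less_eq_dividend[of y b] dividend_less_div_times[of b y] by (simp add: b_def)
    qed
    moreover have "inj_on h {x\<in>V. P x = l}"
      using h by (auto simp: bij_betw_def intro: inj_on_subset)
    ultimately show ?thesis
      using card_inj_on_le[of h "{x\<in>V. P x = l}" "{l * b..<l * b + b}"] by simp
  qed
  ultimately show ?thesis
    unfolding b_def by blast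
qed

text \<open>This joins regularity, the L1 estimate for the step kernel \<open>W\<close> and the
  rigidity of nearly constant pattern products. All constants precede \<open>V\<close>. Since
  \<open>W\<close> is close to \<mu> in L1, the mean of its pattern product is close both to \<beta>
  and to the product at \<mu>, which gives the approximate equation for \<mu>.\<close>

lemma box_counts_imp_cut_close_const:
  assumes fin: "finite I" and k: "2 \<le> card I" and \<beta>: "0 < \<beta>" "\<beta> \<le> 1" and \<epsilon>: "0 < \<epsilon>" and \<gamma>: "0 < \<gamma>"
  obtains \<theta> N0 where "0 < \<theta>" "\<And>V (g :: 'a \<Rightarrow> 'a \<Rightarrow> real). finite V \<Longrightarrow> N0 \<le> card V \<Longrightarrow> unit_kernel V g \<Longrightarrow>
    (\<And>x y. x \<in> V \<Longrightarrow> y \<in> V \<Longrightarrow> g x y = g y x) \<Longrightarrow>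
    (\<And>U. (\<And>i. i \<in> I \<Longrightarrow> U i \<subseteq> V \<and> real (card (U i)) \<le> \<gamma> * real (card V)) \<Longrightarrow> disjoint_family_on U I \<Longrightarrow>
      \<bar>\<Sum>x\<in>PiE I U. kernel_prod (index_pairs I) (pattern_kernel A g) x - \<beta>\<bar> \<le> \<theta> * real (card V) ^ card I) \<Longrightarrow>
    \<exists>\<mu>\<in>{0..1}. \<bar>(\<Prod>e\<in>index_pairs I. if e \<in> A then \<mu> else 1 - \<mu>) - \<beta>\<bar> \<le> \<epsilon> \<and>
      cut_close V (\<lambda>_. ()) g (\<lambda>_ _. \<mu>) \<epsilon>"
proof -
  define c where "c = real (card (index_pairs I))"
  have c: "0 \<le> c"
    by (simp add: c_def)
  \<comment> \<open>Small enough that exchanging \<open>W\<close> for \<mu> at all c pairs costs at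
    most \<epsilon>/2.\<close>
  define \<epsilon>' where "\<epsilon>' = \<epsilon> / (2 * (c + 1))"
  have \<epsilon>': "0 < \<epsilon>'" "\<epsilon>' \<le> \<epsilon> / 2" "c * \<epsilon>' \<le> \<epsilon> / 2"
    using \<epsilon> c by (simp_all add: \<epsilon>'_def field_simps)
  obtain \<eta>1 where \<eta>1: "0 < \<eta>1" "\<And>V (m :: 'a \<Rightarrow> 'a \<Rightarrow> real). finite V \<Longrightarrow> V \<noteq> {} \<Longrightarrow> unit_kernel V m \<Longrightarrow>
    (\<And>x y. x \<in> V \<Longrightarrow> y \<in> V \<Longrightarrow> m x y = m y x) \<Longrightarrow>
    (\<Sum>x\<in>I \<rightarrow>\<^sub>E V. \<bar>kernel_prod (index_pairs I) (pattern_kernel A m) x - \<beta>\<bar>) \<le> \<eta>1 * real (card V) ^ card I \<Longrightarrow>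
    (\<Sum>a\<in>V. \<Sum>b\<in>V. \<bar>m a b - kernel_mean V m\<bar>) \<le> \<epsilon>' * (real (card V))\<^sup>2"
    using pattern_L1_imp_near_const[OF fin k \<beta> \<epsilon>'(1), where A = A and 'a = 'a] by blast
  define \<eta> where "\<eta> = min \<eta>1 (\<epsilon> / 2)"
  have \<eta>: "0 < \<eta>" "\<eta> \<le> \<eta>1" "\<eta> \<le> \<epsilon> / 2"
    using \<eta>1 \<epsilon> by (auto simp: \<eta>_def)
  define \<eta>r where "\<eta>r = min (\<epsilon> / 2) (\<eta> / (3 * (c + 1)))"
  have \<eta>r: "0 < \<eta>r" "\<eta>r \<le> \<epsilon> / 2" "c * \<eta>r \<le> \<eta> / 3"
  proof -
    show "0 < \<eta>r"
      using \<epsilon> \<eta> c by (auto simp: \<eta>r_def)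
    show "\<eta>r \<le> \<epsilon> / 2"
      unfolding \<eta>r_def by (rule min.cobounded1)
    have "c * \<eta>r \<le> c * (\<eta> / (3 * (c + 1)))"
      using c by (intro mult_left_mono) (auto simp: \<eta>r_def)
    also have "\<dots> \<le> \<eta> / 3"
      using c \<eta> by (simp add: field_simps)
    finally show "c * \<eta>r \<le> \<eta> / 3" .
  qed
  \<comment> \<open>Classes have at most 2 N / M0 vertices. The first summand makes this at most
    \<gamma> N, so label boxes are admissible; the second limits the repeated labels to one third of
    the error \<eta>.\<close>
  obtain M0 :: nat where M0: "2 / \<gamma> + 6 * (real (card I))\<^sup>2 / \<eta> < real M0"
    using reals_Archimedean2 by blast
  have M0': "0 < real M0" "2 \<le> \<gamma> * real M0" "6 * (real (card I))\<^sup>2 \<le> \<eta> * real M0"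
  proof -
    have pos: "0 < 2 / \<gamma>" "0 \<le> 6 * (real (card I))\<^sup>2 / \<eta>"
      using \<gamma> \<eta> by auto
    then show "0 < real M0"
      using M0 by linarith
    have "2 / \<gamma> \<le> real M0" "6 * (real (card I))\<^sup>2 / \<eta> \<le> real M0"
      using M0 pos by linarith+
    then show "2 \<le> \<gamma> * real M0" "6 * (real (card I))\<^sup>2 \<le> \<eta> * real M0"
      using \<gamma> \<eta> by (simp_all add: divide_le_eq mult.commute)
  qed
  obtain M :: nat where M: "\<And>V P0 (g :: 'a \<Rightarrow> 'a \<Rightarrow> real). finite V \<Longrightarrow> P0 ` V \<subseteq> {..<M0} \<Longrightarrow>
    (\<And>x y. x \<in> V \<Longrightarrow> y \<in> V \<Longrightarrow> 0 \<le> g x y \<and> g x y \<le> 1) \<Longrightarrow>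
    \<exists>P r. P ` V \<subseteq> {..<M} \<and> (\<forall>x. P0 x = r (P x)) \<and> regular_labelling V P g \<eta>r"
    using exists_regular_labelling[OF \<eta>r(1), where 'a = 'a, of M0] by blast
  \<comment> \<open>The error per box can only be fixed now, as it is multiplied by the number of
    label tuples.\<close>
  define \<theta> where "\<theta> = \<eta> / (3 * (real M ^ card I + 1))"
  have \<theta>: "0 < \<theta>" "real M ^ card I * \<theta> \<le> \<eta> / 3"
  proof -
    define z where "z = real M ^ card I"
    have "0 \<le> z"
      by (simp add: z_def)
    then show "0 < \<theta>" "real M ^ card I * \<theta> \<le> \<eta> / 3"
      using \<eta> unfolding \<theta>_def z_def[symmetric] by (simp_all add: field_simps add_nonneg_pos)
  qed
  show ?thesis
  \<comment> \<open>The size threshold is M0 itself: it absorbs the rounding in b M0 \<le> N + M0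
    \<le> 2 N.\<close>
  proof (rule that[OF \<theta>(1), of M0])
    fix V and g :: "'a \<Rightarrow> 'a \<Rightarrow> real"
    assume V: "finite V" "M0 \<le> card V" and g: "unit_kernel V g"
      and sym: "\<And>x y. x \<in> V \<Longrightarrow> y \<in> V \<Longrightarrow> g x y = g y x"
      and box: "\<And>U. (\<And>i. i \<in> I \<Longrightarrow> U i \<subseteq> V \<and> real (card (U i)) \<le> \<gamma> * real (card V)) \<Longrightarrow> disjoint_family_on U I \<Longrightarrow>
        \<bar>\<Sum>x\<in>PiE I U. kernel_prod (index_pairs I) (pattern_kernel A g) x - \<beta>\<bar> \<le> \<theta> * real (card V) ^ card I"
    define N where "N = real (card V)"
    have N: "0 < N" "real M0 \<le> N"
      using V M0'(1) by (auto simp: N_def)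
    have ne: "V \<noteq> {}"
      using N by (auto simp: N_def)
    have g': "0 \<le> g x y \<and> g x y \<le> 1" if "x \<in> V" "y \<in> V" for x y
      using g that by (auto simp: unit_kernel_def)
    obtain P0 where P0: "P0 ` V \<subseteq> {..<M0}" "\<And>l. card {x\<in>V. P0 x = l} \<le> card V div M0 + 1"
      using exists_small_classes[OF V(1), of M0] M0'(1) by auto
    obtain P r where P: "P ` V \<subseteq> {..<M}" "\<And>x. P0 x = r (P x)" "regular_labelling V P g \<eta>r"
      using M[OF V(1) P0(1), of g] g' by blast
    define b where "b = card V div M0 + 1"
    have Pb: "card {x\<in>V. P x = l} \<le> b" for l
    proof -
      have "card {x\<in>V. P x = l} \<le> card {x\<in>V. P0 x = r l}"
        using V P(2) by (intro card_mono) auto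
      then show ?thesis
        using P0(2)[of "r l"] by (simp add: b_def)
    qed
    have bN: "real b * real M0 \<le> 2 * N"
    proof -
      have "b * M0 \<le> card V + M0"
        by (simp add: b_def div_times_less_eq_dividend)
      then have "real b * real M0 \<le> N + real M0"
        unfolding N_def by (metis of_nat_add of_nat_le_iff of_nat_mult)
      then show ?thesis
        using N by simp
    qed
    have b\<gamma>: "real b \<le> \<gamma> * N"
    proof -
      have "2 * real b \<le> (\<gamma> * real M0) * real b"
        using M0'(2) by (intro mult_right_mono) auto
      also have "\<dots> \<le> \<gamma> * (2 * N)"
        using bN \<gamma> by (simp add: mult.commute mult.assoc)
      finally show ?thesis by simp
    qed
    have bk: "real ((card I)\<^sup>2 * b * card V ^ card I) \<le> N * (\<eta> / 3 * N ^ card I)"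
    proof -
      have "6 * (real (card I))\<^sup>2 * real b \<le> (\<eta> * real M0) * real b"
        using M0'(3) by (intro mult_right_mono) auto
      also have "\<dots> \<le> \<eta> * (2 * N)"
        using bN \<eta>(1) by (simp add: mult.commute mult.assoc)
      finally have "(real (card I))\<^sup>2 * real b \<le> \<eta> / 3 * N"
        by (simp add: mult_ac)
      then have "(real (card I))\<^sup>2 * real b * N ^ card I \<le> \<eta> / 3 * N * N ^ card I"
        using N by (intro mult_right_mono) auto
      then show ?thesis
        by (simp add: N_def mult_ac)
    qed
    define W where "W x y = block_mean V P g (P x) (P y)" for x y
    have W: "unit_kernel V W"
      using block_mean_unit[of V g P, OF g'] by (simp add: W_def unit_kernel_def)
    have Wsym: "W x y = W y x" for x y
      using block_mean_commute[of V g P, OF sym] by (simp add: W_def)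
    have cutW: "cut_close V P g W \<eta>r"
      unfolding cut_close_def W_def using regular_labelling_weighted[OF P(3) V(1)] by blast
    define w where "w e B C = (if e \<in> A then block_mean V P g B C else 1 - block_mean V P g B C)" for e B C
    have wW: "(\<lambda>x y. w e (P x) (P y)) = pattern_kernel A W e" for e
      by (auto simp: w_def pattern_kernel_def W_def fun_eq_iff)
    have wW': "(\<lambda>e x y. w e (P x) (P y)) = pattern_kernel A W"
      using wW by (simp add: fun_eq_iff)
    have "N * (\<Sum>x\<in>I \<rightarrow>\<^sub>E V. \<bar>kernel_prod (index_pairs I) (pattern_kernel A W) x - \<beta>\<bar>)
      \<le> N * (c * \<eta>r * N ^ card I + real M ^ card I * (\<theta> * N ^ card I))
        + real ((card I)\<^sup>2 * b * card V ^ card I)"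
      unfolding wW'[symmetric] N_def c_def
    proof (rule step_kernel_prod_L1[where K = "pattern_kernel A g"])
      show "0 \<le> w e B C \<and> w e B C \<le> 1" for e B C
        using block_mean_unit[of V g P B C, OF g'] by (simp add: w_def)
      show "cut_close V P (pattern_kernel A g e) (\<lambda>x y. w e (P x) (P y)) \<eta>r" for e
        unfolding wW using cutW by (rule cut_close_pattern_kernel)
    next
      fix U :: "nat \<Rightarrow> 'a set"
      assume U: "\<And>i. i \<in> I \<Longrightarrow> U i \<subseteq> V \<and> card (U i) \<le> b" "disjoint_family_on U I"
      show "\<bar>\<Sum>x\<in>PiE I U. kernel_prod (index_pairs I) (pattern_kernel A g) x - \<beta>\<bar> \<le> \<theta> * real (card V) ^ card I"
      proof (rule box[OF _ U(2)])
        fix i assume "i \<in> I"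
        then have "U i \<subseteq> V" "real (card (U i)) \<le> real b"
          using U(1) by auto
        then show "U i \<subseteq> V \<and> real (card (U i)) \<le> \<gamma> * real (card V)"
          using b\<gamma> by (simp add: N_def)
      qed
    qed (use fin V P Pb \<beta> \<theta> in \<open>auto intro!: unit_pattern_kernel g\<close>)
    also have "\<dots> \<le> N * (\<eta> / 3 * N ^ card I + \<eta> / 3 * N ^ card I) + N * (\<eta> / 3 * N ^ card I)"
      using bk \<eta>r(3) \<theta>(2) N
      by (intro add_mono mult_left_mono) (auto simp: mult.assoc[symmetric] intro!: mult_right_mono)
    also have "\<dots> = N * (\<eta> * N ^ card I)"
      by (simp add: algebra_simps)
    finally have L1: "(\<Sum>x\<in>I \<rightarrow>\<^sub>E V. \<bar>kernel_prod (index_pairs I) (pattern_kernel A W) x - \<beta>\<bar>) \<le> \<eta> * N ^ card I"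
      using N by simp
    define \<mu> where "\<mu> = kernel_mean V W"
    have \<mu>: "0 \<le> \<mu>" "\<mu> \<le> 1"
      using kernel_mean_unit[OF W V(1)] by (auto simp: \<mu>_def)
    have "\<eta> * N ^ card I \<le> \<eta>1 * N ^ card I"
      using \<eta>(2) N by (intro mult_right_mono) auto
    then have "(\<Sum>a\<in>V. \<Sum>b\<in>V. \<bar>W a b - \<mu>\<bar>) \<le> \<epsilon>' * N\<^sup>2"
      unfolding \<mu>_def N_def using \<eta>1(2)[OF V(1) ne W Wsym] L1 by (simp add: N_def)
    then have cut\<mu>: "cut_close V P W (\<lambda>_ _. \<mu>) \<epsilon>'" for P :: "'a \<Rightarrow> nat"
      unfolding N_def by (rule cut_close_L1[OF V(1)])
    have "cut_close V P g (\<lambda>_ _. \<mu>) \<epsilon>"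
      using \<eta>r(2) \<epsilon>'(2) by (intro cut_close_mono[OF cut_close_trans[OF cutW cut\<mu>]]) simp
    then have 1: "cut_close V (\<lambda>_. ()) g (\<lambda>_ _. \<mu>) \<epsilon>"
      by (rule cut_close_coarsen)
    define B where "B = (\<Prod>e\<in>index_pairs I. if e \<in> A then \<mu> else 1 - \<mu>)"
    have B: "kernel_prod (index_pairs I) (pattern_kernel A (\<lambda>_ _. \<mu>)) x = B" for x :: "nat \<Rightarrow> 'a"
      by (simp add: kernel_prod_def pattern_kernel_def B_def)
    have "\<bar>\<Sum>x\<in>I \<rightarrow>\<^sub>E V. (kernel_prod (index_pairs I) (pattern_kernel A W) x -
        kernel_prod (index_pairs I) (pattern_kernel A (\<lambda>_ _. \<mu>)) x) * 1\<bar>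
        \<le> c * \<epsilon>' * N ^ card I"
      unfolding c_def N_def
      by (intro kernel_prod_diff[where P = P and S = "\<lambda>_. 1"] fin V order_refl unit_pattern_kernel W cut_close_pattern_kernel cut\<mu>)
        (use \<mu> in \<open>auto simp: unit_kernel_def\<close>)
    then have 2: "\<bar>\<Sum>x\<in>I \<rightarrow>\<^sub>E V. kernel_prod (index_pairs I) (pattern_kernel A W) x - B\<bar> \<le> c * \<epsilon>' * N ^ card I"
      by (simp add: B)
    have "N ^ card I * (B - \<beta>) = (\<Sum>x\<in>I \<rightarrow>\<^sub>E V. B - \<beta>)"
      using fin by (simp add: card_funcset N_def)
    also have "\<dots> = (\<Sum>x\<in>I \<rightarrow>\<^sub>E V. kernel_prod (index_pairs I) (pattern_kernel A W) x - \<beta>) -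
        (\<Sum>x\<in>I \<rightarrow>\<^sub>E V. kernel_prod (index_pairs I) (pattern_kernel A W) x - B)"
      unfolding sum_subtractf[symmetric] by (intro sum.cong) auto
    also have "\<bar>\<dots>\<bar> \<le> \<bar>\<Sum>x\<in>I \<rightarrow>\<^sub>E V. kernel_prod (index_pairs I) (pattern_kernel A W) x - \<beta>\<bar> +
        \<bar>\<Sum>x\<in>I \<rightarrow>\<^sub>E V. kernel_prod (index_pairs I) (pattern_kernel A W) x - B\<bar>"
      by (rule abs_triangle_ineq4)
    also have "\<bar>\<Sum>x\<in>I \<rightarrow>\<^sub>E V. kernel_prod (index_pairs I) (pattern_kernel A W) x - \<beta>\<bar> \<le> \<eta> * N ^ card I"
      using L1 by (rule order_trans[OF sum_abs])
    finally have "\<bar>N ^ card I * (B - \<beta>)\<bar> \<le> \<eta> * N ^ card I + c * \<epsilon>' * N ^ card I"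
      using 2 by linarith
    then have "N ^ card I * \<bar>B - \<beta>\<bar> \<le> N ^ card I * (\<eta> + c * \<epsilon>')"
      using N unfolding abs_mult by (simp add: distrib_left mult_ac)
    then have "\<bar>B - \<beta>\<bar> \<le> \<eta> + c * \<epsilon>'"
      using N by simp
    then have "\<bar>B - \<beta>\<bar> \<le> \<epsilon>"
      using \<eta>(3) \<epsilon>'(3) by linarith
    then show "\<exists>\<mu>\<in>{0..1}. \<bar>(\<Prod>e\<in>index_pairs I. if e \<in> A then \<mu> else 1 - \<mu>) - \<beta>\<bar> \<le> \<epsilon> \<and>
        cut_close V (\<lambda>_. ()) g (\<lambda>_ _. \<mu>) \<epsilon>"
      using 1 \<mu> unfolding B_def by (intro bexI[of _ \<mu>]) auto
  qed
qed

section \<open>From cut distance to quasi-randomness\<close>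

definition adjacency :: "'a sgraph \<Rightarrow> 'a \<Rightarrow> 'a \<Rightarrow> real" where
  "adjacency G x y = of_bool ({x, y} \<in> edge_set G)"

definition edge_pairs :: "nat sgraph \<Rightarrow> (nat \<times> nat) set" where
  "edge_pairs F = {(i, j) \<in> index_pairs (vertices F). {i, j} \<in> edge_set F}"

lemma unit_adjacency: "unit_kernel V (adjacency G)"
  by (simp add: unit_kernel_def adjacency_def)

lemma adjacency_commute: "adjacency G x y = adjacency G y x"
  by (simp add: adjacency_def insert_commute)

lemma edge_not_loop: "simple_graph G \<Longrightarrow> {x, y} \<in> edge_set G \<Longrightarrow> x \<noteq> y"
  by (auto simp: simple_graph_def vertex_pairs_def)

lemma card_edge_pairs:
  assumes "simple_graph F"
  shows "card (edge_pairs F) = num_edges F"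
proof -
  have "bij_betw (\<lambda>(i, j). {i, j}) (edge_pairs F) (edge_set F)"
    unfolding bij_betw_def
  proof
    show "inj_on (\<lambda>(i, j). {i, j}) (edge_pairs F)"
      by (auto simp: inj_on_def edge_pairs_def index_pairs_def doubleton_eq_iff)
    show "(\<lambda>(i, j). {i, j}) ` edge_pairs F = edge_set F"
    proof
      show "edge_set F \<subseteq> (\<lambda>(i, j). {i, j}) ` edge_pairs F"
      proof
        fix e assume e: "e \<in> edge_set F"
        then have "e \<subseteq> vertices F" "card e = 2"
          using assms by (auto simp: simple_graph_def vertex_pairs_def)
        then obtain i j where ij: "e = {i, j}" "i \<noteq> j"
          by (auto simp: card_2_iff)
        define i' j' where "i' = min i j" and "j' = max i j"
        have "e = {i', j'}" "i' < j'"
          using ij by (auto simp: i'_def j'_def min_def max_def)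
        then have "(i', j') \<in> edge_pairs F"
          using e \<open>e \<subseteq> vertices F\<close> by (auto simp: edge_pairs_def index_pairs_def)
        then show "e \<in> (\<lambda>(i, j). {i, j}) ` edge_pairs F"
          using \<open>e = {i', j'}\<close> by (force intro: image_eqI[of _ _ "(i', j')"])
      qed
    qed (auto simp: edge_pairs_def)
  qed
  then show ?thesis
    unfolding num_edges_def by (rule bij_betw_same_card)
qed

lemma card_index_pairs:
  assumes "finite I"
  shows "card (index_pairs I) = card I choose 2"
proof -
  define K where "K = \<lparr>vertices = I, edge_set = vertex_pairs I\<rparr>"
  have "edge_pairs K = index_pairs I"
    by (auto simp: edge_pairs_def K_def index_pairs_def vertex_pairs_def)
  then have "card (index_pairs I) = card (vertex_pairs I)"
    using card_edge_pairs[of K] assms by (simp add: K_def simple_graph_def num_edges_def)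
  then show ?thesis
    unfolding vertex_pairs_def using n_subsets[OF assms] by simp
qed

lemma edge_pairs_subset: "edge_pairs F \<subseteq> index_pairs (vertices F)"
  by (auto simp: edge_pairs_def)

lemma num_edges_le:
  fixes F :: "nat sgraph"
  assumes "simple_graph F"
  shows "num_edges F \<le> num_verts F choose 2"
proof -
  have fin: "finite (vertices F)"
    using assms by (simp add: simple_graph_def)
  show ?thesis
    using card_mono[OF finite_index_pairs[OF fin] edge_pairs_subset]
    unfolding card_edge_pairs[OF assms] card_index_pairs[OF fin] num_verts_def .
qed

lemma complete_graph_iff:
  assumes "simple_graph F"
  shows "complete_graph F \<longleftrightarrow> num_edges F = num_verts F choose 2"
proof -
  have fin: "finite (vertices F)" and sub: "edge_set F \<subseteq> vertex_pairs (vertices F)"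
    using assms by (auto simp: simple_graph_def)
  have "finite (vertex_pairs (vertices F))" "card (vertex_pairs (vertices F)) = num_verts F choose 2"
    using fin n_subsets[OF fin, of 2] by (auto simp: vertex_pairs_def num_verts_def)
  then show ?thesis
    using sub by (metis card_subset_eq complete_graph_def num_edges_def)
qed

lemma empty_graph_iff:
  assumes "simple_graph F"
  shows "empty_graph F \<longleftrightarrow> num_edges F = 0"
proof -
  have "finite (edge_set F)"
    using assms by (rule_tac finite_subset[of _ "Pow (vertices F)"]) (auto simp: simple_graph_def vertex_pairs_def)
  then show ?thesis
    by (simp add: empty_graph_def num_edges_def)
qed

lemma prod_pattern_eq_beta_fun:
  assumes "simple_graph F"
  shows "(\<Prod>e\<in>index_pairs (vertices F). if e \<in> edge_pairs F then q else 1 - q) = beta_fun F q"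
proof -
  let ?I = "index_pairs (vertices F)" and ?A = "edge_pairs F"
  have fin: "finite (vertices F)"
    using assms by (simp add: simple_graph_def)
  have finI: "finite ?I"
    by (rule finite_index_pairs[OF fin])
  have "(\<Prod>e\<in>?I. if e \<in> ?A then q else 1 - q) = q ^ card (?I \<inter> ?A) * (1 - q) ^ card (?I \<inter> - ?A)"
    using finI by (simp add: prod.If_cases)
  also have "?I \<inter> ?A = ?A"
    using edge_pairs_subset by auto
  also have "?I \<inter> - ?A = ?I - ?A"
    by auto
  also have "card (?I - ?A) = card ?I - card ?A"
    using finI edge_pairs_subset finite_subset by (metis card_Diff_subset)
  finally show ?thesis
    by (simp add: beta_fun_def card_edge_pairs[OF assms] card_index_pairs[OF fin] num_verts_def)
qed

text \<open>Without injectivity the count is a sum of products of adjacency kernels, to which the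
  counting lemma applies with the constant sign 1; non-injective maps form the second error term.
  Multiplying by \<open>num_verts G\<close> avoids division by a possibly empty vertex set.\<close>

lemma inj_hom_count_approx:
  assumes G: "simple_graph G" and H: "simple_graph (H :: nat sgraph)" and q: "0 \<le> q" "q \<le> 1"
    and cut: "cut_close (vertices G) (\<lambda>_. ()) (adjacency G) (\<lambda>_ _. q) \<delta>"
  shows "real (num_verts G) * \<bar>real (inj_hom_count H G) - q ^ num_edges H * real (num_verts G) ^ num_verts H\<bar>
    \<le> real (num_verts G) * (real (num_edges H) * \<delta> * real (num_verts G) ^ num_verts H)
      + real ((num_verts H)\<^sup>2 * num_verts G ^ num_verts H)"
proof -
  define V I E N where "V = vertices G" and "I = vertices H" and "E = edge_pairs H" and "N = real (card V)"
  have fin: "finite V" "finite I"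
    using G H by (auto simp: simple_graph_def V_def I_def)
  have E: "E \<subseteq> index_pairs I" "finite E"
    using edge_pairs_subset finite_subset[OF edge_pairs_subset finite_index_pairs] fin
    by (auto simp: E_def I_def)
  have finP: "finite (I \<rightarrow>\<^sub>E V)"
    using fin by (simp add: finite_PiE)
  define h where "h x = kernel_prod E (\<lambda>_. adjacency G) x" for x
  define B where "B = {x \<in> I \<rightarrow>\<^sub>E V. \<not> inj_on x I}"
  have h: "h x = of_bool (\<forall>i\<in>I. \<forall>j\<in>I. {i, j} \<in> edge_set H \<longrightarrow> {x i, x j} \<in> edge_set G)" for x
  proof -
    have "h x = of_bool (\<forall>(i, j)\<in>E. {x i, x j} \<in> edge_set G)"
    proof (cases "\<forall>(i, j)\<in>E. {x i, x j} \<in> edge_set G")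
      case True
      then show ?thesis
        unfolding h_def kernel_prod_def by (auto simp: adjacency_def intro!: prod.neutral)
    next
      case False
      then show ?thesis
        unfolding h_def kernel_prod_def using E(2)
        by (auto simp: adjacency_def prod_zero_iff case_prod_beta)
    qed
    also have "(\<forall>(i, j)\<in>E. {x i, x j} \<in> edge_set G) \<longleftrightarrow>
        (\<forall>i\<in>I. \<forall>j\<in>I. {i, j} \<in> edge_set H \<longrightarrow> {x i, x j} \<in> edge_set G)"
    proof
      assume L: "\<forall>(i, j)\<in>E. {x i, x j} \<in> edge_set G"
      show "\<forall>i\<in>I. \<forall>j\<in>I. {i, j} \<in> edge_set H \<longrightarrow> {x i, x j} \<in> edge_set G"
      proof (intro ballI impI)
        fix i j assume ij: "i \<in> I" "j \<in> I" "{i, j} \<in> edge_set H"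
        then have "i \<noteq> j"
          using edge_not_loop[OF H] by auto
        then consider "(i, j) \<in> E" | "(j, i) \<in> E"
          using ij by (auto simp: E_def edge_pairs_def index_pairs_def I_def insert_commute neq_iff)
        then show "{x i, x j} \<in> edge_set G"
          using L by cases (auto simp: insert_commute)
      qed
    qed (auto simp: E_def edge_pairs_def index_pairs_def I_def)
    finally show ?thesis .
  qed
  have "real (inj_hom_count H G) = (\<Sum>x\<in>I \<rightarrow>\<^sub>E V. h x * of_bool (inj_on x I))"
    unfolding inj_hom_count_def I_def[symmetric] V_def[symmetric] h of_bool_conj[symmetric]
    using finP by (simp add: Int_def conj_commute)
  also have "\<dots> = (\<Sum>x\<in>I \<rightarrow>\<^sub>E V. h x) - (\<Sum>x\<in>I \<rightarrow>\<^sub>E V. h x * of_bool (\<not> inj_on x I))"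
    unfolding sum_subtractf[symmetric] by (intro sum.cong) auto
  finally have count: "real (inj_hom_count H G) =
      (\<Sum>x\<in>I \<rightarrow>\<^sub>E V. h x) - (\<Sum>x\<in>I \<rightarrow>\<^sub>E V. h x * of_bool (\<not> inj_on x I))" .
  have "(\<Sum>x\<in>I \<rightarrow>\<^sub>E V. h x * of_bool (\<not> inj_on x I)) \<le> (\<Sum>x\<in>I \<rightarrow>\<^sub>E V. of_bool (\<not> inj_on x I))"
    by (intro sum_mono) (simp add: h)
  also have "\<dots> = real (card B)"
    using finP by (simp add: B_def Int_def)
  finally have 1: "\<bar>\<Sum>x\<in>I \<rightarrow>\<^sub>E V. h x * of_bool (\<not> inj_on x I)\<bar> \<le> real (card B)"
    by (subst abs_of_nonneg) (auto simp: h intro!: sum_nonneg)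
  have "kernel_prod E (\<lambda>_ _ _. q) x = q ^ card E" for x :: "nat \<Rightarrow> 'a"
    by (simp add: kernel_prod_def)
  moreover have "\<bar>\<Sum>x\<in>I \<rightarrow>\<^sub>E V. (kernel_prod E (\<lambda>_. adjacency G) x - kernel_prod E (\<lambda>_ _ _. q) x)
      * 1\<bar> \<le> real (card E) * \<delta> * real (card V) ^ card I"
    using cut by (intro kernel_prod_diff[where P = "\<lambda>_. ()" and S = "\<lambda>_. 1"] fin E unit_adjacency) (use q in \<open>auto simp: unit_kernel_def V_def\<close>)
  ultimately have "\<bar>\<Sum>x\<in>I \<rightarrow>\<^sub>E V. h x - q ^ card E\<bar> \<le> real (card E) * \<delta> * N ^ card I"
    by (simp add: h_def N_def)
  moreover have "(\<Sum>x\<in>I \<rightarrow>\<^sub>E V. h x - q ^ card E) = (\<Sum>x\<in>I \<rightarrow>\<^sub>E V. h x) - q ^ card E * N ^ card I"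
    using fin by (simp add: sum_subtractf card_funcset N_def)
  ultimately have 2: "\<bar>real (inj_hom_count H G) - q ^ card E * N ^ card I\<bar> \<le> real (card E) * \<delta> * N ^ card I + real (card B)"
    using 1 unfolding count by linarith
  \<comment> \<open>With the identity as labelling the classes are at most singletons, so
    \<open>card_non_injective\<close> with b = 1 counts the maps that fail to be injective.\<close>
  have "card {x \<in> V. x = l} \<le> 1" for l
    by (rule order_trans[OF card_mono[of "{l}"]]) auto
  then have "card V * card B \<le> (card I)\<^sup>2 * 1 * card V ^ card I"
    unfolding B_def by (intro card_non_injective[OF fin(2,1), of "\<lambda>x. x" 1]) auto
  then have 3: "N * real (card B) \<le> real ((card I)\<^sup>2 * card V ^ card I)"
    unfolding N_def by (metis of_nat_le_iff of_nat_mult mult_1_right)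
  have "N * \<bar>real (inj_hom_count H G) - q ^ card E * N ^ card I\<bar> \<le>
      N * (real (card E) * \<delta> * N ^ card I + real (card B))"
    using 2 by (intro mult_left_mono) (auto simp: N_def)
  with 3 have "N * \<bar>real (inj_hom_count H G) - q ^ card E * N ^ card I\<bar> \<le>
      N * (real (card E) * \<delta> * N ^ card I) + real ((card I)\<^sup>2 * card V ^ card I)"
    by (simp add: algebra_simps)
  then show ?thesis
    unfolding E_def card_edge_pairs[OF H] by (simp add: N_def num_verts_def V_def I_def)
qed

lemma cut_close_imp_quasi_random:
  assumes G: "\<And>n. simple_graph (G n)" and lim: "filterlim (\<lambda>n. num_verts (G n)) at_top sequentially"
    and q: "0 \<le> q" "q \<le> 1"
    and cut: "\<And>\<epsilon>. 0 < \<epsilon> \<Longrightarrow> \<forall>\<^sub>F n in sequentially.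
      cut_close (vertices (G n)) (\<lambda>_. ()) (adjacency (G n)) (\<lambda>_ _. q) \<epsilon>"
  shows "quasi_random q G"
  unfolding quasi_random_def
proof (intro conjI allI impI lim)
  fix H :: "nat sgraph" assume H: "simple_graph H"
  show "(\<lambda>n. real (inj_hom_count H (G n)) - q ^ num_edges H * real (num_verts (G n)) ^ num_verts H)
    \<in> o(\<lambda>n. real (num_verts (G n)) ^ num_verts H)"
  proof (rule landau_o.smallI)
    fix c :: real assume c: "0 < c"
    define \<delta> where "\<delta> = c / (2 * (real (num_edges H) + 1))"
    have \<delta>: "0 < \<delta>" "real (num_edges H) * \<delta> \<le> c / 2"
      using c by (simp_all add: \<delta>_def field_simps)
    \<comment> \<open>\<delta> spends one half of \<open>c\<close> on the exchange of kernels; N0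
      keeps the non-injective maps within the other half.\<close>
    obtain N0 :: nat where N0: "2 * (real (num_verts H))\<^sup>2 / c < real N0"
      using reals_Archimedean2 by blast
    have "\<forall>\<^sub>F n in sequentially. N0 + 1 \<le> num_verts (G n)"
      using lim by (simp add: filterlim_at_top)
    then show "\<forall>\<^sub>F n in sequentially. norm (real (inj_hom_count H (G n)) - q ^ num_edges H * real (num_verts (G n)) ^ num_verts H)
        \<le> c * norm (real (num_verts (G n)) ^ num_verts H)"
      using cut[OF \<delta>(1)]
    proof eventually_elim
      case (elim n)
      define N h where "N = real (num_verts (G n))" and "h = num_verts H"
      have N: "0 < N" "2 * (real h)\<^sup>2 / c \<le> N"
        using elim(1) N0 by (auto simp: N_def h_def)
      have hN: "(real h)\<^sup>2 \<le> N * (c / 2)"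
        using N(2) c by (simp add: field_simps)
      let ?X = "\<bar>real (inj_hom_count H (G n)) - q ^ num_edges H * N ^ h\<bar>"
      have "N * ?X \<le> N * (real (num_edges H) * \<delta> * N ^ h) + real (h\<^sup>2 * num_verts (G n) ^ h)"
        using inj_hom_count_approx[OF G H q elim(2)] by (simp add: N_def h_def)
      also have "\<dots> = N * (real (num_edges H) * \<delta> * N ^ h) + (real h)\<^sup>2 * N ^ h"
        by (simp add: N_def)
      also have "\<dots> \<le> N * (c / 2 * N ^ h) + (N * (c / 2)) * N ^ h"
        using \<delta>(2) hN N by (intro add_mono mult_left_mono mult_right_mono) auto
      also have "\<dots> = N * (c * N ^ h)"
        by (simp add: algebra_simps)
      finally show ?case
        using N by (simp add: N_def h_def)
    qed
  qed
qed

text \<open>The index set of the first subsequence consists of those graphs that are at least as close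
  to \<open>p\<close> as to \<open>p'\<close>, phrased without naming the cut distance.\<close>

lemma dichotomy_imp_quasi_random2:
  assumes G: "\<And>n. simple_graph (G n)" and lim: "filterlim (\<lambda>n. num_verts (G n)) at_top sequentially"
    and p: "0 \<le> p" "p \<le> 1" and p': "0 \<le> p'" "p' \<le> 1"
    and cut: "\<And>\<epsilon>. 0 < \<epsilon> \<Longrightarrow> \<forall>\<^sub>F n in sequentially.
      cut_close (vertices (G n)) (\<lambda>_. ()) (adjacency (G n)) (\<lambda>_ _. p) \<epsilon> \<or>
      cut_close (vertices (G n)) (\<lambda>_. ()) (adjacency (G n)) (\<lambda>_ _. p') \<epsilon>"
  shows "quasi_random2 p p' G"
proof -
  define cc where "cc n q \<epsilon> = cut_close (vertices (G n)) (\<lambda>_. ()) (adjacency (G n)) (\<lambda>_ _. q) \<epsilon>" for n q \<epsilon>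
  have mono: "cc n q b" if "cc n q a" "a \<le> b" for n q a b
    using that cut_close_mono unfolding cc_def by blast
  define I1 where "I1 = {n. \<forall>\<epsilon>. cc n p' \<epsilon> \<longrightarrow> cc n p \<epsilon>}"
  have sub: "quasi_random q (G \<circ> enumerate I)"
    if I: "infinite I" and q: "0 \<le> q" "q \<le> 1"
      and imp: "\<And>n \<epsilon>. n \<in> I \<Longrightarrow> cc n p \<epsilon> \<or> cc n p' \<epsilon> \<Longrightarrow> cc n q \<epsilon>" for I :: "nat set" and q
  proof (rule cut_close_imp_quasi_random)
    have en: "filterlim (enumerate I) at_top sequentially"
      using strict_mono_enumerate[OF I] by (rule filterlim_subseq)
    show "simple_graph ((G \<circ> enumerate I) n)" for n
      using G by simp
    show "filterlim (\<lambda>n. num_verts ((G \<circ> enumerate I) n)) at_top sequentially"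
      using filterlim_compose[OF lim en] by simp
    fix \<epsilon> :: real assume "0 < \<epsilon>"
    then have "\<forall>\<^sub>F n in sequentially. cc n p \<epsilon> \<or> cc n p' \<epsilon>"
      using cut by (simp add: cc_def)
    then have "\<forall>\<^sub>F n in sequentially. cc (enumerate I n) p \<epsilon> \<or> cc (enumerate I n) p' \<epsilon>"
      using en by (rule eventually_compose_filterlim)
    then have "\<forall>\<^sub>F n in sequentially. cc (enumerate I n) q \<epsilon>"
      by (rule eventually_mono) (use imp enumerate_in_set[OF I] in blast)
    then show "\<forall>\<^sub>F n in sequentially. cut_close (vertices ((G \<circ> enumerate I) n)) (\<lambda>_. ())
        (adjacency ((G \<circ> enumerate I) n)) (\<lambda>_ _. q) \<epsilon>"
      by (simp add: cc_def)
  qed (use q in auto)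
  show ?thesis
    unfolding quasi_random2_def
  proof (intro exI conjI impI)
    show "I1 \<union> - I1 = UNIV" "I1 \<inter> - I1 = {}"
      by auto
    show "quasi_random p (G \<circ> enumerate I1)" if "infinite I1"
      using that p by (rule sub) (auto simp: I1_def)
    show "quasi_random p' (G \<circ> enumerate (- I1))" if "infinite (- I1)"
      using that p'
    proof (rule sub)
      fix n \<epsilon> assume n: "n \<in> - I1" and or: "cc n p \<epsilon> \<or> cc n p' \<epsilon>"
      \<comment> \<open>\<delta> witnesses that the graph is closer to p': for \<epsilon> <
        \<delta>, closeness to p at \<epsilon> would imply it at \<delta>.\<close>
      obtain \<delta> where \<delta>: "cc n p' \<delta>" "\<not> cc n p \<delta>"
        using n by (auto simp: I1_def)
      show "cc n p' \<epsilon>"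
      proof (cases "\<delta> \<le> \<epsilon>")
        case True
        then show ?thesis
          using \<delta> mono by blast
      next
        case False
        then show ?thesis
          using or \<delta> mono[of n p \<epsilon> \<delta>] by auto
      qed
    qed
  qed
qed

section \<open>The equation for the density\<close>

text \<open>The exponents are successors so that the lowered ones appear without truncated
  subtraction; the sign of the derivative is that of the last, linear factor.\<close>

lemma power_mult_power_has_derivative:
  fixes q :: real
  shows "((\<lambda>q. q ^ Suc a * (1 - q) ^ Suc b) has_real_derivative
    q ^ a * (1 - q) ^ b * (real (Suc a) * (1 - q) - real (Suc b) * q)) (at q)"
proof -
  have "((\<lambda>q. q ^ Suc a) has_real_derivative (1 + of_nat a) * (1 * q ^ a)) (at q)"
    by (rule DERIV_power_Suc) (rule DERIV_ident)
  moreover have "((\<lambda>q. (1 - q) ^ Suc b) has_real_derivative (1 + of_nat b) * ((0 - 1) * (1 - q) ^ b)) (at q)"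
    by (intro DERIV_power_Suc DERIV_diff DERIV_const DERIV_ident)
  ultimately show ?thesis
    by (rule DERIV_cong[OF DERIV_mult]) (simp add: algebra_simps)
qed

lemma power_mult_power_strict_increasing:
  fixes x y :: real
  assumes e: "0 < e" "0 < d" and xy: "0 \<le> x" "x < y" "y \<le> real e / real (e + d)"
  shows "x ^ e * (1 - x) ^ d < y ^ e * (1 - y) ^ d"
proof -
  obtain a b where ab: "e = Suc a" "d = Suc b"
    using e by (meson gr0_implies_Suc)
  have sgn: "real d * q < real e * (1 - q)" "0 < q" "q < 1" if "x < q" "q < y" for q
  proof -
    have "q < real e / real (e + d)"
      using that xy by linarith
    then have *: "q * real (e + d) < real e"
      using e by (simp add: pos_less_divide_eq)
    then show "real d * q < real e * (1 - q)"
      by (simp add: algebra_simps)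
    show "0 < q"
      using that xy by linarith
    have "real e / real (e + d) \<le> 1"
      using e by (simp add: divide_le_eq_1)
    then show "q < 1"
      using \<open>q < real e / real (e + d)\<close> by linarith
  qed
  show ?thesis
    unfolding ab
  proof (rule DERIV_pos_imp_increasing_open[OF xy(2)])
    fix q assume q: "x < q" "q < y"
    have "0 < q ^ a * (1 - q) ^ b * (real (Suc a) * (1 - q) - real (Suc b) * q)"
      using sgn[OF q] by (simp add: ab)
    then show "\<exists>z. ((\<lambda>q. q ^ Suc a * (1 - q) ^ Suc b) has_real_derivative z) (at q) \<and> 0 < z"
      using power_mult_power_has_derivative by blast
  qed (intro continuous_intros)
qed

text \<open>The reflection q to 1 - q exchanges the exponents and reduces this to the increasing
  case.\<close>

lemma power_mult_power_strict_decreasing: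
  fixes x y :: real
  assumes e: "0 < e" "0 < d" and xy: "real e / real (e + d) \<le> x" "x < y" "y \<le> 1"
  shows "y ^ e * (1 - y) ^ d < x ^ e * (1 - x) ^ d"
proof -
  have "1 - real e / real (e + d) = real d / real (d + e)"
    using e by (simp add: field_simps)
  then have "(1 - y) ^ d * (1 - (1 - y)) ^ e < (1 - x) ^ d * (1 - (1 - x)) ^ e"
    using xy e by (intro power_mult_power_strict_increasing) auto
  then show ?thesis
    by (simp add: mult.commute)
qed

text \<open>If both exponents are positive, \<open>beta_fun F\<close> vanishes at 0 and 1 and is
  strictly monotone on either side of the edge density t. For p other than t the intermediate value
  theorem gives a solution across t, and monotonicity makes it the only one, which justifies the
  \<open>THE\<close>. For empty or complete F one exponent is 0 and the other positive, so the
  function is injective on [0, 1].\<close>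

lemma conjugate_density_cases:
  fixes F :: "nat sgraph"
  assumes F: "simple_graph F" and k: "1 < num_verts F" and p: "0 < p" "p < 1"
  shows "conjugate_density F p \<in> {0..1}"
    and "q \<in> {0..1} \<Longrightarrow> beta_fun F q = beta_fun F p \<Longrightarrow> q = p \<or> q = conjugate_density F p"
proof -
  define e d where "e = num_edges F" and "d = (num_verts F choose 2) - num_edges F"
  have ed: "e + d = num_verts F choose 2"
    using num_edges_le[OF F] by (simp add: e_def d_def)
  have pos: "0 < num_verts F choose 2"
    using k by (simp add: zero_less_binomial_iff)
  have b: "beta_fun F q = q ^ e * (1 - q) ^ d" for q
    by (simp add: beta_fun_def e_def d_def)
  have "conjugate_density F p \<in> {0..1} \<and>
    (q \<in> {0..1} \<longrightarrow> beta_fun F q = beta_fun F p \<longrightarrow> q = p \<or> q = conjugate_density F p)" for q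
  proof (cases "empty_graph F \<or> complete_graph F")
    case True
    then have "e = 0 \<or> d = 0"
      using empty_graph_iff[OF F] complete_graph_iff[OF F] by (auto simp: e_def d_def)
    moreover have "q = p" if "q \<in> {0..1}" "beta_fun F q = beta_fun F p" "e = 0"
    proof -
      have "(1 - q) ^ d = (1 - p) ^ d" "0 < d"
        using that ed pos by (auto simp: b)
      then have "1 - q = 1 - p"
        using that p by (intro power_eq_imp_eq_base[of "1 - q" d "1 - p"]) auto
      then show ?thesis by simp
    qed
    moreover have "q = p" if "q \<in> {0..1}" "beta_fun F q = beta_fun F p" "d = 0"
    proof -
      have "q ^ e = p ^ e" "0 < e"
        using that ed pos by (auto simp: b)
      then show ?thesis
        using that p by (intro power_eq_imp_eq_base[of q e p]) auto
    qed
    moreover have "conjugate_density F p = p"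
      using True by (auto simp: conjugate_density_def)
    ultimately show ?thesis
      using p by auto
  next
    case False
    then have e: "0 < e" and d: "0 < d"
      using empty_graph_iff[OF F] complete_graph_iff[OF F] num_edges_le[OF F] by (auto simp: e_def d_def)
    define t where "t = real e / real (e + d)"
    have t: "edge_density F = t"
      unfolding edge_density_def t_def ed unfolding e_def ..
    have t01: "0 < t" "t < 1"
      using e d by (auto simp: t_def)
    have inc: "beta_fun F x < beta_fun F y" if "0 \<le> x" "x < y" "y \<le> t" for x y
      unfolding b using that e d by (intro power_mult_power_strict_increasing) (auto simp: t_def)
    have dec: "beta_fun F y < beta_fun F x" if "t \<le> x" "x < y" "y \<le> 1" for x y
      unfolding b using that e d by (intro power_mult_power_strict_decreasing) (auto simp: t_def)
    have cont: "continuous_on S (beta_fun F)" for S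
      unfolding b[abs_def] by (intro continuous_intros)
    have b01: "beta_fun F 0 = 0" "beta_fun F 1 = 0" "0 < beta_fun F p"
      using e d p by (auto simp: b)
    show ?thesis
    proof (cases "p = t")
      case True
      then have "conjugate_density F p = p"
        by (simp add: conjugate_density_def t)
      moreover have "q = p" if "q \<in> {0..1}" "beta_fun F q = beta_fun F p"
        using that inc[of q p] dec[of p q] True by (cases q p rule: linorder_cases) auto
      ultimately show ?thesis
        using p by auto
    next
      case pt: False
      have "\<exists>!r. r \<in> {0..1} \<and> r \<noteq> p \<and> beta_fun F r = beta_fun F p"
      proof (cases "p < t")
        case True
        obtain r where r: "t \<le> r" "r \<le> 1" "beta_fun F r = beta_fun F p"
          using IVT2'[of "beta_fun F" 1 "beta_fun F p" t] inc[of p t] True p t01 b01 cont by auto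
        have side: "t \<le> r'" if "r' \<in> {0..1}" "r' \<noteq> p" "beta_fun F r' = beta_fun F p" for r'
        proof (rule ccontr)
          assume "\<not> t \<le> r'"
          then show False
            using that inc[of r' p] inc[of p r'] True p by (cases r' p rule: linorder_cases) auto
        qed
        show ?thesis
        proof (rule ex1I[of _ r])
          show "r \<in> {0..1} \<and> r \<noteq> p \<and> beta_fun F r = beta_fun F p"
            using r t01 True by auto
          fix r' assume r': "r' \<in> {0..1} \<and> r' \<noteq> p \<and> beta_fun F r' = beta_fun F p"
          then show "r' = r"
            using side[of r'] r dec[of r r'] dec[of r' r] by (cases r r' rule: linorder_cases) auto
        qed
      next
        case False
        then have tp: "t < p"
          using pt by simp
        obtain r where r: "0 \<le> r" "r \<le> t" "beta_fun F r = beta_fun F p"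
          using IVT'[of "beta_fun F" 0 "beta_fun F p" t] dec[of t p] tp p t01 b01 cont by auto
        have side: "r' \<le> t" if "r' \<in> {0..1}" "r' \<noteq> p" "beta_fun F r' = beta_fun F p" for r'
        proof (rule ccontr)
          assume "\<not> r' \<le> t"
          then show False
            using that dec[of r' p] dec[of p r'] tp p by (cases r' p rule: linorder_cases) auto
        qed
        show ?thesis
        proof (rule ex1I[of _ r])
          show "r \<in> {0..1} \<and> r \<noteq> p \<and> beta_fun F r = beta_fun F p"
            using r t01 tp by auto
          fix r' assume r': "r' \<in> {0..1} \<and> r' \<noteq> p \<and> beta_fun F r' = beta_fun F p"
          then show "r' = r"
            using side[of r'] r inc[of r r'] inc[of r' r] by (cases r r' rule: linorder_cases) auto
        qed
      qed
      moreover have "conjugate_density F p = (THE r. r \<in> {0..1} \<and> r \<noteq> p \<and> beta_fun F r = beta_fun F p)"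
        using False pt by (simp add: conjugate_density_def t)
      ultimately show ?thesis
        using theI'[of "\<lambda>r. r \<in> {0..1} \<and> r \<noteq> p \<and> beta_fun F r = beta_fun F p"]
          the1_equality[of "\<lambda>r. r \<in> {0..1} \<and> r \<noteq> p \<and> beta_fun F r = beta_fun F p" q] by auto
    qed
  qed
  then show "conjugate_density F p \<in> {0..1}"
    and "q \<in> {0..1} \<Longrightarrow> beta_fun F q = beta_fun F p \<Longrightarrow> q = p \<or> q = conjugate_density F p"
    by blast+
qed

text \<open>Compactness: on the set of t in [0, 1] at distance at least \<epsilon> from both
  solutions the deviation attains a positive minimum, and half of it serves as \<delta>.\<close>

lemma beta_fun_near:
  fixes F :: "nat sgraph"
  assumes F: "simple_graph F" and k: "1 < num_verts F" and p: "0 < p" "p < 1" and \<epsilon>: "0 < \<epsilon>"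
  obtains \<delta> where "0 < \<delta>" "\<And>t. t \<in> {0..1} \<Longrightarrow> \<bar>beta_fun F t - beta_fun F p\<bar> \<le> \<delta> \<Longrightarrow>
    \<bar>t - p\<bar> \<le> \<epsilon> \<or> \<bar>t - conjugate_density F p\<bar> \<le> \<epsilon>"
proof -
  define K where "K = {0..1} \<inter> {t. \<epsilon> \<le> \<bar>t - p\<bar>} \<inter> {t. \<epsilon> \<le> \<bar>t - conjugate_density F p\<bar>}"
  have "compact K"
    unfolding K_def by (intro compact_Int_closed compact_Icc closed_Collect_le continuous_intros)
  have cont: "continuous_on K (\<lambda>t. \<bar>beta_fun F t - beta_fun F p\<bar>)"
    unfolding beta_fun_def by (intro continuous_intros)
  show ?thesis
  proof (cases "K = {}")
    case True
    show ?thesis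
      by (rule that[of 1]) (use True in \<open>auto simp: K_def not_le\<close>)
  next
    case False
    obtain t0 where t0: "t0 \<in> K" "\<And>t. t \<in> K \<Longrightarrow> \<bar>beta_fun F t0 - beta_fun F p\<bar> \<le> \<bar>beta_fun F t - beta_fun F p\<bar>"
      using continuous_attains_inf[OF \<open>compact K\<close> False cont] by auto
    have pos: "0 < \<bar>beta_fun F t0 - beta_fun F p\<bar>"
      using conjugate_density_cases(2)[OF F k p, of t0] t0(1) \<epsilon> by (auto simp: K_def)
    show ?thesis
    proof (rule that[of "\<bar>beta_fun F t0 - beta_fun F p\<bar> / 2"])
      fix t assume t: "t \<in> {0..1}" "\<bar>beta_fun F t - beta_fun F p\<bar> \<le> \<bar>beta_fun F t0 - beta_fun F p\<bar> / 2"
      then have "t \<notin> K"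
        using t0(2)[of t] pos by auto
      then show "\<bar>t - p\<bar> \<le> \<epsilon> \<or> \<bar>t - conjugate_density F p\<bar> \<le> \<epsilon>"
        using t(1) by (auto simp: K_def)
    qed (use pos in simp)
  qed
qed

section \<open>Induced counts as kernel products and the proof of the theorem\<close>

definition induced_indicator :: "nat sgraph \<Rightarrow> 'a sgraph \<Rightarrow> (nat \<Rightarrow> 'a) \<Rightarrow> real" where
  "induced_indicator F G x = of_bool (inj_on x (vertices F) \<and>
     (\<forall>i\<in>vertices F. \<forall>j\<in>vertices F. i \<noteq> j \<longrightarrow> ({i, j} \<in> edge_set F \<longleftrightarrow> {x i, x j} \<in> edge_set G)))"

lemma induced_count_eq_sum:
  assumes G: "simple_graph G" and F: "simple_graph F" and U: "\<And>i. i \<in> vertices F \<Longrightarrow> U i \<subseteq> vertices G"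
  shows "real (induced_count F G U) = (\<Sum>x\<in>PiE (vertices F) U. induced_indicator F G x)"
proof -
  have "finite (PiE (vertices F) U)"
    using G F U by (intro finite_PiE) (auto simp: simple_graph_def intro: finite_subset)
  moreover have "{\<phi> \<in> vertices F \<rightarrow>\<^sub>E vertices G. inj_on \<phi> (vertices F) \<and>
     (\<forall>i \<in> vertices F. \<phi> i \<in> U i) \<and>
     (\<forall>i \<in> vertices F. \<forall>j \<in> vertices F. i \<noteq> j \<longrightarrow>
        ({i, j} \<in> edge_set F \<longleftrightarrow> {\<phi> i, \<phi> j} \<in> edge_set G))} =
     {\<phi> \<in> PiE (vertices F) U. inj_on \<phi> (vertices F) \<and>
     (\<forall>i\<in>vertices F. \<forall>j\<in>vertices F. i \<noteq> j \<longrightarrow> ({i, j} \<in> edge_set F \<longleftrightarrow> {\<phi> i, \<phi> j} \<in> edge_set G))}"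
    using U by (auto simp: PiE_iff)
  ultimately show ?thesis
    unfolding induced_count_def induced_indicator_def by (simp add: Int_def)
qed

text \<open>Injectivity has to be assumed because the product does not see it: a non-edge of F whose
  ends are sent to one vertex still contributes the factor 1 in a simple graph. On pairwise disjoint
  boxes every map is injective.\<close>

lemma induced_indicator_eq_kernel_prod:
  assumes F: "simple_graph F" and inj: "inj_on x (vertices F)"
  shows "induced_indicator F G x =
    kernel_prod (index_pairs (vertices F)) (pattern_kernel (edge_pairs F) (adjacency G)) x"
proof -
  let ?I = "index_pairs (vertices F)"
  let ?ok = "\<lambda>i j. {i, j} \<in> edge_set F \<longleftrightarrow> {x i, x j} \<in> edge_set G"
  have fin: "finite ?I"
    using F by (intro finite_index_pairs) (simp add: simple_graph_def)
  have val: "pattern_kernel (edge_pairs F) (adjacency G) e (x (fst e)) (x (snd e)) = of_bool (?ok (fst e) (snd e))"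
    if "e \<in> ?I" for e
    using that by (cases e) (auto simp: pattern_kernel_def adjacency_def edge_pairs_def)
  have "kernel_prod ?I (pattern_kernel (edge_pairs F) (adjacency G)) x =
      (\<Prod>e\<in>?I. of_bool (?ok (fst e) (snd e)))"
    unfolding kernel_prod_def using val by (rule prod.cong[OF refl])
  also have "\<dots> = of_bool (\<forall>e\<in>?I. ?ok (fst e) (snd e))"
  proof (cases "\<forall>e\<in>?I. ?ok (fst e) (snd e)")
    case True
    then show ?thesis by (simp add: prod.neutral)
  next
    case False
    then show ?thesis
      using fin by (subst prod_zero) auto
  qed
  also have "(\<forall>e\<in>?I. ?ok (fst e) (snd e)) \<longleftrightarrow>
      (\<forall>i\<in>vertices F. \<forall>j\<in>vertices F. i \<noteq> j \<longrightarrow> ?ok i j)"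
  proof
    assume L: "\<forall>e\<in>?I. ?ok (fst e) (snd e)"
    show "\<forall>i\<in>vertices F. \<forall>j\<in>vertices F. i \<noteq> j \<longrightarrow> ?ok i j"
    proof (intro ballI impI)
      fix i j assume ij: "i \<in> vertices F" "j \<in> vertices F" "i \<noteq> j"
      then consider "(i, j) \<in> ?I" | "(j, i) \<in> ?I"
        by (auto simp: index_pairs_def neq_iff)
      then show "?ok i j"
        using L by cases (force simp: insert_commute)+
    qed
  qed (auto simp: index_pairs_def)
  finally show ?thesis
    using inj by (simp add: induced_indicator_def)
qed

text \<open>Both versions of the theorem are instances, selected by \<open>D\<close>. The number
  \<kappa> is the proportion of vertices certainly left over once the prescribed sets are removed;
  passing to smaller boxes costs (2/\<kappa>)^k, a constant that the null sequence \<open>e\<close>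
  absorbs.\<close>

lemma fixed_size_counts_imp_quasi_random2:
  fixes G :: "nat \<Rightarrow> 'a sgraph" and F :: "nat sgraph"
  assumes G: "\<And>n. simple_graph (G n)" and lim: "filterlim (\<lambda>n. num_verts (G n)) at_top sequentially"
    and F: "simple_graph F" and k: "1 < num_verts F" and p: "0 < p" "p < 1" and \<gamma>: "0 < \<gamma>"
    and \<kappa>: "0 < \<kappa>" "(if D then real (num_verts F) * \<gamma> else \<gamma>) \<le> 1 - \<kappa>"
    and e: "e \<longlonglongrightarrow> (0 :: real)"
    and count: "\<And>n U. (\<And>i. i \<in> vertices F \<Longrightarrow> U i \<subseteq> vertices (G n) \<and>
        card (U i) = nat \<lfloor>\<gamma> * real (num_verts (G n))\<rfloor>) \<Longrightarrow> (D \<Longrightarrow> disjoint_family_on U (vertices F)) \<Longrightarrow>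
      \<bar>real (induced_count F (G n) U) - beta_fun F p * (\<Prod>i\<in>vertices F. real (card (U i)))\<bar>
        \<le> e n * real (num_verts (G n)) ^ num_verts F"
  shows "quasi_random2 p (conjugate_density F p) G"
proof (rule dichotomy_imp_quasi_random2[OF G lim])
  show "0 \<le> p" "p \<le> 1"
    using p by simp_all
  have "conjugate_density F p \<in> {0..1}"
    by (rule conjugate_density_cases(1)[OF F k p])
  then show "0 \<le> conjugate_density F p" "conjugate_density F p \<le> 1"
    by simp_all
  define I where "I = vertices F"
  have I: "finite I" "card I = num_verts F" "2 \<le> card I"
    using F k by (auto simp: simple_graph_def num_verts_def I_def)
  define \<beta> where "\<beta> = beta_fun F p"
  have \<beta>: "0 < \<beta>" "\<beta> \<le> 1"
    using p by (auto simp: \<beta>_def beta_fun_def intro!: mult_pos_pos mult_le_one power_le_one)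
  fix \<epsilon> :: real assume \<epsilon>: "0 < \<epsilon>"
  obtain \<delta> where \<delta>: "0 < \<delta>" "\<And>t. t \<in> {0..1} \<Longrightarrow> \<bar>beta_fun F t - beta_fun F p\<bar> \<le> \<delta> \<Longrightarrow>
    \<bar>t - p\<bar> \<le> \<epsilon> / 2 \<or> \<bar>t - conjugate_density F p\<bar> \<le> \<epsilon> / 2"
    using beta_fun_near[OF F k p, of "\<epsilon> / 2"] \<epsilon> by auto
  define \<epsilon>1 where "\<epsilon>1 = min \<delta> (\<epsilon> / 2)"
  have \<epsilon>1: "0 < \<epsilon>1" "\<epsilon>1 \<le> \<delta>" "\<epsilon>1 \<le> \<epsilon> / 2"
    using \<delta>(1) \<epsilon> unfolding \<epsilon>1_def by (auto intro: min.cobounded1 min.cobounded2)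
  have \<gamma>2: "0 < \<gamma> / 2"
    using \<gamma> by simp
  obtain \<theta> N0 where \<theta>: "0 < \<theta>" and main: "\<And>V (g :: 'a \<Rightarrow> 'a \<Rightarrow> real). finite V \<Longrightarrow> N0 \<le> card V \<Longrightarrow> unit_kernel V g \<Longrightarrow>
    (\<And>x y. x \<in> V \<Longrightarrow> y \<in> V \<Longrightarrow> g x y = g y x) \<Longrightarrow>
    (\<And>U. (\<And>i. i \<in> I \<Longrightarrow> U i \<subseteq> V \<and> real (card (U i)) \<le> \<gamma> / 2 * real (card V)) \<Longrightarrow> disjoint_family_on U I \<Longrightarrow>
      \<bar>\<Sum>x\<in>PiE I U. kernel_prod (index_pairs I) (pattern_kernel (edge_pairs F) g) x - \<beta>\<bar> \<le> \<theta> * real (card V) ^ card I) \<Longrightarrow>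
    \<exists>\<mu>\<in>{0..1}. \<bar>(\<Prod>e\<in>index_pairs I. if e \<in> edge_pairs F then \<mu> else 1 - \<mu>) - \<beta>\<bar> \<le> \<epsilon>1 \<and>
      cut_close V (\<lambda>_. ()) g (\<lambda>_ _. \<mu>) \<epsilon>1"
    using box_counts_imp_cut_close_const[OF I(1,3) \<beta> \<epsilon>1(1) \<gamma>2, where A = "edge_pairs F" and 'a = 'a] by blast
  \<comment> \<open>Once N \<ge> 2/\<gamma>, the floor m of \<gamma> N is at least \<gamma> N / 2,
    so boxes of density at most \<gamma>/2 have at most m elements.\<close>
  obtain N1 :: nat where N1: "2 / \<gamma> < real N1"
    using reals_Archimedean2 by blast
  have "\<forall>\<^sub>F n in sequentially. N0 + N1 + 1 \<le> num_verts (G n)"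
    using lim by (simp add: filterlim_at_top)
  moreover have "(\<lambda>n. \<bar>e n\<bar> * (2 / \<kappa>) ^ card I) \<longlonglongrightarrow> \<bar>0\<bar> * (2 / \<kappa>) ^ card I"
    by (intro tendsto_intros e)
  then have "\<forall>\<^sub>F n in sequentially. \<bar>e n\<bar> * (2 / \<kappa>) ^ card I < \<theta>"
    using \<theta> by (intro order_tendstoD) simp_all
  ultimately show "\<forall>\<^sub>F n in sequentially.
      cut_close (vertices (G n)) (\<lambda>_. ()) (adjacency (G n)) (\<lambda>_ _. p) \<epsilon> \<or>
      cut_close (vertices (G n)) (\<lambda>_. ()) (adjacency (G n)) (\<lambda>_ _. conjugate_density F p) \<epsilon>"
  proof eventually_elim
    case (elim n)
    define V N where "V = vertices (G n)" and "N = real (card V)"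
    have V: "finite V" "card V = num_verts (G n)"
      using G[of n] by (auto simp: V_def simple_graph_def num_verts_def)
    have N: "0 < N" "2 / \<gamma> \<le> N" "N0 \<le> card V"
      using elim(1) N1 V by (auto simp: N_def)
    define m where "m = nat \<lfloor>\<gamma> * N\<rfloor>"
    have m: "real m \<le> \<gamma> * N" "\<gamma> / 2 * N \<le> real m"
    proof -
      have "0 \<le> \<gamma> * N"
        using \<gamma> N by simp
      then have "real m = of_int \<lfloor>\<gamma> * N\<rfloor>"
        by (simp add: m_def)
      moreover have "2 \<le> \<gamma> * N"
        using N(2) \<gamma> by (simp add: pos_divide_le_eq mult.commute)
      ultimately show "real m \<le> \<gamma> * N" "\<gamma> / 2 * N \<le> real m"
        by linarith+
    qed
    define c where "c = (if D then card I * m else m)"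
    have c: "real c \<le> (1 - \<kappa>) * N"
    proof -
      have "real c \<le> (if D then real (num_verts F) * \<gamma> else \<gamma>) * N"
        using m(1) by (auto simp: c_def I mult.assoc intro: mult_left_mono)
      also have "\<dots> \<le> (1 - \<kappa>) * N"
        using \<kappa>(2) N by (intro mult_right_mono) auto
      finally show ?thesis .
    qed
    define r where "r = card V - c"
    have cV: "c < card V"
    proof -
      have "0 < \<kappa> * N"
        using \<kappa> N by simp
      then have "real c < real (card V)"
        using c by (simp add: N_def algebra_simps)
      then show ?thesis by simp
    qed
    then have r: "0 < r" "c + r \<le> card V" "\<kappa> * N \<le> real r"
      using c by (auto simp: r_def N_def algebra_simps of_nat_diff)
    have e0: "\<bar>\<Sum>x\<in>PiE I U. induced_indicator F (G n) x - \<beta>\<bar> \<le> \<bar>e n\<bar> * N ^ card I"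
      if U: "\<And>i. i \<in> I \<Longrightarrow> U i \<subseteq> V \<and> card (U i) = m" "D \<Longrightarrow> disjoint_family_on U I" for U
    proof -
      have "(\<Sum>x\<in>PiE I U. induced_indicator F (G n) x - \<beta>) =
          real (induced_count F (G n) U) - \<beta> * (\<Prod>i\<in>I. real (card (U i)))"
        using induced_count_eq_sum[OF G F, of U n] U(1) I(1)
        by (simp add: sum_subtractf card_PiE I_def V_def mult.commute)
      moreover have "\<bar>\<dots>\<bar> \<le> e n * N ^ num_verts F"
        using count[of U n] U V unfolding \<beta>_def I_def N_def m_def V_def by auto
      moreover have "e n * N ^ num_verts F \<le> \<bar>e n\<bar> * N ^ card I"
        unfolding I(2) using N by (intro mult_right_mono) auto
      ultimately show ?thesis
        by linarith
    qed
    \<comment> \<open>Sizes are relaxed for the induced indicator, which is what the hypothesis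
      counts even on overlapping sets. The kernel product replaces it only on the final disjoint
      box, where the two agree.\<close>
    have box: "\<bar>\<Sum>x\<in>PiE I U. kernel_prod (index_pairs I) (pattern_kernel (edge_pairs F) (adjacency (G n))) x - \<beta>\<bar>
        \<le> \<theta> * real (card V) ^ card I"
      if U: "\<And>i. i \<in> I \<Longrightarrow> U i \<subseteq> V \<and> real (card (U i)) \<le> \<gamma> / 2 * real (card V)" "disjoint_family_on U I" for U
    proof -
      have "inj_on x I" if "x \<in> PiE I U" for x
        using that U(2) by (auto simp: inj_on_def disjoint_family_on_def) (metis PiE_mem disjoint_iff)
      then have "(\<Sum>x\<in>PiE I U. kernel_prod (index_pairs I) (pattern_kernel (edge_pairs F) (adjacency (G n))) x - \<beta>) =
          (\<Sum>x\<in>PiE I U. induced_indicator F (G n) x - \<beta>)"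
        unfolding I_def by (intro sum.cong refl) (simp add: induced_indicator_eq_kernel_prod[OF F])
      moreover have "\<bar>\<Sum>x\<in>PiE I U. induced_indicator F (G n) x - \<beta>\<bar> \<le>
          (2 * real (card V) / real r) ^ card I * (\<bar>e n\<bar> * N ^ card I)"
      proof (rule sum_box_le_from_fixed_size[OF V(1) I(1) r(1), where D = D and m = m])
        show "(if D then card I * m else m) + r \<le> card V"
          using r(2) unfolding c_def .
        show "\<bar>\<Sum>x\<in>PiE I U'. induced_indicator F (G n) x - \<beta>\<bar> \<le> \<bar>e n\<bar> * N ^ card I"
          if "\<And>i. i \<in> I \<Longrightarrow> U' i \<subseteq> V \<and> card (U' i) = m" "D \<Longrightarrow> disjoint_family_on U' I" for U'
          using that by (rule e0)
        show "U i \<subseteq> V \<and> card (U i) \<le> m" if "i \<in> I" for i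
        proof -
          have "real (card (U i)) \<le> real m"
            using U(1)[OF that] m(2) by (simp add: N_def)
          then show ?thesis
            using U(1)[OF that] by simp
        qed
      qed (rule U(2))
      moreover have "(2 * real (card V) / real r) ^ card I * (\<bar>e n\<bar> * N ^ card I) \<le> \<theta> * N ^ card I"
      proof -
        have "2 * real (card V) / real r \<le> 2 / \<kappa>"
          using r(1,3) \<kappa>(1) by (simp add: N_def field_simps)
        then have "(2 * real (card V) / real r) ^ card I \<le> (2 / \<kappa>) ^ card I"
          by (intro power_mono) auto
        then have "(2 * real (card V) / real r) ^ card I * (\<bar>e n\<bar> * N ^ card I) \<le> (2 / \<kappa>) ^ card I * (\<bar>e n\<bar> * N ^ card I)"
          using N by (intro mult_right_mono) auto
        also have "\<dots> = (\<bar>e n\<bar> * (2 / \<kappa>) ^ card I) * N ^ card I"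
          by simp
        also have "\<dots> \<le> \<theta> * N ^ card I"
          using elim(2) N by (intro mult_right_mono) auto
        finally show ?thesis .
      qed
      ultimately show ?thesis
        by (simp add: N_def)
    qed
    have "\<exists>\<mu>\<in>{0..1}. \<bar>(\<Prod>e\<in>index_pairs I. if e \<in> edge_pairs F then \<mu> else 1 - \<mu>) - \<beta>\<bar> \<le> \<epsilon>1 \<and>
        cut_close V (\<lambda>_. ()) (adjacency (G n)) (\<lambda>_ _. \<mu>) \<epsilon>1"
    proof (rule main[of V "adjacency (G n)"])
      show "adjacency (G n) x y = adjacency (G n) y x" for x y
        by (rule adjacency_commute)
    qed (use V(1) N(3) unit_adjacency box in blast)+
    then obtain \<mu> where \<mu>: "\<mu> \<in> {0..1}"
      "\<bar>(\<Prod>e\<in>index_pairs I. if e \<in> edge_pairs F then \<mu> else 1 - \<mu>) - \<beta>\<bar> \<le> \<epsilon>1"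
      "cut_close V (\<lambda>_. ()) (adjacency (G n)) (\<lambda>_ _. \<mu>) \<epsilon>1"
      by blast
    have "\<bar>beta_fun F \<mu> - beta_fun F p\<bar> \<le> \<delta>"
      using \<mu>(2) \<epsilon>1(2) prod_pattern_eq_beta_fun[OF F, of \<mu>] by (simp add: I_def \<beta>_def)
    moreover have "cut_close V (\<lambda>_. ()) (adjacency (G n)) (\<lambda>_ _. q) \<epsilon>" if "\<bar>\<mu> - q\<bar> \<le> \<epsilon> / 2" for q
    proof -
      have "(\<Sum>x\<in>V. \<Sum>y\<in>V. \<bar>\<mu> - q\<bar>) = \<bar>\<mu> - q\<bar> * (real (card V))\<^sup>2"
        by (simp add: power2_eq_square)
      also have "\<dots> \<le> \<epsilon> / 2 * (real (card V))\<^sup>2"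
        using that by (intro mult_right_mono) auto
      finally have "cut_close V (\<lambda>_. ()) (\<lambda>_ _. \<mu>) (\<lambda>_ _. q) (\<epsilon> / 2)"
        by (rule cut_close_L1[OF V(1)])
      then show ?thesis
        using \<epsilon>1(3) by (intro cut_close_mono[OF cut_close_trans[OF \<mu>(3)]]) auto
    qed
    ultimately show ?case
      using \<delta>(2)[OF \<mu>(1)] unfolding V_def by blast
  qed
qed

theorem theorem3p12:
  fixes G :: "nat \<Rightarrow> 'a sgraph" and F :: "nat sgraph" and k :: nat and p \<gamma> :: real
  assumes "\<And>n. simple_graph (G n)"
    and "filterlim (\<lambda>n. num_verts (G n)) at_top sequentially"
    and "simple_graph F" and "vertices F = {1..k}" and "k > 1"
    and "0 < p" and "p < 1" and "0 < \<gamma>" and "\<gamma> < 1"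
  shows "((\<exists>\<epsilon> :: nat \<Rightarrow> real. \<epsilon> \<longlonglongrightarrow> 0 \<and>
            (\<forall>n. \<forall>U :: nat \<Rightarrow> 'a set.
               (\<forall>i \<in> {1..k}. U i \<subseteq> vertices (G n) \<and>
                  card (U i) = nat \<lfloor>\<gamma> * real (num_verts (G n))\<rfloor>) \<longrightarrow>
               \<bar>real (induced_count F (G n) U)
                  - p ^ num_edges F * (1 - p) ^ ((k choose 2) - num_edges F)
                    * (\<Prod>i = 1..k. real (card (U i)))\<bar>
                 \<le> \<epsilon> n * real (num_verts (G n)) ^ k))
          \<longrightarrow> quasi_random2 p (conjugate_density F p) G)
       \<and> (\<gamma> < 1 / real k \<and>
          (\<exists>\<epsilon> :: nat \<Rightarrow> real. \<epsilon> \<longlonglongrightarrow> 0 \<and>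
            (\<forall>n. \<forall>U :: nat \<Rightarrow> 'a set.
               (\<forall>i \<in> {1..k}. U i \<subseteq> vertices (G n) \<and>
                  card (U i) = nat \<lfloor>\<gamma> * real (num_verts (G n))\<rfloor>) \<and>
               disjoint_family_on U {1..k} \<longrightarrow>
               \<bar>real (induced_count F (G n) U)
                  - p ^ num_edges F * (1 - p) ^ ((k choose 2) - num_edges F)
                    * (\<Prod>i = 1..k. real (card (U i)))\<bar>
                 \<le> \<epsilon> n * real (num_verts (G n)) ^ k))
          \<longrightarrow> quasi_random2 p (conjugate_density F p) G)"
proof (intro conjI impI; (elim conjE exE)?)
  have nF: "num_verts F = k"
    by (simp add: num_verts_def assms(4))
  have k: "1 < num_verts F"
    using assms(5) nF by simp
  have \<beta>: "p ^ num_edges F * (1 - p) ^ ((k choose 2) - num_edges F) = beta_fun F p"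
    by (simp add: beta_fun_def nF)
  {
    fix \<epsilon> :: "nat \<Rightarrow> real"
    assume \<epsilon>: "\<epsilon> \<longlonglongrightarrow> 0"
      and count: "\<forall>n. \<forall>U :: nat \<Rightarrow> 'a set.
               (\<forall>i \<in> {1..k}. U i \<subseteq> vertices (G n) \<and>
                  card (U i) = nat \<lfloor>\<gamma> * real (num_verts (G n))\<rfloor>) \<longrightarrow>
               \<bar>real (induced_count F (G n) U)
                  - p ^ num_edges F * (1 - p) ^ ((k choose 2) - num_edges F)
                    * (\<Prod>i = 1..k. real (card (U i)))\<bar>
                 \<le> \<epsilon> n * real (num_verts (G n)) ^ k"
    show "quasi_random2 p (conjugate_density F p) G"
      \<comment> \<open>The sets may coincide, so a single one is removed and the proportion 1 -
        \<gamma> is left.\<close>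
      by (rule fixed_size_counts_imp_quasi_random2[where D = False and \<kappa> = "1 - \<gamma>" and \<gamma> = \<gamma> and e = \<epsilon>])
        (use assms k \<epsilon> count in \<open>auto simp: nF \<beta>\<close>)
  next
    fix \<epsilon> :: "nat \<Rightarrow> real"
    assume \<gamma>: "\<gamma> < 1 / real k" and \<epsilon>: "\<epsilon> \<longlonglongrightarrow> 0"
      and count: "\<forall>n. \<forall>U :: nat \<Rightarrow> 'a set.
               (\<forall>i \<in> {1..k}. U i \<subseteq> vertices (G n) \<and>
                  card (U i) = nat \<lfloor>\<gamma> * real (num_verts (G n))\<rfloor>) \<and>
               disjoint_family_on U {1..k} \<longrightarrow>
               \<bar>real (induced_count F (G n) U)
                  - p ^ num_edges F * (1 - p) ^ ((k choose 2) - num_edges F)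
                    * (\<Prod>i = 1..k. real (card (U i)))\<bar>
                 \<le> \<epsilon> n * real (num_verts (G n)) ^ k"
    \<comment> \<open>Disjoint sets use the proportion k \<gamma> of the vertices; \<gamma> < 1/k
      says precisely that something is left over.\<close>
    have "0 < 1 - real k * \<gamma>"
      using \<gamma> assms(5) by (simp add: field_simps)
    then show "quasi_random2 p (conjugate_density F p) G"
      by (intro fixed_size_counts_imp_quasi_random2[where D = True and \<kappa> = "1 - real k * \<gamma>" and \<gamma> = \<gamma> and e = \<epsilon>])
        (use assms k \<epsilon> count in \<open>auto simp: nF \<beta>\<close>)
  }
qed

end
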